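(* Let $k$ be a commutative ring with unit, $A$ an associative unital $k$-algebra and $B$ a $k$-subalgebra of $\mathrm{End}_k(A)$ containing the multiplication algebra $M(A)$. Let $A$ be $B$-semiprime and let $\widehat{A}$ be the self-injective hull of $A$ as a left $B$-module. Then: (1) $\widehat{A}=Q_{\mathcal D}(A)$ is the torsion theoretic quotient module of $A$ with respect to the Lambek torsion theory $\mathcal D$ in $\sigma[{}_BA]$, and $$\widehat{A}^B\simeq \varinjlim\{\mathrm{Hom}_B(I,A)\mid I \text{ is an essential } B\text{-submodule of } A\}.$$ (2) The map $\phi: A\otimes_{A^B}\mathrm{End}_B(\widehat{A})\to\widehat{A}$ with $\phi(a\otimes f):=(a)f$ is left $B$-linear. Its kernel is an ideal, and thus one can define a ring structure on $\widehat{A}$ given by the multiplication $$(as)\cdot(bt):=(ab)\,st\qquad\text{for all } a,b\in A,\ s,t\in\widehat{A}^B,$$ where $A$ is a subring of $\widehat{A}$. Let $\widehat{B}:=\langle B,\widehat{A}^B\rangle\subseteq\mathrm{End}_k(\widehat{A})$. Then $\widehat{A}\subseteq M(\widehat{A})\subseteq\widehat{B}$ is again an extension with additional module structure, and the following hold: (3) $\widehat{A}$ is $\widehat{B}$-semiprime and a self-injective $\widehat{B}$-module. (4) $\widehat{A}$ is a non-singular $\widehat{A}^B$-module. (5) $A$ is $B$-prime if and only if $\widehat{A}$ is $\widehat{B}$-prime.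
   Context: Conventions: all algebras are associative with unit. For $a\in A$ let $L_a(x)=ax$, $R_a(x)=xa$; $M(A)\subseteq\mathrm{End}_k(A)$ is the $k$-subalgebra generated by all $L_a,R_a$ ($a\in A$). $A$ is identified with $\{L_a\mid a\in A\}\subseteq B$. $A$ is a left $B$-module via $b\cdot a=b(a)$. Homomorphisms of left modules are written on the right, $(x)(f\circ g)=((x)f)g$. An extension $A\subseteq B$ of $k$-algebras is an extension with additional module structure $\varphi$ if $\varphi:B\to\mathrm{End}_k(A)$ is a ring homomorphism with $\varphi(a)=L_a$ for all $a\in A$. $B$-submodules of $A$ are automatically two-sided ideals (as $M(A)\subseteq B$) and are called $B$-stable ideals. $A$ is $B$-prime (resp. $B$-semiprime) if for all $B$-stable ideals $K,L$ of $A$, $KL=0$ implies $K=0$ or $L=0$ (resp. $K^2=0$ implies $K=0$). The same terminology is used for $\widehat{A}$ and $\widehat{B}$. For a left $B$-module $N$, $N^B:=\{m\in N\mid b\cdot m=(b\cdot 1_A)\,m\ \ \forall b\in B\}$. $A^B$ is a subring of the centre $Z(A)$ of $A$. For a module $M$ with injective hull $E(M)$, the self-injective hull is $\widehat{M}=\sum_{f\in\mathrm{Hom}(M,E(M))}\mathrm{Im}(f)$, the largest $M$-generated submodule of $E(M)$. A module $M$ is self-injective if every homomorphism from a submodule of $M$ to $M$ extends to an endomorphism of $M$. $\sigma[M]$ is the full subcategory of modules that are submodules of $M$-generated modules. The Lambek torsion theory in $\sigma[M]$ has as torsion class all $X\in\sigma[M]$ with $\mathrm{Hom}(X,\widehat{M})=0$.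 For a torsion-free module $N\in\sigma[M]$ with injective hull $\widehat{N}$ in $\sigma[M]$, the quotient module $Q_{\mathcal D}(N)$ is the submodule of $\widehat{N}$ containing $N$ such that $Q_{\mathcal D}(N)/N$ is the torsion submodule of $\widehat{N}/N$. The map $\mathrm{End}_B(\widehat{A})\to\widehat{A}^B$, $f\mapsto(1_A)f$, is a bijection and $\widehat{A}^B$ carries the (commutative) ring structure transported along it, $(1_A)f\cdot(1_A)g=(1_A)(f\circ g)$; $\mathrm{End}_B(\widehat A)$ is an $A^B$-module via $A^B\subseteq \widehat{A}^B$. For $a\in A$ and $s=(1_A)f\in\widehat{A}^B$, $as$ denotes $(a)f$; every element of $\widehat{A}$ is a finite sum of such elements. In $\widehat{B}$, $B$ acts on $\widehat{A}$ by its (faithful) module structure and $\widehat{A}^B$ acts on $\widehat{A}$ through the endomorphisms in $\mathrm{End}_B(\widehat{A})$; $\widehat{B}$ is the subalgebra of $\mathrm{End}_k(\widehat{A})$ generated by these. The direct limit is taken along restriction maps. *)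

theory Defs
  imports
    "HOL-Algebra.Module"
    "HOL-Algebra.QuotRing"
    "HOL-Algebra.Ideal_Product"
    "HOL-Algebra.Generated_Groups"
    "HOL-Algebra.Subrings"
    "HOL-Library.Poly_Mapping"
begin

section \<open>Modules over noncommutative rings\<close>

text \<open>
  The library locale \<^locale>\<open>module\<close> requires a commutative ring of scalars and
  \<^locale>\<open>algebra\<close> a commutative algebra, hence the two locales below. Modules reuse the record
  type \<^typ>\<open>('r, 'm) module\<close>; where a record only serves as a module, its fields
  \<^const>\<open>monoid.mult\<close> and \<^const>\<open>monoid.one\<close> are junk.
\<close>

locale left_module = R?: ring R + M?: abelian_group M
  for R :: "('r, 'z) ring_scheme" (structure) and M :: "('r, 'm, 'y) module_scheme" (structure) +
  assumes smult_closed [simp, intro]: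
      "\<lbrakk>a \<in> carrier R; x \<in> carrier M\<rbrakk> \<Longrightarrow> a \<odot>\<^bsub>M\<^esub> x \<in> carrier M"
    and smult_l_distr:
      "\<lbrakk>a \<in> carrier R; b \<in> carrier R; x \<in> carrier M\<rbrakk> \<Longrightarrow>
        (a \<oplus> b) \<odot>\<^bsub>M\<^esub> x = a \<odot>\<^bsub>M\<^esub> x \<oplus>\<^bsub>M\<^esub> b \<odot>\<^bsub>M\<^esub> x"
    and smult_r_distr:
      "\<lbrakk>a \<in> carrier R; x \<in> carrier M; y \<in> carrier M\<rbrakk> \<Longrightarrow>
        a \<odot>\<^bsub>M\<^esub> (x \<oplus>\<^bsub>M\<^esub> y) = a \<odot>\<^bsub>M\<^esub> x \<oplus>\<^bsub>M\<^esub> a \<odot>\<^bsub>M\<^esub> y"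
    and smult_assoc1:
      "\<lbrakk>a \<in> carrier R; b \<in> carrier R; x \<in> carrier M\<rbrakk> \<Longrightarrow>
        (a \<otimes> b) \<odot>\<^bsub>M\<^esub> x = a \<odot>\<^bsub>M\<^esub> (b \<odot>\<^bsub>M\<^esub> x)"
    and smult_one [simp]: "x \<in> carrier M \<Longrightarrow> \<one> \<odot>\<^bsub>M\<^esub> x = x"

locale assoc_algebra = module k A + ring A
  for k :: "('k, 'z) ring_scheme" (structure) and A :: "('k, 'a, 'y) module_scheme" (structure) +
  assumes smult_mult_left:
      "\<lbrakk>c \<in> carrier k; x \<in> carrier A; y \<in> carrier A\<rbrakk> \<Longrightarrow>
        (c \<odot>\<^bsub>A\<^esub> x) \<otimes>\<^bsub>A\<^esub> y = c \<odot>\<^bsub>A\<^esub> (x \<otimes>\<^bsub>A\<^esub> y)"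
    and smult_mult_right:
      "\<lbrakk>c \<in> carrier k; x \<in> carrier A; y \<in> carrier A\<rbrakk> \<Longrightarrow>
        x \<otimes>\<^bsub>A\<^esub> (c \<odot>\<^bsub>A\<^esub> y) = c \<odot>\<^bsub>A\<^esub> (x \<otimes>\<^bsub>A\<^esub> y)"

definition with_smult :: "('m, 'z) ring_scheme \<Rightarrow> ('r \<Rightarrow> 'm \<Rightarrow> 'm) \<Rightarrow> ('r, 'm) module" where
  "with_smult M act =
    \<lparr>carrier = carrier M, monoid.mult = monoid.mult M,
     one = \<one>\<^bsub>M\<^esub>, ring.zero = \<zero>\<^bsub>M\<^esub>, ring.add = ring.add M, smult = act\<rparr>"

definition lhom ::
  "('r, 'z) ring_scheme \<Rightarrow> ('r, 'm) module \<Rightarrow> ('r, 'n) module \<Rightarrow> ('m \<Rightarrow> 'n) set" where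
  "lhom R M N = {f \<in> carrier M \<rightarrow>\<^sub>E carrier N.
     (\<forall>x\<in>carrier M. \<forall>y\<in>carrier M. f (x \<oplus>\<^bsub>M\<^esub> y) = f x \<oplus>\<^bsub>N\<^esub> f y) \<and>
     (\<forall>r\<in>carrier R. \<forall>x\<in>carrier M. f (r \<odot>\<^bsub>M\<^esub> x) = r \<odot>\<^bsub>N\<^esub> f x)}"

definition submodule_span :: "('r, 'z) ring_scheme \<Rightarrow> ('r, 'm) module \<Rightarrow> 'm set \<Rightarrow> 'm set" where
  "submodule_span R M S = \<Inter>{K. submodule K R M \<and> S \<subseteq> K}"

definition essential :: "('r, 'z) ring_scheme \<Rightarrow> ('r, 'm) module \<Rightarrow> 'm set \<Rightarrow> bool" where
  "essential R M K \<longleftrightarrow> submodule K R M \<and>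
     (\<forall>L. submodule L R M \<longrightarrow> K \<inter> L = {\<zero>\<^bsub>M\<^esub>} \<longrightarrow> L = {\<zero>\<^bsub>M\<^esub>})"

definition quotient_lmodule ::
  "('r, 'm) module \<Rightarrow> 'm set \<Rightarrow> ('r, 'm set) module" where
  "quotient_lmodule M K =
     with_smult (FactRing M K) (\<lambda>r U. \<Union>u\<in>U. K +>\<^bsub>M\<^esub> (r \<odot>\<^bsub>M\<^esub> u))"

subsection \<open>Injectivity\<close>

definition rel_injective ::
  "('r, 'z) ring_scheme \<Rightarrow> ('r, 'l) module \<Rightarrow> ('r, 'm) module \<Rightarrow> bool" where
  "rel_injective R L M \<longleftrightarrow>
     (\<forall>N f. submodule N R L \<longrightarrow> f \<in> lhom R (L\<lparr>carrier := N\<rparr>) M \<longrightarrow>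
        (\<exists>g\<in>lhom R L M. \<forall>x\<in>N. g x = f x))"

abbreviation self_injective :: "('r, 'z) ring_scheme \<Rightarrow> ('r, 'm) module \<Rightarrow> bool" where
  "self_injective R M \<equiv> rel_injective R M M"

text \<open>
  The test modules \<open>L\<close> have their elements in the type of the ring elements. They include \<open>R\<close>
  itself, so by Baer's criterion this is injectivity with respect to all left \<open>R\<close>-modules.
\<close>
definition injective_lmodule :: "('r, 'z) ring_scheme \<Rightarrow> ('r, 'm) module \<Rightarrow> bool" where
  "injective_lmodule R M \<longleftrightarrow> left_module R M \<and>
     (\<forall>L :: ('r, 'r) module. left_module R L \<longrightarrow> rel_injective R L M)"

text \<open>The inclusion of \<open>M\<close> in its injective hull \<open>E\<close> is rendered by an embedding \<open>\<iota>\<close>.\<close>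
definition injective_hull ::
  "('r, 'z) ring_scheme \<Rightarrow> ('r, 'm) module \<Rightarrow> ('r, 'e) module \<Rightarrow> ('m \<Rightarrow> 'e) \<Rightarrow> bool" where
  "injective_hull R M E \<iota> \<longleftrightarrow> injective_lmodule R E \<and>
     \<iota> \<in> lhom R M E \<and> inj_on \<iota> (carrier M) \<and> essential R E (\<iota> ` carrier M)"

text \<open>The sum of the images of all homomorphisms from \<open>M\<close> to \<open>X\<close>.\<close>
definition trace_submodule ::
  "('r, 'z) ring_scheme \<Rightarrow> ('r, 'm) module \<Rightarrow> ('r, 'x) module \<Rightarrow> 'x set" where
  "trace_submodule R M X = submodule_span R X (\<Union>f\<in>lhom R M X. f ` carrier M)"

definition self_injective_hull ::
  "('r, 'z) ring_scheme \<Rightarrow> ('r, 'm) module \<Rightarrow> ('r, 'e) module \<Rightarrow> ('r, 'e) module" where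
  "self_injective_hull R M E = E\<lparr>carrier := trace_submodule R M E\<rparr>"

subsection \<open>The category \<open>\<sigma>[M]\<close> and the Lambek torsion theory\<close>

definition generated_by ::
  "('r, 'z) ring_scheme \<Rightarrow> ('r, 'm) module \<Rightarrow> ('r, 'x) module \<Rightarrow> bool" where
  "generated_by R M X \<longleftrightarrow> left_module R X \<and> trace_submodule R M X = carrier X"

text \<open>
  \<open>X\<close> embeds into some \<open>M\<close>-generated module \<open>Y\<close>. The type of the elements of \<open>Y\<close> is no restriction:
  if \<open>X\<close> embeds into any \<open>M\<close>-generated module, then the submodule generated by a single \<open>x \<in> X\<close>
  is a subquotient of a finite power of \<open>M\<close>, so \<open>X\<close> embeds into a quotient of the direct sum of copies of \<open>M\<close> indexed by
  \<open>X \<times> \<nat>\<close>, whose elements are cosets, that is, sets of functions from \<open>X \<times> \<nat>\<close> to \<open>M\<close>.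
\<close>
definition in_sigma ::
  "('r, 'z) ring_scheme \<Rightarrow> ('r, 'm) module \<Rightarrow> ('r, 'x) module \<Rightarrow> bool" where
  "in_sigma R M X \<longleftrightarrow> left_module R X \<and>
     (\<exists>Y :: ('r, ('x \<times> nat \<Rightarrow> 'm) set) module.
        generated_by R M Y \<and> (\<exists>i\<in>lhom R X Y. inj_on i (carrier X)))"

text \<open>
  Injective hull of \<open>N\<close> in \<open>\<sigma>[M]\<close>. The test modules include \<open>M\<close> itself, and an \<open>M\<close>-injective module
  is \<open>L\<close>-injective for every \<open>L\<close> in \<open>\<sigma>[M]\<close>.
\<close>
definition sigma_injective_hull ::
  "('r, 'z) ring_scheme \<Rightarrow> ('r, 'm) module \<Rightarrow> ('r, 'n) module \<Rightarrow> ('r, 'h) module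
     \<Rightarrow> ('n \<Rightarrow> 'h) \<Rightarrow> bool" where
  "sigma_injective_hull R M N H \<iota> \<longleftrightarrow> in_sigma R M H \<and>
     (\<forall>L :: ('r, 'm) module. in_sigma R M L \<longrightarrow> rel_injective R L H) \<and>
     \<iota> \<in> lhom R N H \<and> inj_on \<iota> (carrier N) \<and> essential R H (\<iota> ` carrier N)"

text \<open>The parameter \<open>Mhat\<close> is the self-injective hull of \<open>M\<close>.\<close>
definition lambek_torsion ::
  "('r, 'z) ring_scheme \<Rightarrow> ('r, 'm) module \<Rightarrow> ('r, 'e) module \<Rightarrow> ('r, 'x) module \<Rightarrow> bool" where
  "lambek_torsion R M Mhat X \<longleftrightarrow>
     in_sigma R M X \<and> lhom R X Mhat = {\<lambda>x\<in>carrier X. \<zero>\<^bsub>Mhat\<^esub>}"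

definition torsion_submodule ::
  "('r, 'z) ring_scheme \<Rightarrow> ('r, 'm) module \<Rightarrow> ('r, 'e) module \<Rightarrow> ('r, 'x) module \<Rightarrow> 'x set" where
  "torsion_submodule R M Mhat X = submodule_span R X
     (\<Union>{T. submodule T R X \<and> lambek_torsion R M Mhat (X\<lparr>carrier := T\<rparr>)})"

text \<open>\<open>Q\<close> is the quotient module of the torsion-free module \<open>N\<close>, formed inside the injective hull
  \<open>H\<close> of \<open>N\<close> in \<open>\<sigma>[M]\<close>.\<close>
definition is_quotient_module ::
  "('r, 'z) ring_scheme \<Rightarrow> ('r, 'm) module \<Rightarrow> ('r, 'e) module \<Rightarrow> ('r, 'n) module
     \<Rightarrow> ('r, 'h) module \<Rightarrow> ('n \<Rightarrow> 'h) \<Rightarrow> 'h set \<Rightarrow> bool" where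
  "is_quotient_module R M Mhat N H \<iota> Q \<longleftrightarrow>
     in_sigma R M N \<and> torsion_submodule R M Mhat N = {\<zero>\<^bsub>N\<^esub>} \<and>
     sigma_injective_hull R M N H \<iota> \<and>
     submodule Q R H \<and> \<iota> ` carrier N \<subseteq> Q \<and>
     (\<lambda>x. (\<iota> ` carrier N) +>\<^bsub>H\<^esub> x) ` Q =
       torsion_submodule R M Mhat (quotient_lmodule H (\<iota> ` carrier N))"

subsection \<open>The direct limit of partial endomorphisms\<close>

definition partial_endos :: "('r, 'z) ring_scheme \<Rightarrow> ('r, 'm) module \<Rightarrow> ('m set \<times> ('m \<Rightarrow> 'm)) set" where
  "partial_endos R M = (SIGMA I : {I. essential R M I}. lhom R (M\<lparr>carrier := I\<rparr>) M)"

definition limit_rel :: "('r, 'z) ring_scheme \<Rightarrow> ('r, 'm) module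
     \<Rightarrow> (('m set \<times> ('m \<Rightarrow> 'm)) \<times> ('m set \<times> ('m \<Rightarrow> 'm))) set" where
  "limit_rel R M = {((I, f), (J, g)). (I, f) \<in> partial_endos R M \<and> (J, g) \<in> partial_endos R M \<and>
     (\<exists>K. essential R M K \<and> K \<subseteq> I \<inter> J \<and> (\<forall>x\<in>K. f x = g x))}"

text \<open>
  The direct limit of the groups of homomorphisms from \<open>I\<close> to \<open>M\<close>, \<open>I\<close> essential in \<open>M\<close>, along
  restriction, as a ring under addition and composition of representatives on the largest common
  domain. Homomorphisms act from the right, so in a product the left factor is applied first.
\<close>
definition partial_endo_limit ::
  "('r, 'z) ring_scheme \<Rightarrow> ('r, 'm) module \<Rightarrow> (('m set \<times> ('m \<Rightarrow> 'm)) set) ring" where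
  "partial_endo_limit R M =
    \<lparr>carrier = partial_endos R M // limit_rel R M,
     monoid.mult = (\<lambda>X Y. \<Union>(I, f)\<in>X. \<Union>(J, g)\<in>Y.
       limit_rel R M `` {({x \<in> I. f x \<in> J}, \<lambda>x\<in>{x \<in> I. f x \<in> J}. g (f x))}),
     one = limit_rel R M `` {(carrier M, \<lambda>x\<in>carrier M. x)},
     ring.zero = limit_rel R M `` {(carrier M, \<lambda>x\<in>carrier M. \<zero>\<^bsub>M\<^esub>)},
     ring.add = (\<lambda>X Y. \<Union>(I, f)\<in>X. \<Union>(J, g)\<in>Y.
       limit_rel R M `` {(I \<inter> J, \<lambda>x\<in>I \<inter> J. f x \<oplus>\<^bsub>M\<^esub> g x)})\<rparr>"

subsection \<open>Non-singular modules\<close>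

definition nonsingular :: "('c, 'z) ring_scheme \<Rightarrow> ('c, 'm) module \<Rightarrow> bool" where
  "nonsingular C M \<longleftrightarrow> module C M \<and>
     {m \<in> carrier M. essential C (with_smult C (monoid.mult C))
        {c \<in> carrier C. c \<odot>\<^bsub>M\<^esub> m = \<zero>\<^bsub>M\<^esub>}}
       = {\<zero>\<^bsub>M\<^esub>}"

section \<open>Tensor products of algebras\<close>

text \<open>The ring freely generated as an abelian group by the pairs \<open>(x, y)\<close>, with componentwise
  multiplication of pairs.\<close>
definition tensor_free ::
  "('m, 'y) ring_scheme \<Rightarrow> ('n, 'z) ring_scheme \<Rightarrow> (('m \<times> 'n) \<Rightarrow>\<^sub>0 int) ring" where
  "tensor_free M N =
    \<lparr>carrier = {c. Poly_Mapping.keys c \<subseteq> carrier M \<times> carrier N},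
     monoid.mult = (\<lambda>c d. frag_extend (\<lambda>(x, y). frag_extend (\<lambda>(x', y').
               frag_of (x \<otimes>\<^bsub>M\<^esub> x', y \<otimes>\<^bsub>N\<^esub> y')) d) c),
     one = frag_of (\<one>\<^bsub>M\<^esub>, \<one>\<^bsub>N\<^esub>), ring.zero = 0, ring.add = (+)\<rparr>"

definition tensor_relators ::
  "('c, 'z) ring_scheme \<Rightarrow> ('c, 'm) module \<Rightarrow> ('c, 'n) module \<Rightarrow> (('m \<times> 'n) \<Rightarrow>\<^sub>0 int) set" where
  "tensor_relators C M N =
     {frag_of (x \<oplus>\<^bsub>M\<^esub> x', y) - frag_of (x, y) - frag_of (x', y) | x x' y.
        x \<in> carrier M \<and> x' \<in> carrier M \<and> y \<in> carrier N} \<union>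
     {frag_of (x, y \<oplus>\<^bsub>N\<^esub> y') - frag_of (x, y) - frag_of (x, y') | x y y'.
        x \<in> carrier M \<and> y \<in> carrier N \<and> y' \<in> carrier N} \<union>
     {frag_of (c \<odot>\<^bsub>M\<^esub> x, y) - frag_of (x, c \<odot>\<^bsub>N\<^esub> y) | c x y.
        c \<in> carrier C \<and> x \<in> carrier M \<and> y \<in> carrier N}"

definition tensor_kernel ::
  "('c, 'z) ring_scheme \<Rightarrow> ('c, 'm) module \<Rightarrow> ('c, 'n) module \<Rightarrow> (('m \<times> 'n) \<Rightarrow>\<^sub>0 int) set" where
  "tensor_kernel C M N = generate (add_monoid (tensor_free M N)) (tensor_relators C M N)"

definition tensor_algebra ::
  "('c, 'z) ring_scheme \<Rightarrow> ('c, 'm) module \<Rightarrow> ('c, 'n) module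
     \<Rightarrow> ((('m \<times> 'n) \<Rightarrow>\<^sub>0 int) set) ring" where
  "tensor_algebra C M N = FactRing (tensor_free M N) (tensor_kernel C M N)"

definition pure_tensor ::
  "('c, 'z) ring_scheme \<Rightarrow> ('c, 'm) module \<Rightarrow> ('c, 'n) module \<Rightarrow> 'm \<Rightarrow> 'n
     \<Rightarrow> (('m \<times> 'n) \<Rightarrow>\<^sub>0 int) set" where
  "pure_tensor C M N x y = tensor_kernel C M N +>\<^bsub>tensor_free M N\<^esub> frag_of (x, y)"

text \<open>The action of operators on the first tensor factor, \<open>b (x \<otimes> y) = (b x) \<otimes> y\<close>.\<close>
definition tensor_left_action ::
  "('c, 'z) ring_scheme \<Rightarrow> ('c, 'm) module \<Rightarrow> ('c, 'n) module \<Rightarrow> ('b \<Rightarrow> 'm \<Rightarrow> 'm)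
     \<Rightarrow> 'b \<Rightarrow> (('m \<times> 'n) \<Rightarrow>\<^sub>0 int) set \<Rightarrow> (('m \<times> 'n) \<Rightarrow>\<^sub>0 int) set" where
  "tensor_left_action C M N act b X = (\<Union>c\<in>X. tensor_kernel C M N +>\<^bsub>tensor_free M N\<^esub>
     frag_extend (\<lambda>(x, y). frag_of (act b x, y)) c)"

text \<open>The additive map on the tensor product induced by a balanced map \<open>h\<close> into \<open>H\<close>.\<close>
definition tensor_lift ::
  "('c, 'z) ring_scheme \<Rightarrow> ('c, 'm) module \<Rightarrow> ('c, 'n) module \<Rightarrow> ('h, 'y) ring_scheme
     \<Rightarrow> ('m \<Rightarrow> 'n \<Rightarrow> 'h) \<Rightarrow> (('m \<times> 'n) \<Rightarrow>\<^sub>0 int) set \<Rightarrow> 'h" where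
  "tensor_lift C M N H h = (\<lambda>X\<in>carrier (tensor_algebra C M N).
     the_elem ((\<lambda>c. \<Oplus>\<^bsub>H\<^esub>p\<in>Poly_Mapping.keys c.
       [Poly_Mapping.lookup c p] \<cdot>\<^bsub>H\<^esub> h (fst p) (snd p)) ` X))"

section \<open>Algebras of operators\<close>

text \<open>The algebra of \<open>k\<close>-linear endomorphisms of \<open>A\<close>, acting from the left.\<close>
definition endo_algebra ::
  "('k, 'z) ring_scheme \<Rightarrow> ('k, 'a) module \<Rightarrow> ('k, 'a \<Rightarrow> 'a) module" where
  "endo_algebra k A =
    \<lparr>carrier = lhom k A A, monoid.mult = compose (carrier A), one = (\<lambda>x\<in>carrier A. x),
     ring.zero = (\<lambda>x\<in>carrier A. \<zero>\<^bsub>A\<^esub>), ring.add = (\<lambda>f g. \<lambda>x\<in>carrier A. f x \<oplus>\<^bsub>A\<^esub> g x),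
     smult = (\<lambda>c f. \<lambda>x\<in>carrier A. c \<odot>\<^bsub>A\<^esub> f x)\<rparr>"

definition k_subalgebra :: "('k, 'z) ring_scheme \<Rightarrow> ('k, 's) module \<Rightarrow> 's set \<Rightarrow> bool" where
  "k_subalgebra k S V \<longleftrightarrow> subring V S \<and> (\<forall>c\<in>carrier k. \<forall>v\<in>V. c \<odot>\<^bsub>S\<^esub> v \<in> V)"

definition generated_subalgebra ::
  "('k, 'z) ring_scheme \<Rightarrow> ('k, 's) module \<Rightarrow> 's set \<Rightarrow> 's set" where
  "generated_subalgebra k S X = \<Inter>{V. k_subalgebra k S V \<and> X \<subseteq> V}"

definition lmult :: "('a, 'z) ring_scheme \<Rightarrow> 'a \<Rightarrow> 'a \<Rightarrow> 'a" where
  "lmult A a = (\<lambda>x\<in>carrier A. a \<otimes>\<^bsub>A\<^esub> x)"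

definition rmult :: "('a, 'z) ring_scheme \<Rightarrow> 'a \<Rightarrow> 'a \<Rightarrow> 'a" where
  "rmult A a = (\<lambda>x\<in>carrier A. x \<otimes>\<^bsub>A\<^esub> a)"

definition multiplication_algebra ::
  "('k, 'z) ring_scheme \<Rightarrow> ('k, 'a) module \<Rightarrow> ('a \<Rightarrow> 'a) set" where
  "multiplication_algebra k A =
     generated_subalgebra k (endo_algebra k A) (lmult A ` carrier A \<union> rmult A ` carrier A)"

definition operator_algebra ::
  "('k, 'z) ring_scheme \<Rightarrow> ('k, 'a) module \<Rightarrow> ('a \<Rightarrow> 'a) set \<Rightarrow> ('k, 'a \<Rightarrow> 'a) module" where
  "operator_algebra k A B = (endo_algebra k A)\<lparr>carrier := B\<rparr>"

text \<open>\<open>A\<close> as a left module over an algebra of operators on \<open>A\<close>.\<close>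
definition operator_module :: "('k, 'a) module \<Rightarrow> ('a \<Rightarrow> 'a, 'a) module" where
  "operator_module A = with_smult A (\<lambda>b x. b x)"

definition stable_ideal ::
  "('k, 'z) ring_scheme \<Rightarrow> ('k, 'a) module \<Rightarrow> ('a \<Rightarrow> 'a) set \<Rightarrow> 'a set \<Rightarrow> bool" where
  "stable_ideal k A B K \<longleftrightarrow> submodule K (operator_algebra k A B) (operator_module A)"

definition B_prime ::
  "('k, 'z) ring_scheme \<Rightarrow> ('k, 'a) module \<Rightarrow> ('a \<Rightarrow> 'a) set \<Rightarrow> bool" where
  "B_prime k A B \<longleftrightarrow> (\<forall>K L. stable_ideal k A B K \<longrightarrow> stable_ideal k A B L \<longrightarrow>
     K \<cdot>\<^bsub>A\<^esub> L = {\<zero>\<^bsub>A\<^esub>} \<longrightarrow> K = {\<zero>\<^bsub>A\<^esub>} \<or> L = {\<zero>\<^bsub>A\<^esub>})"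

definition B_semiprime ::
  "('k, 'z) ring_scheme \<Rightarrow> ('k, 'a) module \<Rightarrow> ('a \<Rightarrow> 'a) set \<Rightarrow> bool" where
  "B_semiprime k A B \<longleftrightarrow> (\<forall>K. stable_ideal k A B K \<longrightarrow>
     K \<cdot>\<^bsub>A\<^esub> K = {\<zero>\<^bsub>A\<^esub>} \<longrightarrow> K = {\<zero>\<^bsub>A\<^esub>})"

text \<open>\<open>B\<close> is an extension of \<open>A\<close>, embedded by \<open>j\<close>, with additional module structure \<open>\<phi>\<close>.\<close>
definition module_structure_extension ::
  "('k, 'z) ring_scheme \<Rightarrow> ('k, 'a) module \<Rightarrow> ('k, 'b) module \<Rightarrow> ('a \<Rightarrow> 'b)
     \<Rightarrow> ('b \<Rightarrow> 'a \<Rightarrow> 'a) \<Rightarrow> bool" where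
  "module_structure_extension k A B j \<phi> \<longleftrightarrow> assoc_algebra k A \<and> assoc_algebra k B \<and>
     j \<in> ring_hom A B \<and> inj_on j (carrier A) \<and>
     (\<forall>c\<in>carrier k. \<forall>a\<in>carrier A. j (c \<odot>\<^bsub>A\<^esub> a) = c \<odot>\<^bsub>B\<^esub> j a) \<and>
     \<phi> \<in> ring_hom B (endo_algebra k A) \<and> (\<forall>a\<in>carrier A. \<phi> (j a) = lmult A a)"

text \<open>In \<open>b \<cdot> m = (b \<cdot> 1) m\<close> the element \<open>b \<cdot> 1\<close> of \<open>A\<close> acts as an element of \<open>B\<close>, that is, through
  its left multiplication.\<close>
definition invariants ::
  "('k, 'a) module \<Rightarrow> ('a \<Rightarrow> 'a) set \<Rightarrow> ('a \<Rightarrow> 'a, 'n) module \<Rightarrow> 'n set" where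
  "invariants A B N =
     {m \<in> carrier N. \<forall>b\<in>B. b \<odot>\<^bsub>N\<^esub> m = lmult A (b \<one>\<^bsub>A\<^esub>) \<odot>\<^bsub>N\<^esub> m}"

text \<open>The endomorphisms of a left module are written on the right, so \<open>f \<otimes> g\<close> is \<open>f\<close> followed by
  \<open>g\<close>.\<close>
definition right_endo_ring ::
  "('r, 'z) ring_scheme \<Rightarrow> ('r, 'h) module \<Rightarrow> ('h \<Rightarrow> 'h) ring" where
  "right_endo_ring R H =
    \<lparr>carrier = lhom R H H, monoid.mult = (\<lambda>f g. compose (carrier H) g f), one = (\<lambda>x\<in>carrier H. x),
     ring.zero = (\<lambda>x\<in>carrier H. \<zero>\<^bsub>H\<^esub>), ring.add = (\<lambda>f g. \<lambda>x\<in>carrier H. f x \<oplus>\<^bsub>H\<^esub> g x)\<rparr>"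

text \<open>In the next two definitions \<open>u\<close> is the image of \<open>1\<close> in \<open>H\<close>, the self-injective hull of \<open>A\<close>;
  \<open>endo_at R H u s\<close> is the endomorphism \<open>f\<close> with \<open>(1) f = s\<close>, which for semiprime \<open>A\<close> and
  invariant \<open>s\<close> exists and is unique.\<close>
definition endo_at ::
  "('r, 'z) ring_scheme \<Rightarrow> ('r, 'h) module \<Rightarrow> 'h \<Rightarrow> 'h \<Rightarrow> 'h \<Rightarrow> 'h" where
  "endo_at R H u s = inv_into (lhom R H H) (\<lambda>f. f u) s"

definition invariant_ring ::
  "('k, 'z) ring_scheme \<Rightarrow> ('k, 'a) module \<Rightarrow> ('a \<Rightarrow> 'a) set \<Rightarrow> ('a \<Rightarrow> 'a, 'h) module \<Rightarrow> 'h
     \<Rightarrow> 'h ring" where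
  "invariant_ring k A B H u = (let R = operator_algebra k A B in
    \<lparr>carrier = invariants A B H,
     monoid.mult = (\<lambda>s t. (endo_at R H u s \<otimes>\<^bsub>right_endo_ring R H\<^esub> endo_at R H u t) u),
     one = u, ring.zero = \<zero>\<^bsub>H\<^esub>, ring.add = ring.add H\<rparr>)"

text \<open>
  The algebra on the module \<open>H\<close> obtained by transporting the multiplication of the ring \<open>T\<close> along
  the surjection \<open>\<phi>\<close>, with unit \<open>u\<close>. The scalars in \<open>k\<close> act through the ring of operators \<open>R\<close>.
\<close>
definition transported_algebra ::
  "('k, 'r) module \<Rightarrow> ('t, 'z) ring_scheme \<Rightarrow> ('t \<Rightarrow> 'h) \<Rightarrow> ('r, 'h) module \<Rightarrow> 'h
     \<Rightarrow> ('k, 'h) module" where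
  "transported_algebra R T \<phi> H u =
    \<lparr>carrier = carrier H,
     monoid.mult = (\<lambda>x y. \<phi> (inv_into (carrier T) \<phi> x \<otimes>\<^bsub>T\<^esub> inv_into (carrier T) \<phi> y)),
     one = u, ring.zero = \<zero>\<^bsub>H\<^esub>, ring.add = ring.add H,
     smult = (\<lambda>c x. (c \<odot>\<^bsub>R\<^esub> \<one>\<^bsub>R\<^esub>) \<odot>\<^bsub>H\<^esub> x)\<rparr>"

end

theory Submission
  imports Defs
begin

text \<open>
  Everything rests on a rigidity property of the semiprime algebra \<open>A\<close>. Let \<open>f\<close> be a
  \<open>B\<close>-linear map from a stable ideal \<open>N\<close> to \<open>A\<close> that vanishes on an essential part \<open>K\<close>
  of \<open>N\<close>. Left and right multiplications belong to \<open>B\<close>, so \<open>f(x) y = f(xy) = x f(y) = 0\<close> for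
  \<open>x \<in> N\<close> and \<open>y \<in> K\<close>. Stable ideals of a semiprime algebra annihilate each other exactly when
  they meet trivially; hence \<open>f(N)\<close> misses \<open>K\<close> and therefore \<open>N\<close>, the product of two
  elements \<open>f(x)\<close> and \<open>w\<close> of \<open>f(N)\<close> is \<open>f(x w)\<close> with \<open>x w\<close> in \<open>N \<inter> f(N) = 0\<close>, and
  semiprimeness gives \<open>f = 0\<close> (lemma \<open>polyform\<close>). Since \<open>A\<close> is essential in the hull, a map
  from \<open>A\<close> to the hull that vanishes on an essential ideal is zero as well
  (\<open>vanish_on_essential\<close>), and since the hull is the sum of the images of such maps, an
  endomorphism of the hull is determined by its values on any essential stable ideal of \<open>A\<close>
  (\<open>endo_eqI\<close>).

  Existence of endomorphisms comes from injectivity. The hull \<open>E\<close> is injective for test modules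
  on the type of the operators; Baer's criterion extends this to all modules. The trace of
  \<open>A\<close> in \<open>E\<close> is stable under all homomorphisms, so it is injective with respect to every module
  in \<open>\<sigma>[A]\<close>, in particular self-injective, and maps from stable ideals to \<open>A\<close> extend to
  endomorphisms of the hull.

  Uniqueness and existence together give the assertions. A homomorphism from the cokernel of
  \<open>\<iota>\<close> to the hull is an endomorphism vanishing on \<open>A\<close>, hence zero; so the cokernel is torsion
  and the hull is the quotient module. Partial endomorphisms of \<open>A\<close> on essential ideals extend
  uniquely, and every endomorphism of the hull restricts to the essential ideal of those elements
  that it sends to \<open>A\<close>; this identifies the invariants with the direct limit. Endomorphisms
  commute, because \<open>f(g(xy)) = g(x) f(y) = g(f(xy))\<close> whenever \<open>f(y)\<close> and \<open>g(x)\<close> lie in \<open>A\<close>,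
  and these products detect every nonzero stable ideal
  (\<open>endo_commute\<close>). Multiplication by a pure tensor therefore acts on values of \<open>\<phi>\<close> through
  an operator of \<open>B\<close> and an endomorphism on either side, so the kernel of \<open>\<phi>\<close> is an ideal.
  Commutativity also makes \<open>B\<close>-linear extensions linear over the algebra generated by \<open>B\<close> and
  the endomorphisms, which is self-injectivity over that algebra.

  A stable ideal of the hull is zero as soon as its trace on \<open>A\<close> is zero; this carries
  semiprimeness, and one half of the statement on primeness, from \<open>A\<close> to the hull. The remaining
  assertions use that a stable ideal \<open>K\<close> and its annihilator span an essential ideal, so that there
  is an endomorphism \<open>e\<close> of the hull that is the identity on \<open>K\<close> and zero on the annihilator
  (\<open>projection\<close>). If \<open>KL = 0\<close>, the fixed elements and the kernel of \<open>e\<close> are stable ideals of the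
  hull that contain \<open>K\<close> and \<open>L\<close> and have product zero. If \<open>m\<close> has an essential annihilator
  \<open>I\<close> in the ring of invariants and \<open>K\<close> consists of the elements of \<open>A\<close> killed by \<open>I\<close>, then
  every multiple of \<open>e\<close> in \<open>I\<close> kills both \<open>K\<close> and its annihilator, hence is zero; so \<open>e\<close>,
  \<open>K\<close> and \<open>m\<close> vanish.
\<close>

section \<open>Modules over noncommutative rings\<close>

lemma submodule_subset: "submodule K R M \<Longrightarrow> K \<subseteq> carrier M"
  and submodule_zero: "submodule K R M \<Longrightarrow> \<zero>\<^bsub>M\<^esub> \<in> K"
  and submodule_add: "submodule K R M \<Longrightarrow> x \<in> K \<Longrightarrow> y \<in> K \<Longrightarrow> x \<oplus>\<^bsub>M\<^esub> y \<in> K"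
  and submodule_smult: "submodule K R M \<Longrightarrow> r \<in> carrier R \<Longrightarrow> x \<in> K \<Longrightarrow> r \<odot>\<^bsub>M\<^esub> x \<in> K"
  and submodule_neg: "submodule K R M \<Longrightarrow> x \<in> K \<Longrightarrow> \<ominus>\<^bsub>M\<^esub> x \<in> K"
  unfolding submodule_def submodule_axioms_def subgroup_def a_inv_def by auto

context left_module
begin

lemma smult_l_null [simp]: "x \<in> carrier M \<Longrightarrow> \<zero>\<^bsub>R\<^esub> \<odot>\<^bsub>M\<^esub> x = \<zero>\<^bsub>M\<^esub>"
  by (metis M.add.r_cancel_one' R.l_zero R.zero_closed smult_closed smult_l_distr)

lemma smult_r_null [simp]: "a \<in> carrier R \<Longrightarrow> a \<odot>\<^bsub>M\<^esub> \<zero>\<^bsub>M\<^esub> = \<zero>\<^bsub>M\<^esub>"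
  by (metis M.add.r_cancel_one' M.l_zero M.zero_closed smult_closed smult_r_distr)

lemma smult_r_minus:
  "a \<in> carrier R \<Longrightarrow> x \<in> carrier M \<Longrightarrow> a \<odot>\<^bsub>M\<^esub> (\<ominus>\<^bsub>M\<^esub> x) = \<ominus>\<^bsub>M\<^esub> (a \<odot>\<^bsub>M\<^esub> x)"
  by (metis M.add.inv_closed M.add.inv_equality M.l_neg smult_closed smult_r_distr smult_r_null)

lemma smult_l_minus:
  "a \<in> carrier R \<Longrightarrow> x \<in> carrier M \<Longrightarrow> (\<ominus>\<^bsub>R\<^esub> a) \<odot>\<^bsub>M\<^esub> x = \<ominus>\<^bsub>M\<^esub> (a \<odot>\<^bsub>M\<^esub> x)"
  by (metis M.add.inv_equality R.add.inv_closed R.l_neg smult_closed smult_l_distr smult_l_null)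

lemma submodule_iff:
  "submodule K R M \<longleftrightarrow> K \<subseteq> carrier M \<and> \<zero>\<^bsub>M\<^esub> \<in> K \<and>
     (\<forall>x\<in>K. \<forall>y\<in>K. x \<oplus>\<^bsub>M\<^esub> y \<in> K) \<and> (\<forall>r\<in>carrier R. \<forall>x\<in>K. r \<odot>\<^bsub>M\<^esub> x \<in> K)"
  (is "_ \<longleftrightarrow> ?rhs")
proof
  assume "submodule K R M"
  then show ?rhs
    using submodule_subset submodule_zero submodule_add submodule_smult by metis
next
  assume r: ?rhs
  have "\<ominus>\<^bsub>M\<^esub> x \<in> K" if "x \<in> K" for x
  proof -
    have "(\<ominus>\<^bsub>R\<^esub> \<one>\<^bsub>R\<^esub>) \<odot>\<^bsub>M\<^esub> x = \<ominus>\<^bsub>M\<^esub> x"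
      using r that smult_l_minus[of "\<one>\<^bsub>R\<^esub>" x] by auto
    then show ?thesis
      using r that by (metis R.add.inv_closed R.one_closed)
  qed
  then show "submodule K R M"
    using r unfolding submodule_def submodule_axioms_def subgroup_def a_inv_def by auto
qed

lemma carrier_submodule: "submodule (carrier M) R M"
  by (simp add: submodule_iff)

lemma zero_submodule: "submodule {\<zero>\<^bsub>M\<^esub>} R M"
  by (simp add: submodule_iff)

lemma submodule_Int: "submodule K R M \<Longrightarrow> submodule L R M \<Longrightarrow> submodule (K \<inter> L) R M"
  by (auto simp: submodule_iff)

lemma submodule_left_module:
  assumes K: "submodule K R M"
  shows "left_module R (M\<lparr>carrier := K\<rparr>)"
proof -
  have *: "K \<subseteq> carrier M" "\<zero>\<^bsub>M\<^esub> \<in> K" "\<And>x y. x \<in> K \<Longrightarrow> y \<in> K \<Longrightarrow> x \<oplus>\<^bsub>M\<^esub> y \<in> K"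
    "\<And>r x. r \<in> carrier R \<Longrightarrow> x \<in> K \<Longrightarrow> r \<odot>\<^bsub>M\<^esub> x \<in> K" "\<And>x. x \<in> K \<Longrightarrow> \<ominus>\<^bsub>M\<^esub> x \<in> K"
    using K submodule_subset submodule_zero submodule_add submodule_smult submodule_neg by metis+
  have "abelian_group (M\<lparr>carrier := K\<rparr>)"
  proof (rule abelian_groupI)
    fix x assume "x \<in> carrier (M\<lparr>carrier := K\<rparr>)"
    then have "\<ominus>\<^bsub>M\<^esub> x \<in> K" "\<ominus>\<^bsub>M\<^esub> x \<oplus>\<^bsub>M\<^esub> x = \<zero>\<^bsub>M\<^esub>" using * M.l_neg by auto
    then show "\<exists>y\<in>carrier (M\<lparr>carrier := K\<rparr>). y \<oplus>\<^bsub>M\<lparr>carrier := K\<rparr>\<^esub> x = \<zero>\<^bsub>M\<lparr>carrier := K\<rparr>\<^esub>"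
      by auto
  qed (use * in \<open>auto simp: subset_iff M.a_assoc intro: M.a_comm\<close>)
  then show ?thesis
    using * R.ring_axioms
    by (auto simp: left_module_def left_module_axioms_def subset_iff
        smult_l_distr smult_r_distr smult_assoc1)
qed

lemma submodule_of_submodule:
  assumes "submodule K R M"
  shows "submodule N R (M\<lparr>carrier := K\<rparr>) \<longleftrightarrow> submodule N R M \<and> N \<subseteq> K"
proof -
  interpret K: left_module R "M\<lparr>carrier := K\<rparr>"
    by (rule submodule_left_module[OF assms])
  show ?thesis
    using submodule_subset[OF assms] by (auto simp: K.submodule_iff submodule_iff)
qed

end

text \<open>Records that differ only in their remaining fields, possibly of different types, share the
  additive group; this is how the many module records over one group are handled.\<close>
lemma abelian_group_cong:
  assumes "abelian_group X" "carrier Y = carrier X" "ring.add Y = ring.add X" "\<zero>\<^bsub>Y\<^esub> = \<zero>\<^bsub>X\<^esub>"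
  shows "abelian_group Y"
proof -
  interpret X: abelian_group X by fact
  show ?thesis
  proof (rule abelian_groupI, unfold assms(2-4))
    show "\<exists>y\<in>carrier X. y \<oplus>\<^bsub>X\<^esub> x = \<zero>\<^bsub>X\<^esub>" if "x \<in> carrier X" for x
      using that by (intro bexI[of _ "\<ominus>\<^bsub>X\<^esub> x"]) (simp_all add: X.l_neg)
  qed (simp_all add: X.a_ac)
qed

lemma ring_left_module:
  assumes "ring R"
  shows "left_module R (with_smult R (monoid.mult R))"
proof -
  interpret ring R by fact
  have "abelian_group (with_smult R (monoid.mult R))"
    by (rule abelian_group_cong[OF is_abelian_group]) (simp_all add: with_smult_def)
  then show ?thesis
    using assms by (auto simp: left_module_def left_module_axioms_def with_smult_def
        l_distr r_distr m_assoc)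
qed

subsection \<open>Homomorphisms\<close>

lemma lhomI:
  assumes "\<And>x. x \<in> carrier M \<Longrightarrow> f x \<in> carrier N" "\<And>x. x \<notin> carrier M \<Longrightarrow> f x = undefined"
    and "\<And>x y. x \<in> carrier M \<Longrightarrow> y \<in> carrier M \<Longrightarrow> f (x \<oplus>\<^bsub>M\<^esub> y) = f x \<oplus>\<^bsub>N\<^esub> f y"
    and "\<And>r x. r \<in> carrier R \<Longrightarrow> x \<in> carrier M \<Longrightarrow> f (r \<odot>\<^bsub>M\<^esub> x) = r \<odot>\<^bsub>N\<^esub> f x"
  shows "f \<in> lhom R M N"
  using assms by (auto simp: lhom_def)

text \<open>Homomorphisms are extensional, so a map given by a formula has to be restricted first.\<close>
lemma restrict_lhom:
  assumes "left_module R M"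
    and "\<And>x. x \<in> carrier M \<Longrightarrow> f x \<in> carrier N"
    and "\<And>x y. x \<in> carrier M \<Longrightarrow> y \<in> carrier M \<Longrightarrow> f (x \<oplus>\<^bsub>M\<^esub> y) = f x \<oplus>\<^bsub>N\<^esub> f y"
    and "\<And>r x. r \<in> carrier R \<Longrightarrow> x \<in> carrier M \<Longrightarrow> f (r \<odot>\<^bsub>M\<^esub> x) = r \<odot>\<^bsub>N\<^esub> f x"
  shows "restrict f (carrier M) \<in> lhom R M N"
proof -
  interpret left_module R M by fact
  show ?thesis using assms(2-) by (intro lhomI) auto
qed

lemma lhom_closed: "f \<in> lhom R M N \<Longrightarrow> x \<in> carrier M \<Longrightarrow> f x \<in> carrier N"
  and lhom_undef: "f \<in> lhom R M N \<Longrightarrow> x \<notin> carrier M \<Longrightarrow> f x = undefined"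
  and lhom_add: "f \<in> lhom R M N \<Longrightarrow> x \<in> carrier M \<Longrightarrow> y \<in> carrier M \<Longrightarrow>
    f (x \<oplus>\<^bsub>M\<^esub> y) = f x \<oplus>\<^bsub>N\<^esub> f y"
  and lhom_smult: "f \<in> lhom R M N \<Longrightarrow> r \<in> carrier R \<Longrightarrow> x \<in> carrier M \<Longrightarrow>
    f (r \<odot>\<^bsub>M\<^esub> x) = r \<odot>\<^bsub>N\<^esub> f x"
  by (auto simp: lhom_def)

lemma lhom_eqI:
  assumes "f \<in> lhom R M N" "g \<in> lhom R M N" "\<And>x. x \<in> carrier M \<Longrightarrow> f x = g x"
  shows "f = g"
proof
  fix x show "f x = g x"
    using assms(3)[of x] lhom_undef[OF assms(1), of x] lhom_undef[OF assms(2), of x]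
    by (cases "x \<in> carrier M") auto
qed

lemma lhom_zero:
  assumes "left_module R M" "left_module R N" "f \<in> lhom R M N"
  shows "f \<zero>\<^bsub>M\<^esub> = \<zero>\<^bsub>N\<^esub>"
proof -
  interpret M: left_module R M by fact
  interpret N: left_module R N by fact
  show ?thesis
    using lhom_smult[OF assms(3), of "\<zero>\<^bsub>R\<^esub>" "\<zero>\<^bsub>M\<^esub>"] lhom_closed[OF assms(3), of "\<zero>\<^bsub>M\<^esub>"] by simp
qed

lemma lhom_minus:
  assumes "left_module R M" "left_module R N" "f \<in> lhom R M N" "x \<in> carrier M"
  shows "f (\<ominus>\<^bsub>M\<^esub> x) = \<ominus>\<^bsub>N\<^esub> f x"
proof -
  interpret M: left_module R M by fact
  interpret N: left_module R N by fact
  have "f (\<ominus>\<^bsub>M\<^esub> x) \<oplus>\<^bsub>N\<^esub> f x = \<zero>\<^bsub>N\<^esub>"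
    using lhom_add[OF assms(3), of "\<ominus>\<^bsub>M\<^esub> x" x] lhom_zero[OF assms(1-3)] assms(4) by (simp add: M.l_neg)
  then show ?thesis
    using N.minus_equality[of "f (\<ominus>\<^bsub>M\<^esub> x)" "f x"] lhom_closed[OF assms(3)] assms(4) by simp
qed

lemma lhom_compose:
  assumes "left_module R M" "f \<in> lhom R M N" "g \<in> lhom R N P"
  shows "compose (carrier M) g f \<in> lhom R M P"
  unfolding compose_def using assms
  by (intro restrict_lhom) (auto simp: lhom_closed lhom_add lhom_smult)

lemma lhom_id:
  assumes "left_module R M"
  shows "(\<lambda>x\<in>carrier M. x) \<in> lhom R M M"
  using assms by (rule restrict_lhom) auto

lemma lhom_sub:
  assumes "left_module R M" "submodule K R M" "f \<in> lhom R M N"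
  shows "restrict f K \<in> lhom R (M\<lparr>carrier := K\<rparr>) N"
proof -
  have K: "x \<in> carrier M" if "x \<in> K" for x
    using submodule_subset[OF assms(2)] that by auto
  show ?thesis
    using restrict_lhom[OF left_module.submodule_left_module[OF assms(1,2)], of f N]
    by (simp add: K lhom_closed[OF assms(3)] lhom_add[OF assms(3)] lhom_smult[OF assms(3)])
qed

lemma lhom_vimage:
  assumes "left_module R M" "left_module R N" "f \<in> lhom R M N" "submodule K R N"
  shows "submodule {x \<in> carrier M. f x \<in> K} R M"
proof -
  interpret M: left_module R M by fact
  show ?thesis
    using lhom_zero[OF assms(1-3)] submodule_zero[OF assms(4)] submodule_add[OF assms(4)]
      submodule_smult[OF assms(4)]
    by (simp add: M.submodule_iff lhom_add[OF assms(3)] lhom_smult[OF assms(3)])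
qed

lemma lhom_kernel:
  assumes "left_module R M" "left_module R N" "f \<in> lhom R M N"
  shows "submodule {x \<in> carrier M. f x = \<zero>\<^bsub>N\<^esub>} R M"
  using lhom_vimage[OF assms left_module.zero_submodule[OF assms(2)]] by simp

lemma lhom_equalizer:
  assumes "left_module R M" "left_module R N" "f \<in> lhom R M N" "g \<in> lhom R M N"
  shows "submodule {x \<in> carrier M. f x = g x} R M"
proof -
  interpret M: left_module R M by fact
  interpret N: left_module R N by fact
  show ?thesis
    using lhom_zero[OF assms(1-3)] lhom_zero[OF assms(1,2,4)]
    by (simp add: M.submodule_iff lhom_add[OF assms(3)] lhom_smult[OF assms(3)]
        lhom_add[OF assms(4)] lhom_smult[OF assms(4)])
qed

lemma lhom_image:
  assumes "left_module R M" "left_module R N" "f \<in> lhom R M N" "submodule K R M"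
  shows "submodule (f ` K) R N"
proof -
  interpret M: left_module R M by fact
  interpret N: left_module R N by fact
  have K: "K \<subseteq> carrier M" by (rule submodule_subset[OF assms(4)])
  show ?thesis
    unfolding N.submodule_iff
  proof (intro conjI ballI)
    show "f ` K \<subseteq> carrier N" using K lhom_closed[OF assms(3)] by blast
    show "\<zero>\<^bsub>N\<^esub> \<in> f ` K"
      using lhom_zero[OF assms(1-3)] submodule_zero[OF assms(4)] by (simp add: rev_image_eqI)
  next
    fix x y assume "x \<in> f ` K" "y \<in> f ` K"
    then obtain a b where ab: "a \<in> K" "b \<in> K" "x = f a" "y = f b" by blast
    then have "f (a \<oplus>\<^bsub>M\<^esub> b) = x \<oplus>\<^bsub>N\<^esub> y"
      using K lhom_add[OF assms(3), of a b] by auto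
    then show "x \<oplus>\<^bsub>N\<^esub> y \<in> f ` K"
      using submodule_add[OF assms(4) ab(1,2)] by (simp add: rev_image_eqI)
  next
    fix r x assume r: "r \<in> carrier R" and "x \<in> f ` K"
    then obtain a where a: "a \<in> K" "x = f a" by blast
    then have "f (r \<odot>\<^bsub>M\<^esub> a) = r \<odot>\<^bsub>N\<^esub> x"
      using K lhom_smult[OF assms(3) r, of a] by auto
    then show "r \<odot>\<^bsub>N\<^esub> x \<in> f ` K"
      using submodule_smult[OF assms(4) r a(1)] by (simp add: rev_image_eqI)
  qed
qed

subsection \<open>Spans and traces\<close>

lemma submodule_span_submodule:
  assumes "left_module R M" "S \<subseteq> carrier M"
  shows "submodule (submodule_span R M S) R M"
proof -
  interpret left_module R M by fact
  have "submodule_span R M S \<subseteq> carrier M"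
    using assms(2) carrier_submodule by (auto simp: submodule_span_def)
  then show ?thesis
    by (auto simp: submodule_iff) (auto simp: submodule_span_def submodule_zero submodule_add submodule_smult)
qed

lemma submodule_span_incl: "S \<subseteq> submodule_span R M S"
  by (auto simp: submodule_span_def)

lemma submodule_span_minimal: "submodule K R M \<Longrightarrow> S \<subseteq> K \<Longrightarrow> submodule_span R M S \<subseteq> K"
  by (auto simp: submodule_span_def)

lemma trace_submodule_submodule:
  assumes "left_module R X"
  shows "submodule (trace_submodule R M X) R X"
  unfolding trace_submodule_def
  by (rule submodule_span_submodule[OF assms]) (auto simp: lhom_closed)

lemma trace_incl: "f \<in> lhom R M X \<Longrightarrow> a \<in> carrier M \<Longrightarrow> f a \<in> trace_submodule R M X"
  unfolding trace_submodule_def by (rule subsetD[OF submodule_span_incl]) auto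

lemma trace_minimal:
  assumes "submodule K R X" "\<And>f a. f \<in> lhom R M X \<Longrightarrow> a \<in> carrier M \<Longrightarrow> f a \<in> K"
  shows "trace_submodule R M X \<subseteq> K"
  unfolding trace_submodule_def using assms by (intro submodule_span_minimal) auto

lemma generated_by_self:
  assumes "left_module R M"
  shows "generated_by R M M"
proof -
  have "x \<in> trace_submodule R M M" if "x \<in> carrier M" for x
    using trace_incl[OF lhom_id[OF assms] that] that by simp
  then show ?thesis
    using submodule_subset[OF trace_submodule_submodule[OF assms]] assms
    by (auto simp: generated_by_def)
qed

text \<open>Composition with \<open>h\<close> turns maps from \<open>M\<close> to \<open>Y\<close> into maps from \<open>M\<close> to \<open>X\<close>. In
  particular a homomorphism from an \<open>M\<close>-generated module has all its values in the trace.\<close>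
lemma lhom_trace:
  assumes "left_module R M" "left_module R Y" "left_module R X" "h \<in> lhom R Y X"
    and "x \<in> trace_submodule R M Y"
  shows "h x \<in> trace_submodule R M X"
proof -
  let ?K = "{y \<in> carrier Y. h y \<in> trace_submodule R M X}"
  have "trace_submodule R M Y \<subseteq> ?K"
  proof (rule trace_minimal)
    show "submodule ?K R Y"
      by (rule lhom_vimage[OF assms(2-4) trace_submodule_submodule[OF assms(3)]])
    fix f a assume fa: "f \<in> lhom R M Y" "a \<in> carrier M"
    have "compose (carrier M) h f a \<in> trace_submodule R M X"
      by (rule trace_incl[OF lhom_compose[OF assms(1) fa(1) assms(4)] fa(2)])
    then show "f a \<in> ?K"
      using fa by (auto simp: compose_def lhom_closed)
  qed
  with assms(5) show ?thesis by auto
qed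

subsection \<open>Quotient modules\<close>

lemma additive_subgroup_submodule:
  "submodule K R M \<Longrightarrow> additive_subgroup K M"
  by (simp add: additive_subgroup_def submodule_def)

lemma quotient_left_module:
  assumes "left_module R M" "submodule K R M"
  shows "left_module R (quotient_lmodule M K)"
    and "(\<lambda>x\<in>carrier M. K +>\<^bsub>M\<^esub> x) \<in> lhom R M (quotient_lmodule M K)"
    and "carrier (quotient_lmodule M K) = (\<lambda>x. K +>\<^bsub>M\<^esub> x) ` carrier M"
proof -
  interpret left_module R M by fact
  interpret K: abelian_subgroup K M
    by (rule abelian_subgroupI3[OF additive_subgroup_submodule[OF assms(2)] M.abelian_group_axioms])
  let ?Q = "quotient_lmodule M K"
  show car: "carrier ?Q = (\<lambda>x. K +>\<^bsub>M\<^esub> x) ` carrier M"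
    by (auto simp: quotient_lmodule_def with_smult_def FactRing_def A_RCOSETS_def')
  have add: "(K +>\<^bsub>M\<^esub> x) \<oplus>\<^bsub>?Q\<^esub> (K +>\<^bsub>M\<^esub> y) = K +>\<^bsub>M\<^esub> (x \<oplus>\<^bsub>M\<^esub> y)"
    if "x \<in> carrier M" "y \<in> carrier M" for x y
    using K.a_rcos_sum[OF that] by (simp add: quotient_lmodule_def with_smult_def FactRing_def)
  have zero: "\<zero>\<^bsub>?Q\<^esub> = K +>\<^bsub>M\<^esub> \<zero>\<^bsub>M\<^esub>"
    using submodule_subset[OF assms(2)]
    by (simp add: quotient_lmodule_def with_smult_def FactRing_def)
  have act: "r \<odot>\<^bsub>?Q\<^esub> (K +>\<^bsub>M\<^esub> x) = K +>\<^bsub>M\<^esub> (r \<odot>\<^bsub>M\<^esub> x)"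
    if r: "r \<in> carrier R" and x: "x \<in> carrier M" for r x
  proof -
    have "K +>\<^bsub>M\<^esub> (r \<odot>\<^bsub>M\<^esub> u) = K +>\<^bsub>M\<^esub> (r \<odot>\<^bsub>M\<^esub> x)" if u: "u \<in> K +>\<^bsub>M\<^esub> x" for u
    proof -
      obtain h where h: "h \<in> K" "u = h \<oplus>\<^bsub>M\<^esub> x"
        using u unfolding a_r_coset_def' by blast
      have "r \<odot>\<^bsub>M\<^esub> u = r \<odot>\<^bsub>M\<^esub> h \<oplus>\<^bsub>M\<^esub> r \<odot>\<^bsub>M\<^esub> x"
        unfolding h(2) using h(1) submodule_subset[OF assms(2)] by (intro smult_r_distr r x) blast
      then have "r \<odot>\<^bsub>M\<^esub> u \<in> K +>\<^bsub>M\<^esub> (r \<odot>\<^bsub>M\<^esub> x)"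
        using submodule_smult[OF assms(2) r h(1)] unfolding a_r_coset_def' by blast
      then show ?thesis
        by (rule K.a_repr_independence'[symmetric]) (rule smult_closed[OF r x])
    qed
    note const = this
    have "x \<in> K +>\<^bsub>M\<^esub> x" using x by (rule K.a_rcos_self)
    then have "(\<Union>u\<in>K +>\<^bsub>M\<^esub> x. K +>\<^bsub>M\<^esub> (r \<odot>\<^bsub>M\<^esub> u)) = K +>\<^bsub>M\<^esub> (r \<odot>\<^bsub>M\<^esub> x)"
      by (intro SUP_eq_const const) blast
    then show ?thesis
      unfolding quotient_lmodule_def with_smult_def by simp
  qed
  have "abelian_group (M Quot K)"
    by (rule comm_group_abelian_groupI)
      (simp add: FactRing_def K.a_factorgroup_is_comm_group[unfolded A_FactGroup_def'])
  then have "abelian_group ?Q"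
    by (rule abelian_group_cong) (simp_all add: quotient_lmodule_def with_smult_def)
  then show Q: "left_module R ?Q"
    using R.ring_axioms
    by (auto simp: left_module_def left_module_axioms_def car act add
        smult_l_distr smult_r_distr smult_assoc1)
  show "(\<lambda>x\<in>carrier M. K +>\<^bsub>M\<^esub> x) \<in> lhom R M ?Q"
    by (rule restrict_lhom) (auto simp: left_module_axioms car add act)
qed

lemma quotient_generated_by:
  assumes "left_module R M" "generated_by R M X" "submodule K R X"
  shows "generated_by R M (quotient_lmodule X K)"
proof -
  have X: "left_module R X" "trace_submodule R M X = carrier X"
    using assms(2) by (auto simp: generated_by_def)
  note Q = quotient_left_module[OF X(1) assms(3)]
  have "(K +>\<^bsub>X\<^esub> x) \<in> trace_submodule R M (quotient_lmodule X K)" if "x \<in> carrier X" for x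
    using lhom_trace[OF assms(1) X(1) Q(1,2), of x] X(2) that by simp
  then show ?thesis
    using submodule_subset[OF trace_submodule_submodule[OF Q(1), of M]] Q(1)
    by (auto simp: generated_by_def Q(3))
qed

subsection \<open>Generated modules in \<open>\<sigma>[M]\<close>\<close>

text \<open>The definition of \<open>\<sigma>[M]\<close> asks for an ambient generated module on a prescribed type. A
  generated module is moved there along any injection of its carrier.\<close>
lemma transport_left_module:
  fixes X :: "('r, 'x) module" and i :: "'x \<Rightarrow> 'y"
  assumes "left_module R X" "inj_on i (carrier X)"
  obtains Y :: "('r, 'y) module" where "left_module R Y" "carrier Y = i ` carrier X"
    "restrict i (carrier X) \<in> lhom R X Y"
proof -
  interpret left_module R X by fact
  define j where "j = inv_into (carrier X) i"
  have j [simp]: "j (i x) = x" if "x \<in> carrier X" for x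
    unfolding j_def using assms(2) that by (rule inv_into_f_f)
  define Y :: "('r, 'y) module" where
    "Y = \<lparr>carrier = i ` carrier X, monoid.mult = \<lambda>x y. x, one = i \<zero>\<^bsub>X\<^esub>, ring.zero = i \<zero>\<^bsub>X\<^esub>,
      ring.add = \<lambda>x y. i (j x \<oplus>\<^bsub>X\<^esub> j y), smult = \<lambda>r x. i (r \<odot>\<^bsub>X\<^esub> j x)\<rparr>"
  have car: "carrier Y = i ` carrier X" and zero: "\<zero>\<^bsub>Y\<^esub> = i \<zero>\<^bsub>X\<^esub>"
    and add: "\<And>x y. x \<in> carrier X \<Longrightarrow> y \<in> carrier X \<Longrightarrow> i x \<oplus>\<^bsub>Y\<^esub> i y = i (x \<oplus>\<^bsub>X\<^esub> y)"
    and act: "\<And>r x. x \<in> carrier X \<Longrightarrow> r \<odot>\<^bsub>Y\<^esub> i x = i (r \<odot>\<^bsub>X\<^esub> x)"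
    by (simp_all add: Y_def)
  have "abelian_group Y"
  proof (rule abelian_groupI)
    fix y assume "y \<in> carrier Y"
    then obtain x where x: "x \<in> carrier X" "y = i x" by (auto simp: car)
    then have "i (\<ominus>\<^bsub>X\<^esub> x) \<oplus>\<^bsub>Y\<^esub> y = \<zero>\<^bsub>Y\<^esub>"
      by (simp add: add zero M.l_neg)
    then show "\<exists>z\<in>carrier Y. z \<oplus>\<^bsub>Y\<^esub> y = \<zero>\<^bsub>Y\<^esub>"
      using x by (auto simp: car)
  next
    fix x y z assume "x \<in> carrier Y" "y \<in> carrier Y" "z \<in> carrier Y"
    then show "x \<oplus>\<^bsub>Y\<^esub> y \<oplus>\<^bsub>Y\<^esub> z = x \<oplus>\<^bsub>Y\<^esub> (y \<oplus>\<^bsub>Y\<^esub> z)"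
      by (auto simp: car add M.a_assoc)
  next
    fix x y assume "x \<in> carrier Y" "y \<in> carrier Y"
    then show "x \<oplus>\<^bsub>Y\<^esub> y = y \<oplus>\<^bsub>Y\<^esub> x"
      by (auto simp: car add M.a_comm)
  qed (auto simp: car add zero)
  then have "left_module R Y"
    using R.ring_axioms
    by (auto simp: left_module_def left_module_axioms_def car act add
        smult_l_distr smult_r_distr smult_assoc1)
  moreover have "restrict i (carrier X) \<in> lhom R X Y"
    by (rule restrict_lhom) (auto simp: left_module_axioms car add act)
  ultimately show ?thesis
    using that car by auto
qed

lemma generated_by_trivial:
  assumes "left_module R M" "generated_by R M X" "carrier M = {\<zero>\<^bsub>M\<^esub>}"
  shows "carrier X = {\<zero>\<^bsub>X\<^esub>}"
proof -
  have X: "left_module R X" "trace_submodule R M X = carrier X"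
    using assms(2) by (auto simp: generated_by_def)
  have "trace_submodule R M X \<subseteq> {\<zero>\<^bsub>X\<^esub>}"
    using assms(3) lhom_zero[OF assms(1) X(1)]
    by (intro trace_minimal left_module.zero_submodule[OF X(1)]) auto
  then show ?thesis
    using X submodule_zero[OF left_module.carrier_submodule[OF X(1)]] by auto
qed

text \<open>The prescribed ambient type offers room for an injection as soon as \<open>M\<close> has a nonzero
  element; otherwise \<open>X\<close> is zero as well.\<close>
lemma generated_by_in_sigma:
  fixes X :: "('r, 'x) module" and M :: "('r, 'm) module"
  assumes "left_module R M" "generated_by R M X"
  shows "in_sigma R M X"
proof -
  have X: "left_module R X" "trace_submodule R M X = carrier X"
    using assms(2) by (auto simp: generated_by_def)
  obtain i :: "'x \<Rightarrow> ('x \<times> nat \<Rightarrow> 'm) set" where i: "inj_on i (carrier X)"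
  proof (cases "\<exists>m\<in>carrier M. m \<noteq> \<zero>\<^bsub>M\<^esub>")
    case True
    then obtain m where m: "m \<noteq> \<zero>\<^bsub>M\<^esub>" by auto
\<comment> \<open>\<open>x\<close> is encoded by the function that equals \<open>m\<close> exactly at the pairs with first entry \<open>x\<close>\<close>
    define i where "i = (\<lambda>x. {\<lambda>p::'x \<times> nat. if fst p = x then m else \<zero>\<^bsub>M\<^esub>})"
    have "inj i"
    proof (rule injI)
      fix x y assume "i x = i y"
      then have "(\<lambda>p::'x \<times> nat. if fst p = x then m else \<zero>\<^bsub>M\<^esub>) = (\<lambda>p. if fst p = y then m else \<zero>\<^bsub>M\<^esub>)"
        by (simp add: i_def)
      from fun_cong[OF this, of "(x, 0)"] m show "x = y" by (simp split: if_splits)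
    qed
    then have "inj_on i (carrier X)" by (rule inj_on_subset) simp
    then show ?thesis by (rule that)
  next
    case False
    then have "carrier M = {\<zero>\<^bsub>M\<^esub>}"
      using submodule_zero[OF left_module.carrier_submodule[OF assms(1)]] by blast
    with assms have "carrier X = {\<zero>\<^bsub>X\<^esub>}" by (rule generated_by_trivial)
    then show ?thesis using that[of undefined] by simp
  qed
  obtain Y :: "('r, ('x \<times> nat \<Rightarrow> 'm) set) module" where
    Y: "left_module R Y" "carrier Y = i ` carrier X" "restrict i (carrier X) \<in> lhom R X Y"
    using transport_left_module[OF X(1) i] .
  have "i x \<in> trace_submodule R M Y" if "x \<in> carrier X" for x
    using lhom_trace[OF assms(1) X(1) Y(1,3), of x] X(2) that by simp
  then have "generated_by R M Y"
    using submodule_subset[OF trace_submodule_submodule[OF Y(1), of M]] Y(1,2)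
    by (auto simp: generated_by_def)
  moreover have "inj_on (restrict i (carrier X)) (carrier X)"
    using i by (simp add: inj_on_def)
  ultimately show ?thesis
    unfolding in_sigma_def using X(1) Y(3) by blast
qed

subsection \<open>Baer's criterion\<close>

text \<open>A partial homomorphism is handled as its graph, so that Zorn's lemma applies to inclusion.\<close>
definition hom_graph :: "('r, 'z) ring_scheme \<Rightarrow> ('r, 'l) module \<Rightarrow> ('r, 'm) module \<Rightarrow> ('l \<times> 'm) set \<Rightarrow> bool" where
  "hom_graph R L M G \<longleftrightarrow> G \<subseteq> carrier L \<times> carrier M \<and> (\<zero>\<^bsub>L\<^esub>, \<zero>\<^bsub>M\<^esub>) \<in> G \<and>
     (\<forall>x y x' y'. (x, y) \<in> G \<longrightarrow> (x', y') \<in> G \<longrightarrow> (x \<oplus>\<^bsub>L\<^esub> x', y \<oplus>\<^bsub>M\<^esub> y') \<in> G) \<and>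
     (\<forall>r x y. r \<in> carrier R \<longrightarrow> (x, y) \<in> G \<longrightarrow> (r \<odot>\<^bsub>L\<^esub> x, r \<odot>\<^bsub>M\<^esub> y) \<in> G) \<and>
     (\<forall>y. (\<zero>\<^bsub>L\<^esub>, y) \<in> G \<longrightarrow> y = \<zero>\<^bsub>M\<^esub>)"

text \<open>Two values at one argument differ by a value at zero.\<close>
lemma hom_graph_unique:
  assumes "left_module R L" "left_module R M" "hom_graph R L M G" "(x, y) \<in> G" "(x, y') \<in> G"
  shows "y = y'"
proof -
  interpret L: left_module R L by fact
  interpret M: left_module R M by fact
  have c: "x \<in> carrier L" "y \<in> carrier M" "y' \<in> carrier M"
    using assms by (auto simp: hom_graph_def)
  have "((\<ominus>\<^bsub>R\<^esub> \<one>\<^bsub>R\<^esub>) \<odot>\<^bsub>L\<^esub> x, (\<ominus>\<^bsub>R\<^esub> \<one>\<^bsub>R\<^esub>) \<odot>\<^bsub>M\<^esub> y') \<in> G"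
    using assms unfolding hom_graph_def by (metis L.R.a_inv_closed L.R.one_closed)
  then have "(\<ominus>\<^bsub>L\<^esub> x, \<ominus>\<^bsub>M\<^esub> y') \<in> G"
    using c by (simp add: L.smult_l_minus M.smult_l_minus)
  then have "(x \<oplus>\<^bsub>L\<^esub> \<ominus>\<^bsub>L\<^esub> x, y \<oplus>\<^bsub>M\<^esub> \<ominus>\<^bsub>M\<^esub> y') \<in> G"
    using assms unfolding hom_graph_def by metis
  then have "y \<oplus>\<^bsub>M\<^esub> \<ominus>\<^bsub>M\<^esub> y' = \<zero>\<^bsub>M\<^esub>"
    using assms(3) c unfolding hom_graph_def by (metis L.r_neg)
  then show ?thesis using c by (metis M.r_neg M.add.inv_closed M.add.right_cancel)
qed

text \<open>The extension step: for \<open>x\<close> outside the domain \<open>D\<close>, the map \<open>r \<mapsto> f(rx)\<close> on the left ideal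
  \<open>{r. rx \<in> D}\<close> extends to \<open>R\<close>, and the image of \<open>1\<close> is a consistent value at \<open>x\<close>.\<close>
lemma hom_graph_extend:
  fixes R :: "('r, 'z) ring_scheme" and L :: "('r, 'l) module" and M :: "('r, 'm) module"
  assumes "left_module R L" "injective_lmodule R M" "hom_graph R L M G" "x \<in> carrier L"
  shows "\<exists>G' y. hom_graph R L M G' \<and> G \<subseteq> G' \<and> (x, y) \<in> G'"
proof -
  have "left_module R M" using assms(2) by (simp add: injective_lmodule_def)
  interpret L: left_module R L by fact
  interpret M: left_module R M by fact
  note uniq = hom_graph_unique[OF assms(1) \<open>left_module R M\<close> assms(3)]
  have G: "G \<subseteq> carrier L \<times> carrier M" "(\<zero>\<^bsub>L\<^esub>, \<zero>\<^bsub>M\<^esub>) \<in> G"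
    "\<And>x y x' y'. (x, y) \<in> G \<Longrightarrow> (x', y') \<in> G \<Longrightarrow> (x \<oplus>\<^bsub>L\<^esub> x', y \<oplus>\<^bsub>M\<^esub> y') \<in> G"
    "\<And>r x y. r \<in> carrier R \<Longrightarrow> (x, y) \<in> G \<Longrightarrow> (r \<odot>\<^bsub>L\<^esub> x, r \<odot>\<^bsub>M\<^esub> y) \<in> G"
    "\<And>y. (\<zero>\<^bsub>L\<^esub>, y) \<in> G \<Longrightarrow> y = \<zero>\<^bsub>M\<^esub>"
    using assms(3) unfolding hom_graph_def by blast+
  define RR where "RR = with_smult R (monoid.mult R)"
  have RR: "left_module R RR" unfolding RR_def by (rule ring_left_module) (rule L.R.ring_axioms)
  define I where "I = {r \<in> carrier R. \<exists>y. (r \<odot>\<^bsub>L\<^esub> x, y) \<in> G}"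
  define h where "h = (\<lambda>r\<in>I. THE y. (r \<odot>\<^bsub>L\<^esub> x, y) \<in> G)"
  have h: "h r = y" if "r \<in> I" "(r \<odot>\<^bsub>L\<^esub> x, y) \<in> G" for r y
    unfolding h_def using that uniq by (auto intro!: the_equality)
  have hI: "(r \<odot>\<^bsub>L\<^esub> x, h r) \<in> G" if "r \<in> I" for r
    using that h by (auto simp: I_def)
  have addI: "((r \<oplus>\<^bsub>R\<^esub> s) \<odot>\<^bsub>L\<^esub> x, h r \<oplus>\<^bsub>M\<^esub> h s) \<in> G" if "r \<in> I" "s \<in> I" for r s
    using G(3)[OF hI[OF that(1)] hI[OF that(2)]] that assms(4)
    by (simp add: I_def L.smult_l_distr)
  have mulI: "((r \<otimes>\<^bsub>R\<^esub> s) \<odot>\<^bsub>L\<^esub> x, r \<odot>\<^bsub>M\<^esub> h s) \<in> G" if "r \<in> carrier R" "s \<in> I" for r s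
    using G(4)[OF that(1) hI[OF that(2)]] that assms(4)
    by (simp add: I_def L.smult_assoc1)
  have I: "submodule I R RR"
    unfolding left_module.submodule_iff[OF RR]
  proof (intro conjI ballI)
    show "I \<subseteq> carrier RR" by (auto simp: I_def RR_def with_smult_def)
    show "\<zero>\<^bsub>RR\<^esub> \<in> I" using G(2) assms(4) by (auto simp: I_def RR_def with_smult_def)
    fix r s assume "r \<in> I" "s \<in> I"
    then show "r \<oplus>\<^bsub>RR\<^esub> s \<in> I"
      using addI[of r s] by (auto simp: I_def RR_def with_smult_def)
  next
    fix r s assume "r \<in> carrier R" "s \<in> I"
    then show "r \<odot>\<^bsub>RR\<^esub> s \<in> I"
      using mulI[of r s] by (auto simp: I_def RR_def with_smult_def)
  qed
  have "h \<in> lhom R (RR\<lparr>carrier := I\<rparr>) M"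
  proof (rule lhomI)
    fix r s assume "r \<in> carrier (RR\<lparr>carrier := I\<rparr>)" "s \<in> carrier (RR\<lparr>carrier := I\<rparr>)"
    then show "h (r \<oplus>\<^bsub>RR\<lparr>carrier := I\<rparr>\<^esub> s) = h r \<oplus>\<^bsub>M\<^esub> h s"
      using addI[of r s] submodule_add[OF I, of r s] by (auto simp: RR_def with_smult_def intro!: h)
  next
    fix r s assume "r \<in> carrier R" "s \<in> carrier (RR\<lparr>carrier := I\<rparr>)"
    then show "h (r \<odot>\<^bsub>RR\<lparr>carrier := I\<rparr>\<^esub> s) = r \<odot>\<^bsub>M\<^esub> h s"
      using mulI[of r s] submodule_smult[OF I, of r s] by (auto simp: RR_def with_smult_def intro!: h)
  qed (use hI G(1) in \<open>auto simp: h_def\<close>)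
  moreover have "rel_injective R RR M"
    using assms(2) RR by (auto simp: injective_lmodule_def)
  ultimately obtain g where g: "g \<in> lhom R RR M" "\<And>r. r \<in> I \<Longrightarrow> g r = h r"
    using I unfolding rel_injective_def by blast
\<comment> \<open>the value at \<open>x\<close>: every \<open>r\<close> with \<open>rx\<close> in the old domain forces \<open>r e\<close> to be the old value at \<open>rx\<close>\<close>
  define e where "e = g \<one>\<^bsub>R\<^esub>"
  have e: "e \<in> carrier M"
    using lhom_closed[OF g(1)] by (auto simp: e_def RR_def with_smult_def)
  have gr: "g r = r \<odot>\<^bsub>M\<^esub> e" if "r \<in> carrier R" for r
    using lhom_smult[OF g(1), of r "\<one>\<^bsub>R\<^esub>"] that by (simp add: e_def RR_def with_smult_def)
  define G' where "G' = {(d \<oplus>\<^bsub>L\<^esub> r \<odot>\<^bsub>L\<^esub> x, y \<oplus>\<^bsub>M\<^esub> r \<odot>\<^bsub>M\<^esub> e) |d y r. (d, y) \<in> G \<and> r \<in> carrier R}"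
  have G'I: "(d \<oplus>\<^bsub>L\<^esub> r \<odot>\<^bsub>L\<^esub> x, y \<oplus>\<^bsub>M\<^esub> r \<odot>\<^bsub>M\<^esub> e) \<in> G'" if "(d, y) \<in> G" "r \<in> carrier R" for d y r
    using that by (auto simp: G'_def)
  have sub: "G \<subseteq> G'"
  proof
    fix p assume "p \<in> G"
    moreover obtain d y where "p = (d, y)" by (cases p)
    ultimately show "p \<in> G'"
      using G'I[of d y "\<zero>\<^bsub>R\<^esub>"] G(1) e assms(4) by auto
  qed
  have xe: "(x, e) \<in> G'"
    using G'I[OF G(2), of "\<one>\<^bsub>R\<^esub>"] e assms(4) by simp
  have "hom_graph R L M G'"
    unfolding hom_graph_def
  proof (intro conjI allI impI)
    show "G' \<subseteq> carrier L \<times> carrier M"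
      using G(1) e assms(4) by (auto simp: G'_def)
    show "(\<zero>\<^bsub>L\<^esub>, \<zero>\<^bsub>M\<^esub>) \<in> G'" using sub G(2) by auto
  next
    fix u v u' v' assume "(u, v) \<in> G'" "(u', v') \<in> G'"
    then obtain d y r d' y' r' where
      *: "(d, y) \<in> G" "r \<in> carrier R" "(d', y') \<in> G" "r' \<in> carrier R"
        "u = d \<oplus>\<^bsub>L\<^esub> r \<odot>\<^bsub>L\<^esub> x" "v = y \<oplus>\<^bsub>M\<^esub> r \<odot>\<^bsub>M\<^esub> e" "u' = d' \<oplus>\<^bsub>L\<^esub> r' \<odot>\<^bsub>L\<^esub> x" "v' = y' \<oplus>\<^bsub>M\<^esub> r' \<odot>\<^bsub>M\<^esub> e"
      by (auto simp: G'_def)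
    then have c: "d \<in> carrier L" "d' \<in> carrier L" "y \<in> carrier M" "y' \<in> carrier M" using G(1) by auto
    have "(d \<oplus>\<^bsub>L\<^esub> d' \<oplus>\<^bsub>L\<^esub> (r \<oplus>\<^bsub>R\<^esub> r') \<odot>\<^bsub>L\<^esub> x, y \<oplus>\<^bsub>M\<^esub> y' \<oplus>\<^bsub>M\<^esub> (r \<oplus>\<^bsub>R\<^esub> r') \<odot>\<^bsub>M\<^esub> e) \<in> G'"
      using * by (intro G'I G(3)) auto
    also have "d \<oplus>\<^bsub>L\<^esub> d' \<oplus>\<^bsub>L\<^esub> (r \<oplus>\<^bsub>R\<^esub> r') \<odot>\<^bsub>L\<^esub> x = u \<oplus>\<^bsub>L\<^esub> u'"
      using * c assms(4) by (simp add: L.smult_l_distr L.a_ac)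
    also have "y \<oplus>\<^bsub>M\<^esub> y' \<oplus>\<^bsub>M\<^esub> (r \<oplus>\<^bsub>R\<^esub> r') \<odot>\<^bsub>M\<^esub> e = v \<oplus>\<^bsub>M\<^esub> v'"
      using * c e by (simp add: M.smult_l_distr M.a_ac)
    finally show "(u \<oplus>\<^bsub>L\<^esub> u', v \<oplus>\<^bsub>M\<^esub> v') \<in> G'" .
  next
    fix s u v assume s: "s \<in> carrier R" and "(u, v) \<in> G'"
    then obtain d y r where
      *: "(d, y) \<in> G" "r \<in> carrier R" "u = d \<oplus>\<^bsub>L\<^esub> r \<odot>\<^bsub>L\<^esub> x" "v = y \<oplus>\<^bsub>M\<^esub> r \<odot>\<^bsub>M\<^esub> e"
      by (auto simp: G'_def)
    then have c: "d \<in> carrier L" "y \<in> carrier M" using G(1) by auto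
    have "(s \<odot>\<^bsub>L\<^esub> d \<oplus>\<^bsub>L\<^esub> (s \<otimes>\<^bsub>R\<^esub> r) \<odot>\<^bsub>L\<^esub> x, s \<odot>\<^bsub>M\<^esub> y \<oplus>\<^bsub>M\<^esub> (s \<otimes>\<^bsub>R\<^esub> r) \<odot>\<^bsub>M\<^esub> e) \<in> G'"
      using * s by (intro G'I G(4)) auto
    then show "(s \<odot>\<^bsub>L\<^esub> u, s \<odot>\<^bsub>M\<^esub> v) \<in> G'"
      using * s c e assms(4)
      by (simp add: L.smult_r_distr M.smult_r_distr L.smult_assoc1 M.smult_assoc1)
  next
    fix v assume "(\<zero>\<^bsub>L\<^esub>, v) \<in> G'"
    then obtain d y r where
      *: "(d, y) \<in> G" "r \<in> carrier R" "\<zero>\<^bsub>L\<^esub> = d \<oplus>\<^bsub>L\<^esub> r \<odot>\<^bsub>L\<^esub> x" "v = y \<oplus>\<^bsub>M\<^esub> r \<odot>\<^bsub>M\<^esub> e"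
      by (auto simp: G'_def)
    then have c: "d \<in> carrier L" "y \<in> carrier M" using G(1) by auto
    have "((\<ominus>\<^bsub>R\<^esub> \<one>\<^bsub>R\<^esub>) \<odot>\<^bsub>L\<^esub> d, (\<ominus>\<^bsub>R\<^esub> \<one>\<^bsub>R\<^esub>) \<odot>\<^bsub>M\<^esub> y) \<in> G"
      using * by (intro G(4)) auto
    then have neg: "(\<ominus>\<^bsub>L\<^esub> d, \<ominus>\<^bsub>M\<^esub> y) \<in> G"
      using c by (simp add: L.smult_l_minus M.smult_l_minus)
\<comment> \<open>single-valuedness: here \<open>rx\<close> lies in the old domain, where \<open>e\<close> was chosen to be consistent\<close>
    have "r \<odot>\<^bsub>L\<^esub> x = \<ominus>\<^bsub>L\<^esub> d"
      using *(2,3) c assms(4) by (metis L.a_comm L.minus_equality L.smult_closed)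
    then have "(r \<odot>\<^bsub>L\<^esub> x, \<ominus>\<^bsub>M\<^esub> y) \<in> G" using neg by simp
    moreover from this have "r \<in> I" using * by (auto simp: I_def)
    ultimately have "r \<odot>\<^bsub>M\<^esub> e = \<ominus>\<^bsub>M\<^esub> y"
      using h g(2) gr *(2) by metis
    then show "v = \<zero>\<^bsub>M\<^esub>" using * c by (simp add: M.r_neg)
  qed
  then show ?thesis using sub xe by blast
qed

text \<open>A chain is directed, so each closure condition concerns a single member of it.\<close>
lemma hom_graph_Union:
  assumes "C \<noteq> {}" "subset.chain {G. hom_graph R L M G} C"
  shows "hom_graph R L M (\<Union>C)"
proof -
  have C: "\<And>G. G \<in> C \<Longrightarrow> hom_graph R L M G" "\<And>G H. G \<in> C \<Longrightarrow> H \<in> C \<Longrightarrow> G \<subseteq> H \<or> H \<subseteq> G"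
    using assms(2) by (auto simp: subset_chain_def)
  show ?thesis
    unfolding hom_graph_def
  proof (intro conjI allI impI)
    show "\<Union>C \<subseteq> carrier L \<times> carrier M" using C(1) unfolding hom_graph_def by blast
    show "(\<zero>\<^bsub>L\<^esub>, \<zero>\<^bsub>M\<^esub>) \<in> \<Union>C" using C(1) assms(1) unfolding hom_graph_def by blast
  next
    fix x y x' y' assume "(x, y) \<in> \<Union>C" "(x', y') \<in> \<Union>C"
    then obtain G where "G \<in> C" "(x, y) \<in> G" "(x', y') \<in> G" using C(2) by blast
    then show "(x \<oplus>\<^bsub>L\<^esub> x', y \<oplus>\<^bsub>M\<^esub> y') \<in> \<Union>C" using C(1) unfolding hom_graph_def by blast
  next
    fix r x y assume "r \<in> carrier R" "(x, y) \<in> \<Union>C"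
    then show "(r \<odot>\<^bsub>L\<^esub> x, r \<odot>\<^bsub>M\<^esub> y) \<in> \<Union>C" using C(1) unfolding hom_graph_def by blast
  next
    fix y assume "(\<zero>\<^bsub>L\<^esub>, y) \<in> \<Union>C"
    then show "y = \<zero>\<^bsub>M\<^esub>" using C(1) unfolding hom_graph_def by blast
  qed
qed

text \<open>A maximal graph above the graph of the given map is defined everywhere, since otherwise it
  could be extended by one more element.\<close>
theorem baer_criterion:
  fixes R :: "('r, 'z) ring_scheme" and L :: "('r, 'l) module" and M :: "('r, 'm) module"
  assumes L: "left_module R L" and inj: "injective_lmodule R M"
  shows "rel_injective R L M"
  unfolding rel_injective_def
proof (intro allI impI)
  fix N f assume N: "submodule N R L" and f: "f \<in> lhom R (L\<lparr>carrier := N\<rparr>) M"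
  have M: "left_module R M" using inj by (simp add: injective_lmodule_def)
  interpret L: left_module R L by fact
  interpret M: left_module R M by fact
  have N': "left_module R (L\<lparr>carrier := N\<rparr>)" by (rule L.submodule_left_module[OF N])
  define G0 where "G0 = (\<lambda>x. (x, f x)) ` N"
  have G0: "hom_graph R L M G0"
    using N f lhom_zero[OF N' M f] lhom_closed[OF f] lhom_add[OF f] lhom_smult[OF f]
    by (auto simp: hom_graph_def G0_def image_iff L.submodule_iff)
  define P where "P = {G. hom_graph R L M G \<and> G0 \<subseteq> G}"
  have "\<exists>G\<in>P. \<forall>X\<in>P. G \<subseteq> X \<longrightarrow> X = G"
  proof (rule subset_Zorn_nonempty)
    show "P \<noteq> {}" using G0 by (auto simp: P_def)
    fix C assume C: "C \<noteq> {}" "subset.chain P C"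
    then have "subset.chain {G. hom_graph R L M G} C"
      by (auto simp: subset_chain_def P_def)
    then have "hom_graph R L M (\<Union>C)" using C(1) by (intro hom_graph_Union)
    moreover obtain X where "X \<in> C" "G0 \<subseteq> X"
      using C by (auto simp: P_def subset_chain_def)
    ultimately show "\<Union>C \<in> P" by (auto simp: P_def)
  qed
  then obtain G where G: "hom_graph R L M G" "G0 \<subseteq> G" and max: "\<And>X. hom_graph R L M X \<Longrightarrow> G \<subseteq> X \<Longrightarrow> X = G"
  proof -
    obtain G where "G \<in> P" and m: "\<And>X. X \<in> P \<Longrightarrow> G \<subseteq> X \<Longrightarrow> X = G"
      using \<open>\<exists>G\<in>P. \<forall>X\<in>P. G \<subseteq> X \<longrightarrow> X = G\<close> by blast
    then have G: "hom_graph R L M G" "G0 \<subseteq> G" by (auto simp: P_def)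
    moreover have "X = G" if "hom_graph R L M X" "G \<subseteq> X" for X
      using m[of X] G(2) that by (auto simp: P_def)
    ultimately show ?thesis by (rule that)
  qed
  note uniq = hom_graph_unique[OF L M G(1)]
  define g where "g = (\<lambda>x\<in>carrier L. THE y. (x, y) \<in> G)"
  have gG: "g x = y" if "(x, y) \<in> G" for x y
    using that G(1) uniq by (auto simp: g_def hom_graph_def intro!: the_equality)
  have g: "(x, g x) \<in> G" if x: "x \<in> carrier L" for x
    using hom_graph_extend[OF L inj G(1) x] max gG by metis
  have "g \<in> lhom R L M"
  proof (rule lhomI)
    fix x assume "x \<in> carrier L"
    then show "g x \<in> carrier M" using g G(1) by (auto simp: hom_graph_def)
  next
    fix x y assume "x \<in> carrier L" "y \<in> carrier L"
    then show "g (x \<oplus>\<^bsub>L\<^esub> y) = g x \<oplus>\<^bsub>M\<^esub> g y"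
      using g G(1) by (intro gG) (auto simp: hom_graph_def)
  next
    fix r x assume "r \<in> carrier R" "x \<in> carrier L"
    then show "g (r \<odot>\<^bsub>L\<^esub> x) = r \<odot>\<^bsub>M\<^esub> g x"
      using g G(1) by (intro gG) (auto simp: hom_graph_def)
  qed (auto simp: g_def)
  moreover have "\<forall>x\<in>N. g x = f x"
    using G(2) gG by (auto simp: G0_def)
  ultimately show "\<exists>g\<in>lhom R L M. \<forall>x\<in>N. g x = f x" by blast
qed

subsection \<open>Essential submodules\<close>

lemma essentialD:
  "essential R M K \<Longrightarrow> submodule K R M"
  "essential R M K \<Longrightarrow> submodule L R M \<Longrightarrow> K \<inter> L = {\<zero>\<^bsub>M\<^esub>} \<Longrightarrow> L = {\<zero>\<^bsub>M\<^esub>}"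
  by (auto simp: essential_def)

lemma essential_Int:
  assumes "left_module R M" "essential R M K" "essential R M K'"
  shows "essential R M (K \<inter> K')"
proof -
  interpret left_module R M by fact
  show ?thesis
    unfolding essential_def
  proof (intro conjI allI impI)
    show "submodule (K \<inter> K') R M" using assms by (intro submodule_Int essentialD)
    fix L assume L: "submodule L R M" "K \<inter> K' \<inter> L = {\<zero>\<^bsub>M\<^esub>}"
    have "submodule (K' \<inter> L) R M" by (intro submodule_Int essentialD(1)[OF assms(3)] L(1))
    moreover have "K \<inter> (K' \<inter> L) = {\<zero>\<^bsub>M\<^esub>}" using L(2) by (simp add: Int_assoc)
    ultimately have "K' \<inter> L = {\<zero>\<^bsub>M\<^esub>}" by (rule essentialD(2)[OF assms(2)])
    with assms(3) L(1) show "L = {\<zero>\<^bsub>M\<^esub>}" by (rule essentialD(2))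
  qed
qed

lemma essential_carrier:
  assumes "left_module R M"
  shows "essential R M (carrier M)"
proof -
  interpret left_module R M by fact
  show ?thesis
    unfolding essential_def
    using carrier_submodule submodule_subset by blast
qed

text \<open>If \<open>L\<close> meets the preimage trivially, its image avoids \<open>K\<close> and is zero; then \<open>L\<close> lies in
  the kernel, which is part of the preimage.\<close>
lemma essential_vimage:
  assumes M: "left_module R M" and N: "left_module R N" and f: "f \<in> lhom R M N"
    and K: "essential R N K"
  shows "essential R M {x \<in> carrier M. f x \<in> K}"
  unfolding essential_def
proof (intro conjI allI impI)
  interpret M: left_module R M by fact
  interpret N: left_module R N by fact
  note Ks = essentialD(1)[OF K]
  show "submodule {x \<in> carrier M. f x \<in> K} R M"
    by (rule lhom_vimage[OF M N f Ks])
  fix L assume L: "submodule L R M" "{x \<in> carrier M. f x \<in> K} \<inter> L = {\<zero>\<^bsub>M\<^esub>}"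
  have fz: "f \<zero>\<^bsub>M\<^esub> = \<zero>\<^bsub>N\<^esub>" by (rule lhom_zero[OF M N f])
  have "submodule (f ` L) R N" by (rule lhom_image[OF M N f L(1)])
  moreover have "K \<inter> f ` L = {\<zero>\<^bsub>N\<^esub>}"
  proof (intro equalityI subsetI)
    fix y assume "y \<in> K \<inter> f ` L"
    then obtain l where l: "l \<in> L" "y = f l" "f l \<in> K" by blast
    then have "l \<in> {x \<in> carrier M. f x \<in> K} \<inter> L" using submodule_subset[OF L(1)] by blast
    then have "l = \<zero>\<^bsub>M\<^esub>" unfolding L(2) by blast
    then show "y \<in> {\<zero>\<^bsub>N\<^esub>}" using l fz by simp
  next
    fix y assume "y \<in> {\<zero>\<^bsub>N\<^esub>}"
    then show "y \<in> K \<inter> f ` L"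
      using fz submodule_zero[OF Ks] submodule_zero[OF L(1)] by (auto intro: rev_image_eqI)
  qed
  ultimately have "f ` L = {\<zero>\<^bsub>N\<^esub>}" by (rule essentialD(2)[OF K])
  then have "f x \<in> K" if "x \<in> L" for x
    using submodule_zero[OF Ks] imageI[OF that, of f] by simp
  then have "{x \<in> carrier M. f x \<in> K} \<inter> L = L"
    using submodule_subset[OF L(1)] by auto
  then show "L = {\<zero>\<^bsub>M\<^esub>}" using L(2) by simp
qed

lemma essential_trans:
  assumes M: "left_module R M" and N: "essential R M N" and K: "essential R (M\<lparr>carrier := N\<rparr>) K"
  shows "essential R M K"
  unfolding essential_def
proof (intro conjI allI impI)
  interpret M: left_module R M by fact
  note Ns = essentialD(1)[OF N]
  have Ks: "submodule K R M" "K \<subseteq> N"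
    using essentialD(1)[OF K] M.submodule_of_submodule[OF Ns] by simp_all
  show "submodule K R M" by (rule Ks(1))
  fix L assume L: "submodule L R M" "K \<inter> L = {\<zero>\<^bsub>M\<^esub>}"
  have "submodule (N \<inter> L) R (M\<lparr>carrier := N\<rparr>)"
    using M.submodule_of_submodule[OF Ns] M.submodule_Int[OF Ns L(1)] by simp
  moreover have "K \<inter> (N \<inter> L) = {\<zero>\<^bsub>M\<lparr>carrier := N\<rparr>\<^esub>}" using L(2) Ks(2) by auto
  ultimately have "N \<inter> L = {\<zero>\<^bsub>M\<lparr>carrier := N\<rparr>\<^esub>}" by (rule essentialD(2)[OF K])
  then show "L = {\<zero>\<^bsub>M\<^esub>}" using essentialD(2)[OF N L(1)] by simp
qed

section \<open>Algebras of endomorphisms\<close>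

lemma module_left_module: "module k M \<Longrightarrow> left_module k M"
  by (simp add: module_def left_module_def left_module_axioms_def module_axioms_def cring.axioms)

lemma left_module_module: "cring k \<Longrightarrow> left_module k M \<Longrightarrow> module k M"
  by (simp add: module_def left_module_def left_module_axioms_def module_axioms_def)

text \<open>The ring of operators on an algebra is the opposite of such a ring over the base ring, so this
  lemma serves for both.\<close>
lemma right_endo_ring_ring:
  fixes R :: "('r, 'z) ring_scheme" and H :: "('r, 'h) module"
  assumes "left_module R H"
  shows "ring (right_endo_ring R H)"
proof -
  interpret H: left_module R H by fact
  note LM = assms
  let ?S = "right_endo_ring R H"
  have clo: "f x \<in> carrier H" if "f \<in> lhom R H H" "x \<in> carrier H" for f x
    using that by (rule lhom_closed)
  have eqI: "f = g" if "f \<in> lhom R H H" "g \<in> lhom R H H" "\<And>x. x \<in> carrier H \<Longrightarrow> f x = g x" for f g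
    using that by (rule lhom_eqI)
  have zero: "\<zero>\<^bsub>?S\<^esub> \<in> lhom R H H"
    unfolding right_endo_ring_def ring.simps by (rule restrict_lhom[OF LM]) auto
  have one: "\<one>\<^bsub>?S\<^esub> \<in> lhom R H H"
    unfolding right_endo_ring_def monoid.simps by (rule lhom_id[OF LM])
  have add: "f \<oplus>\<^bsub>?S\<^esub> g \<in> lhom R H H" if "f \<in> lhom R H H" "g \<in> lhom R H H" for f g
    unfolding right_endo_ring_def ring.simps
    by (rule restrict_lhom[OF LM])
      (simp_all add: that clo lhom_add[OF that(1)] lhom_add[OF that(2)]
        lhom_smult[OF that(1)] lhom_smult[OF that(2)] H.smult_r_distr H.M.a_ac)
  have mul: "f \<otimes>\<^bsub>?S\<^esub> g \<in> lhom R H H" if "f \<in> lhom R H H" "g \<in> lhom R H H" for f g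
    unfolding right_endo_ring_def monoid.simps by (rule lhom_compose[OF LM that])
  have ev: "(f \<oplus>\<^bsub>?S\<^esub> g) x = f x \<oplus>\<^bsub>H\<^esub> g x" "(f \<otimes>\<^bsub>?S\<^esub> g) x = g (f x)" "\<zero>\<^bsub>?S\<^esub> x = \<zero>\<^bsub>H\<^esub>" "\<one>\<^bsub>?S\<^esub> x = x"
    if "x \<in> carrier H" for f g x
    using that by (simp_all add: right_endo_ring_def compose_def)
  have car: "carrier ?S = lhom R H H" by (simp add: right_endo_ring_def)
  have ag: "abelian_group ?S"
  proof (rule abelian_groupI, unfold car)
    fix f assume f: "f \<in> lhom R H H"
    let ?g = "\<lambda>x\<in>carrier H. \<ominus>\<^bsub>H\<^esub> f x"
    have g: "?g \<in> lhom R H H"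
      by (rule restrict_lhom[OF LM])
        (simp_all add: clo[OF f] lhom_add[OF f] lhom_smult[OF f] H.smult_r_minus H.M.minus_add)
    have "?g \<oplus>\<^bsub>?S\<^esub> f = \<zero>\<^bsub>?S\<^esub>"
      by (rule eqI[OF add[OF g f] zero]) (simp add: ev clo[OF f] H.M.l_neg)
    with g show "\<exists>g\<in>lhom R H H. g \<oplus>\<^bsub>?S\<^esub> f = \<zero>\<^bsub>?S\<^esub>" by blast
  next
    fix f g h assume "f \<in> lhom R H H" "g \<in> lhom R H H" "h \<in> lhom R H H"
    then show "f \<oplus>\<^bsub>?S\<^esub> g \<oplus>\<^bsub>?S\<^esub> h = f \<oplus>\<^bsub>?S\<^esub> (g \<oplus>\<^bsub>?S\<^esub> h)"
      by (intro eqI) (simp_all add: add ev clo H.M.a_assoc)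
  next
    fix f g assume "f \<in> lhom R H H" "g \<in> lhom R H H"
    then show "f \<oplus>\<^bsub>?S\<^esub> g = g \<oplus>\<^bsub>?S\<^esub> f"
      by (intro eqI) (simp_all add: add ev clo H.M.a_comm)
  next
    fix f assume "f \<in> lhom R H H"
    then show "\<zero>\<^bsub>?S\<^esub> \<oplus>\<^bsub>?S\<^esub> f = f"
      by (intro eqI) (simp_all add: add zero ev clo)
  qed (simp_all add: zero add)
  show ?thesis
  proof (rule ringI[OF ag])
    show "Group.monoid ?S"
    proof (rule monoidI, unfold car)
      fix f g h assume fgh: "f \<in> lhom R H H" "g \<in> lhom R H H" "h \<in> lhom R H H"
      then show "f \<otimes>\<^bsub>?S\<^esub> g \<otimes>\<^bsub>?S\<^esub> h = f \<otimes>\<^bsub>?S\<^esub> (g \<otimes>\<^bsub>?S\<^esub> h)"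
        by (intro eqI) (simp_all add: mul ev clo)
    next
      fix f assume f: "f \<in> lhom R H H"
      then show "\<one>\<^bsub>?S\<^esub> \<otimes>\<^bsub>?S\<^esub> f = f" "f \<otimes>\<^bsub>?S\<^esub> \<one>\<^bsub>?S\<^esub> = f"
        by (auto intro!: eqI simp: mul one ev clo)
    qed (simp_all add: one mul)
  next
    fix f g h assume "f \<in> carrier ?S" "g \<in> carrier ?S" "h \<in> carrier ?S"
    then have fgh: "f \<in> lhom R H H" "g \<in> lhom R H H" "h \<in> lhom R H H" by (simp_all add: car)
    show "(f \<oplus>\<^bsub>?S\<^esub> g) \<otimes>\<^bsub>?S\<^esub> h = f \<otimes>\<^bsub>?S\<^esub> h \<oplus>\<^bsub>?S\<^esub> g \<otimes>\<^bsub>?S\<^esub> h"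
      using fgh by (intro eqI) (simp_all add: add mul ev clo lhom_add)
    show "h \<otimes>\<^bsub>?S\<^esub> (f \<oplus>\<^bsub>?S\<^esub> g) = h \<otimes>\<^bsub>?S\<^esub> f \<oplus>\<^bsub>?S\<^esub> h \<otimes>\<^bsub>?S\<^esub> g"
      using fgh by (intro eqI) (simp_all add: add mul ev clo)
  qed
qed

lemma endo_algebra_assoc_algebra:
  fixes k :: "('k, 'z) ring_scheme" and A :: "('k, 'a) module"
  assumes "module k A"
  shows "assoc_algebra k (endo_algebra k A)"
proof -
  have A: "left_module k A" by (rule module_left_module[OF assms])
  interpret A: module k A by fact
  let ?E = "endo_algebra k A" and ?S = "right_endo_ring k A"
  interpret S: ring ?S by (rule right_endo_ring_ring[OF A])
  have ES: "carrier ?E = carrier ?S" "f \<oplus>\<^bsub>?E\<^esub> g = f \<oplus>\<^bsub>?S\<^esub> g" "f \<otimes>\<^bsub>?E\<^esub> g = g \<otimes>\<^bsub>?S\<^esub> f"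
    "\<one>\<^bsub>?E\<^esub> = \<one>\<^bsub>?S\<^esub>" for f g
    by (simp_all add: endo_algebra_def right_endo_ring_def)
  have car: "carrier ?E = lhom k A A" by (simp add: endo_algebra_def)
  have ag: "abelian_group ?E"
    by (rule abelian_group_cong[OF S.is_abelian_group]) (simp_all add: endo_algebra_def right_endo_ring_def)
  have rg: "ring ?E"
  proof (rule ringI[OF ag])
    show "Group.monoid ?E" by (rule monoidI) (simp_all add: ES S.m_assoc)
  qed (simp_all add: ES S.l_distr S.r_distr)
  have add: "f \<oplus>\<^bsub>?E\<^esub> g \<in> lhom k A A" and mul: "f \<otimes>\<^bsub>?E\<^esub> g \<in> lhom k A A"
    if "f \<in> lhom k A A" "g \<in> lhom k A A" for f g
    using that ring.ring_simprules(1,5)[OF rg, of f g] by (simp_all add: car)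
  have clo: "f x \<in> carrier A" if "f \<in> lhom k A A" "x \<in> carrier A" for f x
    using that by (rule lhom_closed)
  have eqI: "f = g" if "f \<in> lhom k A A" "g \<in> lhom k A A" "\<And>x. x \<in> carrier A \<Longrightarrow> f x = g x" for f g
    using that by (rule lhom_eqI)
  have smu: "c \<odot>\<^bsub>?E\<^esub> f \<in> lhom k A A" if "c \<in> carrier k" "f \<in> lhom k A A" for c f
  proof -
    have "c \<odot>\<^bsub>A\<^esub> (r \<odot>\<^bsub>A\<^esub> f x) = r \<odot>\<^bsub>A\<^esub> (c \<odot>\<^bsub>A\<^esub> f x)" if "r \<in> carrier k" "x \<in> carrier A" for r x
      using that \<open>c \<in> carrier k\<close> clo[OF \<open>f \<in> lhom k A A\<close>]
      by (simp add: A.smult_assoc1[symmetric] A.m_comm)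
    then show ?thesis
      unfolding endo_algebra_def module.simps
      by (intro restrict_lhom[OF A])
        (simp_all add: that clo lhom_add[OF that(2)] lhom_smult[OF that(2)] A.smult_r_distr)
  qed
  have ev: "(f \<oplus>\<^bsub>?E\<^esub> g) x = f x \<oplus>\<^bsub>A\<^esub> g x" "(f \<otimes>\<^bsub>?E\<^esub> g) x = f (g x)"
    "(c \<odot>\<^bsub>?E\<^esub> f) x = c \<odot>\<^bsub>A\<^esub> f x" if "x \<in> carrier A" for f g x c
    using that by (simp_all add: endo_algebra_def compose_def)
  have "module k ?E"
  proof (rule moduleI[OF A.R.is_cring ag], unfold car)
    show "a \<odot>\<^bsub>?E\<^esub> f \<in> lhom k A A" if "a \<in> carrier k" "f \<in> lhom k A A" for a f
      using that by (rule smu)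
    show "(a \<oplus>\<^bsub>k\<^esub> b) \<odot>\<^bsub>?E\<^esub> f = a \<odot>\<^bsub>?E\<^esub> f \<oplus>\<^bsub>?E\<^esub> b \<odot>\<^bsub>?E\<^esub> f"
      if "a \<in> carrier k" "b \<in> carrier k" "f \<in> lhom k A A" for a b f
      using that by (intro eqI) (simp_all add: smu add ev clo A.smult_l_distr)
    show "a \<odot>\<^bsub>?E\<^esub> (f \<oplus>\<^bsub>?E\<^esub> g) = a \<odot>\<^bsub>?E\<^esub> f \<oplus>\<^bsub>?E\<^esub> a \<odot>\<^bsub>?E\<^esub> g"
      if "a \<in> carrier k" "f \<in> lhom k A A" "g \<in> lhom k A A" for a f g
      using that by (intro eqI) (simp_all add: smu add ev clo A.smult_r_distr)
    show "(a \<otimes>\<^bsub>k\<^esub> b) \<odot>\<^bsub>?E\<^esub> f = a \<odot>\<^bsub>?E\<^esub> (b \<odot>\<^bsub>?E\<^esub> f)"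
      if "a \<in> carrier k" "b \<in> carrier k" "f \<in> lhom k A A" for a b f
      using that by (intro eqI) (simp_all add: smu ev clo A.smult_assoc1)
    show "\<one>\<^bsub>k\<^esub> \<odot>\<^bsub>?E\<^esub> f = f" if "f \<in> lhom k A A" for f
      using that by (intro eqI) (simp_all add: smu ev clo)
  qed
  then show ?thesis
    using rg unfolding assoc_algebra_def assoc_algebra_axioms_def car
    by (intro conjI allI impI) (auto intro!: eqI simp: smu mul ev clo lhom_smult)
qed

lemma k_subalgebra_assoc_algebra:
  fixes k :: "('k, 'z) ring_scheme" and S :: "('k, 's) module"
  assumes "assoc_algebra k S" "k_subalgebra k S V"
  shows "assoc_algebra k (S\<lparr>carrier := V\<rparr>)"
proof -
  interpret S: assoc_algebra k S by fact
  have V: "subring V S" and sm: "\<And>c v. c \<in> carrier k \<Longrightarrow> v \<in> V \<Longrightarrow> c \<odot>\<^bsub>S\<^esub> v \<in> V"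
    using assms(2) by (auto simp: k_subalgebra_def)
  have VS: "v \<in> carrier S" if "v \<in> V" for v using subringE(1)[OF V] that by auto
  have rg: "ring (S\<lparr>carrier := V\<rparr>)" by (rule S.subring_is_ring[OF V])
  then interpret V: ring "S\<lparr>carrier := V\<rparr>" .
  have "module k (S\<lparr>carrier := V\<rparr>)"
    by (rule moduleI[OF S.R.is_cring V.is_abelian_group])
      (simp_all add: sm VS S.smult_l_distr S.smult_r_distr S.smult_assoc1)
  then show ?thesis
    using rg by (simp add: assoc_algebra_def assoc_algebra_axioms_def VS S.smult_mult_left S.smult_mult_right)
qed

lemma generated_subalgebra:
  fixes k :: "('k, 'z) ring_scheme" and S :: "('k, 's) module"
  assumes "assoc_algebra k S" "X \<subseteq> carrier S"
  shows "k_subalgebra k S (generated_subalgebra k S X)" "X \<subseteq> generated_subalgebra k S X"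
proof -
  interpret S: assoc_algebra k S by fact
  let ?F = "{V. k_subalgebra k S V \<and> X \<subseteq> V}"
  have "carrier S \<in> ?F"
    using assms(2) S.carrier_is_subring by (auto simp: k_subalgebra_def)
  then have "subring (\<Inter>?F) S"
    by (intro S.subring_Inter) (auto simp: k_subalgebra_def)
  then show "k_subalgebra k S (generated_subalgebra k S X)"
    by (auto simp: k_subalgebra_def generated_subalgebra_def)
  show "X \<subseteq> generated_subalgebra k S X"
    by (auto simp: generated_subalgebra_def)
qed

lemma generated_subalgebra_minimal:
  "k_subalgebra k S V \<Longrightarrow> X \<subseteq> V \<Longrightarrow> generated_subalgebra k S X \<subseteq> V"
  by (auto simp: generated_subalgebra_def)

lemma operator_module_simps:
  "carrier (operator_module A) = carrier A" "x \<oplus>\<^bsub>operator_module A\<^esub> y = x \<oplus>\<^bsub>A\<^esub> y"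
  "\<zero>\<^bsub>operator_module A\<^esub> = \<zero>\<^bsub>A\<^esub>" "b \<odot>\<^bsub>operator_module A\<^esub> x = b x"
  by (simp_all add: operator_module_def with_smult_def)

lemma operator_algebra_simps:
  "carrier (operator_algebra k A B) = B"
  "\<beta> \<oplus>\<^bsub>operator_algebra k A B\<^esub> \<gamma> = \<beta> \<oplus>\<^bsub>endo_algebra k A\<^esub> \<gamma>"
  "\<beta> \<otimes>\<^bsub>operator_algebra k A B\<^esub> \<gamma> = \<beta> \<otimes>\<^bsub>endo_algebra k A\<^esub> \<gamma>"
  "\<one>\<^bsub>operator_algebra k A B\<^esub> = \<one>\<^bsub>endo_algebra k A\<^esub>"
  "c \<odot>\<^bsub>operator_algebra k A B\<^esub> \<beta> = c \<odot>\<^bsub>endo_algebra k A\<^esub> \<beta>"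
  by (simp_all add: operator_algebra_def)

lemma operator_assoc_algebra:
  fixes k :: "('k, 'z) ring_scheme" and A :: "('k, 'a) module"
  assumes "module k A" "k_subalgebra k (endo_algebra k A) B"
  shows "assoc_algebra k (operator_algebra k A B)"
  unfolding operator_algebra_def
  by (rule k_subalgebra_assoc_algebra[OF endo_algebra_assoc_algebra[OF assms(1)] assms(2)])

lemma operator_left_module:
  fixes k :: "('k, 'z) ring_scheme" and A :: "('k, 'a) module"
  assumes "module k A" "k_subalgebra k (endo_algebra k A) B"
  shows "left_module (operator_algebra k A B) (operator_module A)"
proof -
  interpret A: module k A by fact
  have R: "ring (operator_algebra k A B)" using operator_assoc_algebra[OF assms] by (simp add: assoc_algebra_def)
  have B: "b \<in> lhom k A A" if "b \<in> B" for b
    using assms(2) subringE(1)[of B "endo_algebra k A"] that by (auto simp: k_subalgebra_def endo_algebra_def)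
  note M = operator_module_simps
  have "abelian_group (operator_module A)"
    by (rule abelian_group_cong[OF A.abelian_group_axioms]) (simp_all add: operator_module_def with_smult_def)
  then show ?thesis
    using R lhom_closed[OF B] lhom_add[OF B]
    by (simp add: left_module_def left_module_axioms_def M operator_algebra_def endo_algebra_def compose_def)
qed

section \<open>The self-injective hull\<close>

lemma lhom_codomain_restrict:
  "f \<in> lhom R M N \<Longrightarrow> (\<And>x. x \<in> carrier M \<Longrightarrow> f x \<in> K) \<Longrightarrow> f \<in> lhom R M (N\<lparr>carrier := K\<rparr>)"
  by (auto simp: lhom_def)

lemma lhom_codomain_extend:
  "f \<in> lhom R M (N\<lparr>carrier := K\<rparr>) \<Longrightarrow> K \<subseteq> carrier N \<Longrightarrow> f \<in> lhom R M N"
  by (auto simp: lhom_def)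

lemma lhom_diff:
  assumes "left_module R M" "left_module R N" "f \<in> lhom R M N" "g \<in> lhom R M N"
  shows "(\<lambda>x\<in>carrier M. f x \<oplus>\<^bsub>N\<^esub> \<ominus>\<^bsub>N\<^esub> g x) \<in> lhom R M N"
proof -
  interpret N: left_module R N by fact
  show ?thesis
    by (rule restrict_lhom[OF assms(1)])
      (simp_all add: lhom_closed[OF assms(3)] lhom_closed[OF assms(4)] lhom_add[OF assms(3)]
        lhom_add[OF assms(4)] lhom_smult[OF assms(3)] lhom_smult[OF assms(4)] N.smult_r_distr
        N.smult_r_minus N.minus_add N.a_ac)
qed

text \<open>An embedding is inverted on its image; this turns maps into the hull with values in \<open>A\<close>
  back into maps to \<open>A\<close>.\<close>
lemma lhom_factor:
  assumes "left_module R X" "left_module R M" "j \<in> lhom R M N" "inj_on j (carrier M)"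
    and "f \<in> lhom R X N" "\<And>x. x \<in> carrier X \<Longrightarrow> f x \<in> j ` carrier M"
  shows "(\<lambda>x\<in>carrier X. inv_into (carrier M) j (f x)) \<in> lhom R X M"
proof -
  interpret M: left_module R M by fact
  interpret X: left_module R X by fact
  let ?h = "\<lambda>x. inv_into (carrier M) j (f x)"
  have h: "?h x \<in> carrier M" "j (?h x) = f x" if "x \<in> carrier X" for x
    using assms(6)[OF that] by (auto intro: inv_into_into f_inv_into_f)
  have u: "?h x = m" if "x \<in> carrier X" "m \<in> carrier M" "j m = f x" for x m
    using inv_into_f_f[OF assms(4) that(2)] that(3) by simp
  show ?thesis
  proof (rule restrict_lhom[OF assms(1)])
    fix x y assume "x \<in> carrier X" "y \<in> carrier X"
    then show "?h (x \<oplus>\<^bsub>X\<^esub> y) = ?h x \<oplus>\<^bsub>M\<^esub> ?h y"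
      by (intro u) (simp_all add: h lhom_add[OF assms(3)] lhom_add[OF assms(5)])
  next
    fix r x assume "r \<in> carrier R" "x \<in> carrier X"
    then show "?h (r \<odot>\<^bsub>X\<^esub> x) = r \<odot>\<^bsub>M\<^esub> ?h x"
      by (intro u) (simp_all add: h lhom_smult[OF assms(3)] lhom_smult[OF assms(5)])
  qed (rule h(1))
qed

lemma rel_injectiveE:
  assumes "rel_injective R L M" "submodule N R L" "f \<in> lhom R (L\<lparr>carrier := N\<rparr>) M"
  obtains g where "g \<in> lhom R L M" "\<And>x. x \<in> N \<Longrightarrow> g x = f x"
  using assms unfolding rel_injective_def by metis

lemma carrier_self_injective_hull: "carrier (self_injective_hull R M E) = trace_submodule R M E"
  by (simp add: self_injective_hull_def)

context
  fixes R :: "('r, 'z) ring_scheme" and M :: "('r, 'm) module" and E :: "('r, 'e) module"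
    and \<iota> :: "'m \<Rightarrow> 'e"
  assumes M: "left_module R M" and hull: "injective_hull R M E \<iota>"
begin

interpretation M: left_module R M by (rule M)
interpretation E: left_module R E using hull by (simp add: injective_hull_def injective_lmodule_def)

abbreviation (input) "HH \<equiv> self_injective_hull R M E"

lemma hull_left_module: "left_module R HH"
  unfolding self_injective_hull_def
  by (rule E.submodule_left_module[OF trace_submodule_submodule[OF E.left_module_axioms]])

lemma lhom_to_hull:
  assumes "generated_by R M X" "f \<in> lhom R X E"
  shows "f \<in> lhom R X HH"
proof -
  have X: "left_module R X" "trace_submodule R M X = carrier X"
    using assms(1) by (auto simp: generated_by_def)
  show ?thesis
    unfolding self_injective_hull_def
    using lhom_trace[OF M X(1) E.left_module_axioms assms(2)] X(2)
    by (intro lhom_codomain_restrict assms(2)) simp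
qed

lemma hull_embedding: "\<iota> \<in> lhom R M HH" "inj_on \<iota> (carrier M)"
  using hull lhom_to_hull[OF generated_by_self[OF M]] by (auto simp: injective_hull_def)

text \<open>The trace of \<open>M\<close> in \<open>E\<close> equals the trace of \<open>M\<close> in that trace, because the defining maps
  already take their values there.\<close>
lemma hull_generated_by: "generated_by R M HH"
proof -
  note H = hull_left_module
  have tr: "submodule (trace_submodule R M E) R E"
    by (rule trace_submodule_submodule[OF E.left_module_axioms])
  have "trace_submodule R M E \<subseteq> trace_submodule R M HH"
  proof (rule trace_minimal)
    show "submodule (trace_submodule R M HH) R E"
      using trace_submodule_submodule[OF H, of M] E.submodule_of_submodule[OF tr]
      by (simp add: self_injective_hull_def)
    show "f a \<in> trace_submodule R M HH" if "f \<in> lhom R M E" "a \<in> carrier M" for f a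
      by (rule trace_incl[OF lhom_to_hull[OF generated_by_self[OF M] that(1)] that(2)])
  qed
  then show ?thesis
    using H submodule_subset[OF trace_submodule_submodule[OF H, of M]]
    by (auto simp: generated_by_def carrier_self_injective_hull)
qed

text \<open>A homomorphism into the trace extends to a homomorphism into \<open>E\<close>, and a homomorphism from
  an \<open>M\<close>-generated module into \<open>E\<close> takes its values in the trace.\<close>
lemma hull_injective_generated:
  assumes Y: "generated_by R M Y"
  shows "rel_injective R Y HH"
  unfolding rel_injective_def
proof (intro allI impI)
  fix N f assume N: "submodule N R Y" and f: "f \<in> lhom R (Y\<lparr>carrier := N\<rparr>) HH"
  have "left_module R Y" using Y by (simp add: generated_by_def)
  then have inj: "rel_injective R Y E"
    using hull by (intro baer_criterion) (simp_all add: injective_hull_def)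
  have f': "f \<in> lhom R (Y\<lparr>carrier := N\<rparr>) E"
    using f submodule_subset[OF trace_submodule_submodule[OF E.left_module_axioms, of M]]
    unfolding self_injective_hull_def by (rule lhom_codomain_extend)
  obtain g where "g \<in> lhom R Y E" "\<And>x. x \<in> N \<Longrightarrow> g x = f x"
    by (rule rel_injectiveE[OF inj N f']) blast
  then show "\<exists>g\<in>lhom R Y HH. \<forall>x\<in>N. g x = f x"
    using lhom_to_hull[OF Y] by blast
qed

text \<open>A map from a submodule of \<open>L\<close> is transported along the embedding \<open>i\<close> of \<open>L\<close> into an
  \<open>M\<close>-generated module \<open>Y\<close>, extended to \<open>Y\<close>, and pulled back.\<close>
lemma hull_injective_sigma:
  fixes L :: "('r, 'l) module"
  assumes "in_sigma R M L"
  shows "rel_injective R L HH"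
  unfolding rel_injective_def
proof (intro allI impI)
  fix N f assume N: "submodule N R L" and f: "f \<in> lhom R (L\<lparr>carrier := N\<rparr>) HH"
  obtain Y :: "('r, ('l \<times> nat \<Rightarrow> 'm) set) module" and i where
    Y: "generated_by R M Y" and i: "i \<in> lhom R L Y" "inj_on i (carrier L)"
    and L: "left_module R L"
    using assms unfolding in_sigma_def by blast
  have Y': "left_module R Y" using Y by (simp add: generated_by_def)
  interpret L: left_module R L by fact
  interpret Y: left_module R Y by (rule Y')
  have LN: "left_module R (L\<lparr>carrier := N\<rparr>)" by (rule L.submodule_left_module[OF N])
  have iN: "submodule (i ` N) R Y" by (rule lhom_image[OF L Y' i(1) N])
  have NL: "N \<subseteq> carrier L" by (rule submodule_subset[OF N])
  have YN: "left_module R (Y\<lparr>carrier := i ` N\<rparr>)" by (rule Y.submodule_left_module[OF iN])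
  define h where "h = (\<lambda>y\<in>i ` N. inv_into (carrier (L\<lparr>carrier := N\<rparr>)) (restrict i N) y)"
  have inj: "inj_on (restrict i N) (carrier (L\<lparr>carrier := N\<rparr>))"
    using inj_on_subset[OF i(2) NL] by simp
  have "h \<in> lhom R (Y\<lparr>carrier := i ` N\<rparr>) (L\<lparr>carrier := N\<rparr>)"
    using lhom_factor[OF YN LN lhom_codomain_restrict[OF lhom_sub[OF L N i(1)], of "i ` N"] inj lhom_id[OF YN]]
    by (simp add: h_def cong: restrict_cong)
  then have "compose (i ` N) f h \<in> lhom R (Y\<lparr>carrier := i ` N\<rparr>) HH"
    using lhom_compose[OF YN _ f] by simp
  then obtain g where g: "g \<in> lhom R Y HH" "\<And>y. y \<in> i ` N \<Longrightarrow> g y = compose (i ` N) f h y"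
    by (rule rel_injectiveE[OF hull_injective_generated[OF Y] iN]) blast
  have "compose (carrier L) g i x = f x" if x: "x \<in> N" for x
  proof -
    have "inv_into N (restrict i N) (restrict i N x) = x"
      using inj x by (intro inv_into_f_f) auto
    then have "h (i x) = x" using x by (simp add: h_def)
    then show ?thesis using g(2)[of "i x"] x NL by (auto simp: compose_def)
  qed
  then show "\<exists>g\<in>lhom R L HH. \<forall>x\<in>N. g x = f x"
    using lhom_compose[OF L i(1) g(1)] by blast
qed

lemma hull_self_injective: "self_injective R HH"
  by (rule hull_injective_generated[OF hull_generated_by])

lemma hull_essential: "essential R HH (\<iota> ` carrier M)"
  unfolding essential_def
proof (intro conjI allI impI)
  have tr: "submodule (trace_submodule R M E) R E"
    by (rule trace_submodule_submodule[OF E.left_module_axioms])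
  show "submodule (\<iota> ` carrier M) R HH"
    by (rule lhom_image[OF M hull_left_module hull_embedding(1) M.carrier_submodule])
  fix L assume L: "submodule L R HH" "\<iota> ` carrier M \<inter> L = {\<zero>\<^bsub>HH\<^esub>}"
  have "submodule L R E"
    using L(1) E.submodule_of_submodule[OF tr] by (simp add: self_injective_hull_def)
  moreover have "essential R E (\<iota> ` carrier M)" using hull by (simp add: injective_hull_def)
  ultimately show "L = {\<zero>\<^bsub>HH\<^esub>}"
    using L(2) by (simp add: self_injective_hull_def essential_def)
qed

lemma extend_from_image:
  assumes f: "f \<in> lhom R M HH"
  shows "\<exists>g\<in>lhom R HH HH. \<forall>a\<in>carrier M. g (\<iota> a) = f a"
proof -
  note H = hull_left_module
  note iota = hull_embedding
  let ?I = "\<iota> ` carrier M"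
  have I: "submodule ?I R HH" by (rule essentialD(1)[OF hull_essential])
  have HI: "left_module R (HH\<lparr>carrier := ?I\<rparr>)" by (rule left_module.submodule_left_module[OF H I])
  define h where "h = (\<lambda>y\<in>?I. inv_into (carrier M) \<iota> y)"
  have "h \<in> lhom R (HH\<lparr>carrier := ?I\<rparr>) M"
    using lhom_factor[OF HI M iota lhom_codomain_extend[OF lhom_id[OF HI]]] submodule_subset[OF I]
    by (simp add: h_def cong: restrict_cong)
  then have "compose ?I f h \<in> lhom R (HH\<lparr>carrier := ?I\<rparr>) HH"
    using lhom_compose[OF HI _ f] by simp
  then obtain g where "g \<in> lhom R HH HH" "\<And>y. y \<in> ?I \<Longrightarrow> g y = compose ?I f h y"
    by (rule rel_injectiveE[OF hull_self_injective I]) blast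
  moreover have "compose ?I f h (\<iota> a) = f a" if "a \<in> carrier M" for a
    using that iota(2) by (simp add: compose_def h_def)
  ultimately show ?thesis by (intro bexI[of _ g] ballI) simp_all
qed

end

section \<open>Tensor products of rings over common scalars\<close>

definition free_lift :: "('h, 'w) ring_scheme \<Rightarrow> ('m \<Rightarrow> 'n \<Rightarrow> 'h) \<Rightarrow> (('m \<times> 'n) \<Rightarrow>\<^sub>0 int) \<Rightarrow> 'h" where
  "free_lift H h c = (\<Oplus>\<^bsub>H\<^esub>p\<in>Poly_Mapping.keys c. add_pow H (Poly_Mapping.lookup c p) (h (fst p) (snd p)))"

text \<open>Compatibility of the scalars with both multiplications makes the componentwise product of
  pairs respect the balancing relations.\<close>
locale tensor_rings =
  fixes C :: "('c, 'z) ring_scheme" and M :: "('c, 'm) module" and N :: "('c, 'n) module"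
  assumes M_ring: "ring M" and N_ring: "ring N"
    and M_smult: "\<And>c x. c \<in> carrier C \<Longrightarrow> x \<in> carrier M \<Longrightarrow> c \<odot>\<^bsub>M\<^esub> x \<in> carrier M"
      "\<And>c x y. c \<in> carrier C \<Longrightarrow> x \<in> carrier M \<Longrightarrow> y \<in> carrier M \<Longrightarrow> (c \<odot>\<^bsub>M\<^esub> x) \<otimes>\<^bsub>M\<^esub> y = c \<odot>\<^bsub>M\<^esub> (x \<otimes>\<^bsub>M\<^esub> y)"
      "\<And>c x y. c \<in> carrier C \<Longrightarrow> x \<in> carrier M \<Longrightarrow> y \<in> carrier M \<Longrightarrow> x \<otimes>\<^bsub>M\<^esub> (c \<odot>\<^bsub>M\<^esub> y) = c \<odot>\<^bsub>M\<^esub> (x \<otimes>\<^bsub>M\<^esub> y)"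
    and N_smult: "\<And>c x. c \<in> carrier C \<Longrightarrow> x \<in> carrier N \<Longrightarrow> c \<odot>\<^bsub>N\<^esub> x \<in> carrier N"
      "\<And>c x y. c \<in> carrier C \<Longrightarrow> x \<in> carrier N \<Longrightarrow> y \<in> carrier N \<Longrightarrow> (c \<odot>\<^bsub>N\<^esub> x) \<otimes>\<^bsub>N\<^esub> y = c \<odot>\<^bsub>N\<^esub> (x \<otimes>\<^bsub>N\<^esub> y)"
      "\<And>c x y. c \<in> carrier C \<Longrightarrow> x \<in> carrier N \<Longrightarrow> y \<in> carrier N \<Longrightarrow> x \<otimes>\<^bsub>N\<^esub> (c \<odot>\<^bsub>N\<^esub> y) = c \<odot>\<^bsub>N\<^esub> (x \<otimes>\<^bsub>N\<^esub> y)"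
begin

interpretation M: ring M by (rule M_ring)
interpretation N: ring N by (rule N_ring)

abbreviation "F \<equiv> tensor_free M N"
abbreviation "K \<equiv> tensor_kernel C M N"
abbreviation "P \<equiv> carrier M \<times> carrier N"
abbreviation "Q \<equiv> tensor_algebra C M N"
abbreviation "pure \<equiv> pure_tensor C M N"

lemma F_carrier: "c \<in> carrier F \<longleftrightarrow> Poly_Mapping.keys c \<subseteq> P"
  by (simp add: tensor_free_def)

lemma F_simps [simp]: "c \<oplus>\<^bsub>F\<^esub> d = c + d" "\<zero>\<^bsub>F\<^esub> = 0" "\<one>\<^bsub>F\<^esub> = frag_of (\<one>\<^bsub>M\<^esub>, \<one>\<^bsub>N\<^esub>)"
  by (simp_all add: tensor_free_def)

lemma F_closed [simp]:
  "0 \<in> carrier F" "c \<in> carrier F \<Longrightarrow> d \<in> carrier F \<Longrightarrow> c + d \<in> carrier F"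
  "c \<in> carrier F \<Longrightarrow> d \<in> carrier F \<Longrightarrow> c - d \<in> carrier F" "c \<in> carrier F \<Longrightarrow> - c \<in> carrier F"
  "p \<in> P \<Longrightarrow> frag_of p \<in> carrier F"
  using keys_add[of c d] keys_diff[of c d] by (auto simp: F_carrier)

lemma F_induct [consumes 1, case_names zero one diff]:
  assumes "c \<in> carrier F" "Z 0" "\<And>x y. x \<in> carrier M \<Longrightarrow> y \<in> carrier N \<Longrightarrow> Z (frag_of (x, y))"
    and "\<And>a b. a \<in> carrier F \<Longrightarrow> b \<in> carrier F \<Longrightarrow> Z a \<Longrightarrow> Z b \<Longrightarrow> Z (a - b)"
  shows "Z c"
proof -
  have "Poly_Mapping.keys c \<subseteq> P" using assms(1) by (simp add: F_carrier)
  then have "c \<in> carrier F \<and> Z c"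
    by (induction rule: frag_induction) (use assms(2-) in auto)
  then show ?thesis by simp
qed

lemma mult_diff_left: "(c - c') \<otimes>\<^bsub>F\<^esub> d = c \<otimes>\<^bsub>F\<^esub> d - c' \<otimes>\<^bsub>F\<^esub> d"
  by (simp add: tensor_free_def frag_extend_diff)

lemma mult_add_left: "(c + c') \<otimes>\<^bsub>F\<^esub> d = c \<otimes>\<^bsub>F\<^esub> d + c' \<otimes>\<^bsub>F\<^esub> d"
  by (simp add: tensor_free_def frag_extend_add)

lemma mult_add_right: "c \<otimes>\<^bsub>F\<^esub> (d + d') = c \<otimes>\<^bsub>F\<^esub> d + c \<otimes>\<^bsub>F\<^esub> d'"
  by (simp add: tensor_free_def frag_extend_def[of _ c] case_prod_unfold frag_extend_add
      frag_cmul_distrib2 sum.distrib)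

lemma mult_diff_right: "c \<otimes>\<^bsub>F\<^esub> (d - d') = c \<otimes>\<^bsub>F\<^esub> d - c \<otimes>\<^bsub>F\<^esub> d'"
  using mult_add_right[of c "d - d'" d'] by (simp add: algebra_simps)

lemma mult_zero [simp]: "0 \<otimes>\<^bsub>F\<^esub> d = 0" "c \<otimes>\<^bsub>F\<^esub> 0 = 0"
  using mult_diff_left[of 0 0 d] mult_diff_right[of c 0 0] by simp_all

lemma mult_of [simp]: "frag_of (x, y) \<otimes>\<^bsub>F\<^esub> frag_of (x', y') = frag_of (x \<otimes>\<^bsub>M\<^esub> x', y \<otimes>\<^bsub>N\<^esub> y')"
  by (simp add: tensor_free_def)

lemma mult_closed [simp]:
  assumes "c \<in> carrier F" "d \<in> carrier F"
  shows "c \<otimes>\<^bsub>F\<^esub> d \<in> carrier F"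
  using assms(1)
proof (induction rule: F_induct)
  case (one x y)
  from assms(2) show ?case
    by (induction rule: F_induct) (use one in \<open>simp_all add: mult_diff_right\<close>)
qed (simp_all add: mult_diff_left)

lemma F_abelian_group: "abelian_group F"
proof (rule abelian_groupI)
  fix c assume "c \<in> carrier F"
  then show "\<exists>d\<in>carrier F. d \<oplus>\<^bsub>F\<^esub> c = \<zero>\<^bsub>F\<^esub>" by (intro bexI[of _ "- c"]) simp_all
qed (simp_all add: algebra_simps)

lemma F_ring: "ring F"
proof (rule ringI[OF F_abelian_group])
  show "Group.monoid F"
  proof (rule monoidI)
    fix c d e assume cde: "c \<in> carrier F" "d \<in> carrier F" "e \<in> carrier F"
    from cde(1) show "c \<otimes>\<^bsub>F\<^esub> d \<otimes>\<^bsub>F\<^esub> e = c \<otimes>\<^bsub>F\<^esub> (d \<otimes>\<^bsub>F\<^esub> e)"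
    proof (induction rule: F_induct)
      case c: (one x y)
      from cde(2) show ?case
      proof (induction rule: F_induct)
        case d: (one x' y')
        from cde(3) show ?case
          by (induction rule: F_induct)
            (use c d in \<open>simp_all add: mult_diff_right M.m_assoc N.m_assoc\<close>)
      qed (simp_all add: mult_diff_left mult_diff_right)
    qed (simp_all add: mult_diff_left)
  next
    fix c assume "c \<in> carrier F"
    then show "\<one>\<^bsub>F\<^esub> \<otimes>\<^bsub>F\<^esub> c = c"
      by (induction rule: F_induct) (simp_all add: mult_diff_right)
  next
    fix c assume "c \<in> carrier F"
    then show "c \<otimes>\<^bsub>F\<^esub> \<one>\<^bsub>F\<^esub> = c"
      by (induction rule: F_induct) (simp_all add: mult_diff_left)
  qed simp_all
qed (simp_all add: mult_add_left mult_add_right)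

interpretation F: ring F by (rule F_ring)

lemma F_minus: "c \<in> carrier F \<Longrightarrow> \<ominus>\<^bsub>F\<^esub> c = - c"
  by (rule F.minus_equality) simp_all

lemma relators_closed: "tensor_relators C M N \<subseteq> carrier F"
  unfolding tensor_relators_def by (auto simp: M_smult(1) N_smult(1))

lemma K_subgroup: "subgroup K (add_monoid F)"
  unfolding tensor_kernel_def using relators_closed by (intro F.add.generate_is_subgroup) simp

lemma K_closed: "c \<in> K \<Longrightarrow> c \<in> carrier F" "0 \<in> K" "c \<in> K \<Longrightarrow> d \<in> K \<Longrightarrow> c + d \<in> K"
  "c \<in> K \<Longrightarrow> - c \<in> K" "c \<in> K \<Longrightarrow> d \<in> K \<Longrightarrow> c - d \<in> K"
proof -
  show 1: "c \<in> K \<Longrightarrow> c \<in> carrier F" for c using subgroup.subset[OF K_subgroup] by auto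
  show "0 \<in> K" using subgroup.one_closed[OF K_subgroup] by simp
  show 2: "c \<in> K \<Longrightarrow> d \<in> K \<Longrightarrow> c + d \<in> K" for c d using subgroup.m_closed[OF K_subgroup, of c d] by simp
  show 3: "c \<in> K \<Longrightarrow> - c \<in> K" for c
    using subgroup.m_inv_closed[OF K_subgroup, of c] F_minus[of c] 1[of c] by (simp add: a_inv_def)
  show "c \<in> K \<Longrightarrow> d \<in> K \<Longrightarrow> c - d \<in> K" using 2[of c "- d"] 3[of d] by simp
qed

lemma relator_in_K: "r \<in> tensor_relators C M N \<Longrightarrow> r \<in> K"
  unfolding tensor_kernel_def by (rule generate.incl)

lemma K_induct [consumes 1, case_names zero rel diff]:
  assumes "c \<in> K" "Z 0" "\<And>r. r \<in> tensor_relators C M N \<Longrightarrow> Z r"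
    and diff: "\<And>a b. a \<in> K \<Longrightarrow> b \<in> K \<Longrightarrow> Z a \<Longrightarrow> Z b \<Longrightarrow> Z (a - b)"
  shows "Z c"
proof -
  have "c \<in> K \<and> Z c"
    using assms(1)[unfolded tensor_kernel_def]
  proof (induction rule: generate.induct)
    case one
    then show ?case using assms(2) K_closed(2) by simp
  next
    case (incl r)
    then show ?case using assms(3) by (simp add: relator_in_K)
  next
    case (inv r)
    have r: "r \<in> K" using inv by (rule relator_in_K)
    have "inv\<^bsub>add_monoid F\<^esub> r = 0 - r" using F_minus[OF K_closed(1)[OF r]] by (simp add: a_inv_def)
    then show ?case
      using diff[OF K_closed(2) r assms(2) assms(3)[OF inv]] K_closed(4)[OF r] by simp
  next
    case (eng a b)
    then have "Z (a - (0 - b))"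
      by (intro diff K_closed assms(2)) simp_all
    then show ?case using K_closed(3)[of a b] eng by simp
  qed
  then show ?thesis by simp
qed

lemma relators_in_K:
  "x \<in> carrier M \<Longrightarrow> x' \<in> carrier M \<Longrightarrow> y \<in> carrier N \<Longrightarrow>
    frag_of (x \<oplus>\<^bsub>M\<^esub> x', y) - frag_of (x, y) - frag_of (x', y) \<in> K"
  "x \<in> carrier M \<Longrightarrow> y \<in> carrier N \<Longrightarrow> y' \<in> carrier N \<Longrightarrow>
    frag_of (x, y \<oplus>\<^bsub>N\<^esub> y') - frag_of (x, y) - frag_of (x, y') \<in> K"
  "c \<in> carrier C \<Longrightarrow> x \<in> carrier M \<Longrightarrow> y \<in> carrier N \<Longrightarrow>
    frag_of (c \<odot>\<^bsub>M\<^esub> x, y) - frag_of (x, c \<odot>\<^bsub>N\<^esub> y) \<in> K"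
  by (rule relator_in_K; unfold tensor_relators_def; blast)+

lemma relatorE:
  assumes "r \<in> tensor_relators C M N"
  obtains x x' y where "r = frag_of (x \<oplus>\<^bsub>M\<^esub> x', y) - frag_of (x, y) - frag_of (x', y)"
      "x \<in> carrier M" "x' \<in> carrier M" "y \<in> carrier N"
  | x y y' where "r = frag_of (x, y \<oplus>\<^bsub>N\<^esub> y') - frag_of (x, y) - frag_of (x, y')"
      "x \<in> carrier M" "y \<in> carrier N" "y' \<in> carrier N"
  | c x y where "r = frag_of (c \<odot>\<^bsub>M\<^esub> x, y) - frag_of (x, c \<odot>\<^bsub>N\<^esub> y)"
      "c \<in> carrier C" "x \<in> carrier M" "y \<in> carrier N"
  using assms unfolding tensor_relators_def by blast

text \<open>By additivity it suffices to multiply a relator by a single pair, and this yields a relator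
  of the same kind.\<close>
lemma K_ideal: "ideal K F"
proof (rule idealI[OF F_ring K_subgroup])
  fix k d assume k: "k \<in> K" and d: "d \<in> carrier F"
  from d show "d \<otimes>\<^bsub>F\<^esub> k \<in> K"
  proof (induction rule: F_induct)
    case p: (one a b)
    from k show ?case
    proof (induction rule: K_induct)
      case (rel r)
      then show ?case
        by (cases rule: relatorE)
          (use p in \<open>simp_all add: mult_diff_right M.r_distr N.r_distr M_smult N_smult relators_in_K\<close>)
    qed (simp_all add: mult_diff_right K_closed)
  qed (simp_all add: mult_diff_left K_closed)
  from d show "k \<otimes>\<^bsub>F\<^esub> d \<in> K"
  proof (induction rule: F_induct)
    case p: (one a b)
    from k show ?case
    proof (induction rule: K_induct)
      case (rel r)
      then show ?case
        by (cases rule: relatorE)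
          (use p in \<open>simp_all add: mult_diff_left M.l_distr N.l_distr M_smult N_smult relators_in_K\<close>)
    qed (simp_all add: mult_diff_left K_closed)
  qed (simp_all add: mult_diff_right K_closed)
qed

interpretation K: ideal K F by (rule K_ideal)

lemma Q_ring: "ring Q"
  unfolding tensor_algebra_def by (rule K.quotient_is_ring)

abbreviation "cs c \<equiv> K +>\<^bsub>F\<^esub> c"

lemma Q_carrier: "carrier Q = cs ` carrier F"
  by (auto simp: tensor_algebra_def FactRing_def A_RCOSETS_def')

lemma Q_simps:
  "c \<in> carrier F \<Longrightarrow> d \<in> carrier F \<Longrightarrow> cs c \<oplus>\<^bsub>Q\<^esub> cs d = cs (c + d)"
  "c \<in> carrier F \<Longrightarrow> d \<in> carrier F \<Longrightarrow> cs c \<otimes>\<^bsub>Q\<^esub> cs d = cs (c \<otimes>\<^bsub>F\<^esub> d)"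
  "\<zero>\<^bsub>Q\<^esub> = cs 0" "\<one>\<^bsub>Q\<^esub> = cs (frag_of (\<one>\<^bsub>M\<^esub>, \<one>\<^bsub>N\<^esub>))"
  using K.a_rcos_sum[of c d] K.rcoset_mult_add[of c d] F.a_coset_add_zero[OF K.a_subset]
  by (simp_all add: tensor_algebra_def FactRing_def)

lemma cs_iff: "d \<in> cs c \<longleftrightarrow> d - c \<in> K"
proof
  assume "d \<in> cs c"
  then show "d - c \<in> K" unfolding a_r_coset_def' by auto
next
  assume "d - c \<in> K"
  then show "d \<in> cs c" unfolding a_r_coset_def' by (auto intro!: bexI[of _ "d - c"])
qed

lemma cs_eqI: "c \<in> carrier F \<Longrightarrow> d - c \<in> K \<Longrightarrow> cs d = cs c"
  using K.a_repr_independence'[of d c] by (simp add: cs_iff)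

lemma Q_minus: "c \<in> carrier F \<Longrightarrow> d \<in> carrier F \<Longrightarrow> cs c \<ominus>\<^bsub>Q\<^esub> cs d = cs (c - d)"
proof -
  interpret Q: ring Q by (rule Q_ring)
  assume cd: "c \<in> carrier F" "d \<in> carrier F"
  have "\<ominus>\<^bsub>Q\<^esub> cs d = cs (- d)"
    using cd by (intro Q.minus_equality) (simp_all add: Q_simps Q_carrier)
  then show ?thesis using cd by (simp add: a_minus_def Q_simps)
qed

lemma pure_closed [simp]: "x \<in> carrier M \<Longrightarrow> y \<in> carrier N \<Longrightarrow> pure x y \<in> carrier Q"
  by (simp add: pure_tensor_def Q_carrier)

lemma pure_mult: "x \<in> carrier M \<Longrightarrow> y \<in> carrier N \<Longrightarrow> x' \<in> carrier M \<Longrightarrow> y' \<in> carrier N \<Longrightarrow>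
    pure x y \<otimes>\<^bsub>Q\<^esub> pure x' y' = pure (x \<otimes>\<^bsub>M\<^esub> x') (y \<otimes>\<^bsub>N\<^esub> y')"
  by (simp add: pure_tensor_def Q_simps)

lemma pure_one: "\<one>\<^bsub>Q\<^esub> = pure \<one>\<^bsub>M\<^esub> \<one>\<^bsub>N\<^esub>"
  by (simp add: pure_tensor_def Q_simps)

text \<open>Differences suffice, since they generate sums and negatives.\<close>
lemma tensor_induct [consumes 1, case_names zero pure diff]:
  assumes "X \<in> carrier Q" "Z \<zero>\<^bsub>Q\<^esub>"
    and "\<And>x y. x \<in> carrier M \<Longrightarrow> y \<in> carrier N \<Longrightarrow> Z (pure x y)"
    and "\<And>X Y. X \<in> carrier Q \<Longrightarrow> Y \<in> carrier Q \<Longrightarrow> Z X \<Longrightarrow> Z Y \<Longrightarrow> Z (X \<ominus>\<^bsub>Q\<^esub> Y)"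
  shows "Z X"
proof -
  obtain c where c: "c \<in> carrier F" "X = cs c" using assms(1) by (auto simp: Q_carrier)
  from c(1) have "Z (cs c)"
  proof (induction rule: F_induct)
    case zero then show ?case using assms(2) by (simp add: Q_simps)
  next
    case (one x y) then show ?case using assms(3) by (simp add: pure_tensor_def)
  next
    case (diff a b) then show ?case using assms(4)[of "cs a" "cs b"] by (simp add: Q_minus Q_carrier)
  qed
  with c(2) show ?thesis by simp
qed

subsection \<open>Induced maps\<close>

context
  fixes H :: "('h, 'w) ring_scheme" and h :: "'m \<Rightarrow> 'n \<Rightarrow> 'h"
  assumes H: "abelian_group H"
    and h_closed: "\<And>x y. x \<in> carrier M \<Longrightarrow> y \<in> carrier N \<Longrightarrow> h x y \<in> carrier H"
    and h_add_left: "\<And>x x' y. x \<in> carrier M \<Longrightarrow> x' \<in> carrier M \<Longrightarrow> y \<in> carrier N \<Longrightarrow>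
      h (x \<oplus>\<^bsub>M\<^esub> x') y = h x y \<oplus>\<^bsub>H\<^esub> h x' y"
    and h_add_right: "\<And>x y y'. x \<in> carrier M \<Longrightarrow> y \<in> carrier N \<Longrightarrow> y' \<in> carrier N \<Longrightarrow>
      h x (y \<oplus>\<^bsub>N\<^esub> y') = h x y \<oplus>\<^bsub>H\<^esub> h x y'"
    and h_balanced: "\<And>c x y. c \<in> carrier C \<Longrightarrow> x \<in> carrier M \<Longrightarrow> y \<in> carrier N \<Longrightarrow>
      h (c \<odot>\<^bsub>M\<^esub> x) y = h x (c \<odot>\<^bsub>N\<^esub> y)"
begin

interpretation H: abelian_group H by (rule H)

abbreviation "fl \<equiv> free_lift H h"

lemma pow_closed: "p \<in> P \<Longrightarrow> add_pow H (i::int) (h (fst p) (snd p)) \<in> carrier H"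
  using H.add.int_pow_closed[of "h (fst p) (snd p)" i] by (auto simp: h_closed add_pow_def)

text \<open>Formal sums with different supports are compared over a common one.\<close>
lemma free_lift_superset:
  assumes "finite X" "Poly_Mapping.keys c \<subseteq> X" "X \<subseteq> P"
  shows "fl c = (\<Oplus>\<^bsub>H\<^esub>p\<in>X. add_pow H (Poly_Mapping.lookup c p) (h (fst p) (snd p)))"
proof -
  have "add_pow H (Poly_Mapping.lookup c p) (h (fst p) (snd p)) = \<zero>\<^bsub>H\<^esub>"
    if "p \<notin> Poly_Mapping.keys c" for p
    using that by (simp add: in_keys_iff add_pow_def)
  moreover have "add_pow H (Poly_Mapping.lookup c p) (h (fst p) (snd p)) \<in> carrier H" if "p \<in> X" for p
    using that assms(3) by (intro pow_closed) auto
  ultimately show ?thesis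
    unfolding free_lift_def using assms(1,2)
    by (intro H.add.finprod_mono_neutral_cong_left) auto
qed

lemma free_lift_closed: "c \<in> carrier F \<Longrightarrow> fl c \<in> carrier H"
  unfolding free_lift_def F_carrier by (intro H.finsum_closed Pi_I pow_closed) auto

lemma free_lift_add:
  assumes "c \<in> carrier F" "d \<in> carrier F"
  shows "fl (c + d) = fl c \<oplus>\<^bsub>H\<^esub> fl d"
proof -
  let ?X = "Poly_Mapping.keys c \<union> Poly_Mapping.keys d"
  let ?t = "\<lambda>(c :: 'm \<times> 'n \<Rightarrow>\<^sub>0 int) p. add_pow H (Poly_Mapping.lookup c p) (h (fst p) (snd p))"
  have X: "finite ?X" "?X \<subseteq> P" using assms by (auto simp: F_carrier)
  have t: "?t c p \<in> carrier H" if "p \<in> ?X" for c p using that X(2) by (intro pow_closed) auto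
  have "?t (c + d) p = ?t c p \<oplus>\<^bsub>H\<^esub> ?t d p" if "p \<in> ?X" for p
    using that X(2) H.add.int_pow_mult[of "h (fst p) (snd p)"]
    by (auto simp: lookup_add add_pow_def h_closed)
  then have "(\<Oplus>\<^bsub>H\<^esub>p\<in>?X. ?t (c + d) p) = (\<Oplus>\<^bsub>H\<^esub>p\<in>?X. ?t c p \<oplus>\<^bsub>H\<^esub> ?t d p)"
    using t by (intro H.finsum_cong') auto
  also have "\<dots> = (\<Oplus>\<^bsub>H\<^esub>p\<in>?X. ?t c p) \<oplus>\<^bsub>H\<^esub> (\<Oplus>\<^bsub>H\<^esub>p\<in>?X. ?t d p)"
    using t by (intro H.finsum_addf) auto
  finally show ?thesis
    using free_lift_superset[OF X(1) _ X(2), of c] free_lift_superset[OF X(1) _ X(2), of d]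
      free_lift_superset[OF X(1) _ X(2), of "c + d"] keys_add[of c d] by simp
qed

lemma free_lift_diff:
  assumes "c \<in> carrier F" "d \<in> carrier F"
  shows "fl (c - d) = fl c \<ominus>\<^bsub>H\<^esub> fl d"
proof -
  have "fl c = fl (c - d) \<oplus>\<^bsub>H\<^esub> fl d"
    using free_lift_add[of "c - d" d] assms by simp
  then show ?thesis
    using assms free_lift_closed[of d] free_lift_closed[of "c - d"]
    by (simp add: a_minus_def H.a_assoc H.r_neg)
qed

lemma free_lift_zero: "fl 0 = \<zero>\<^bsub>H\<^esub>"
  by (simp add: free_lift_def)

lemma free_lift_of: "x \<in> carrier M \<Longrightarrow> y \<in> carrier N \<Longrightarrow> fl (frag_of (x, y)) = h x y"
  using H.add.int_pow_1[of "h x y"] h_closed[of x y]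
  by (simp add: free_lift_def keys_frag_of add_pow_def)

text \<open>Biadditivity and balancedness of \<open>h\<close> are exactly the vanishing on the three kinds of
  relators.\<close>
lemma free_lift_kernel:
  assumes "c \<in> K"
  shows "fl c = \<zero>\<^bsub>H\<^esub>"
  using assms
proof (induction rule: K_induct)
  case (rel r)
  have *: "a \<oplus>\<^bsub>H\<^esub> b \<ominus>\<^bsub>H\<^esub> a \<ominus>\<^bsub>H\<^esub> b = \<zero>\<^bsub>H\<^esub>" if "a \<in> carrier H" "b \<in> carrier H" for a b
  proof -
    have "a \<oplus>\<^bsub>H\<^esub> b \<ominus>\<^bsub>H\<^esub> a \<ominus>\<^bsub>H\<^esub> b = (a \<oplus>\<^bsub>H\<^esub> b) \<oplus>\<^bsub>H\<^esub> (\<ominus>\<^bsub>H\<^esub> a \<oplus>\<^bsub>H\<^esub> \<ominus>\<^bsub>H\<^esub> b)"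
      using that by (simp add: a_minus_def H.a_assoc)
    also have "\<dots> = \<zero>\<^bsub>H\<^esub>"
      using that by (simp only: H.minus_add[symmetric]) (simp add: H.r_neg)
    finally show ?thesis .
  qed
  from rel show ?case
    by (cases rule: relatorE)
      (simp_all add: free_lift_diff free_lift_of h_add_left h_add_right h_balanced h_closed
        M_smult(1) N_smult(1) *, simp add: a_minus_def H.r_neg h_closed N_smult(1))
qed (simp_all add: free_lift_zero free_lift_diff K_closed(1) a_minus_def H.r_neg)

text \<open>The value is the same on all representatives, so the image of the coset is a singleton.\<close>
lemma tensor_lift_coset:
  assumes "c \<in> carrier F"
  shows "tensor_lift C M N H h (cs c) = fl c"
proof -
  have "fl d = fl c" if "d - c \<in> K" for d
    using free_lift_add[OF K_closed(1)[OF that] assms] free_lift_kernel[OF that]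
      free_lift_closed[OF assms] by simp
  then have "fl ` cs c = (\<lambda>_. fl c) ` cs c" by (intro image_cong refl) (simp add: cs_iff)
  also have "\<dots> = {fl c}"
    by (rule image_constant[of c]) (simp add: cs_iff K_closed)
  finally have "fl ` cs c = {fl c}" .
  moreover have "cs c \<in> carrier Q" using assms by (simp add: Q_carrier)
  ultimately show ?thesis
    by (simp add: tensor_lift_def free_lift_def[abs_def])
qed

lemma tensor_lift_pure:
  "x \<in> carrier M \<Longrightarrow> y \<in> carrier N \<Longrightarrow> tensor_lift C M N H h (pure x y) = h x y"
  by (simp add: pure_tensor_def tensor_lift_coset free_lift_of)

lemma tensor_lift_closed: "X \<in> carrier Q \<Longrightarrow> tensor_lift C M N H h X \<in> carrier H"
  by (auto simp: Q_carrier tensor_lift_coset free_lift_closed)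

lemma tensor_lift_add:
  "X \<in> carrier Q \<Longrightarrow> Y \<in> carrier Q \<Longrightarrow>
    tensor_lift C M N H h (X \<oplus>\<^bsub>Q\<^esub> Y) = tensor_lift C M N H h X \<oplus>\<^bsub>H\<^esub> tensor_lift C M N H h Y"
  by (auto simp: Q_carrier Q_simps tensor_lift_coset free_lift_add)

lemma tensor_lift_undef: "X \<notin> carrier Q \<Longrightarrow> tensor_lift C M N H h X = undefined"
  by (simp add: tensor_lift_def)

end

subsection \<open>Operators on the first factor\<close>

context
  fixes R :: "('b, 'w) ring_scheme" and act :: "'b \<Rightarrow> 'm \<Rightarrow> 'm"
  assumes act: "left_module R (with_smult M act)"
    and act_scalar: "\<And>b c x. b \<in> carrier R \<Longrightarrow> c \<in> carrier C \<Longrightarrow> x \<in> carrier M \<Longrightarrow>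
      act b (c \<odot>\<^bsub>M\<^esub> x) = c \<odot>\<^bsub>M\<^esub> act b x"
begin

interpretation L: left_module R "with_smult M act" by (rule act)

lemma act_simps [simp]:
  "b \<in> carrier R \<Longrightarrow> x \<in> carrier M \<Longrightarrow> act b x \<in> carrier M"
  "b \<in> carrier R \<Longrightarrow> x \<in> carrier M \<Longrightarrow> y \<in> carrier M \<Longrightarrow> act b (x \<oplus>\<^bsub>M\<^esub> y) = act b x \<oplus>\<^bsub>M\<^esub> act b y"
  "b \<in> carrier R \<Longrightarrow> b' \<in> carrier R \<Longrightarrow> x \<in> carrier M \<Longrightarrow> act (b \<oplus>\<^bsub>R\<^esub> b') x = act b x \<oplus>\<^bsub>M\<^esub> act b' x"
  "b \<in> carrier R \<Longrightarrow> b' \<in> carrier R \<Longrightarrow> x \<in> carrier M \<Longrightarrow> act (b \<otimes>\<^bsub>R\<^esub> b') x = act b (act b' x)"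
  "x \<in> carrier M \<Longrightarrow> act \<one>\<^bsub>R\<^esub> x = x"
  using L.smult_closed[of b x] L.smult_r_distr[of b x y] L.smult_l_distr[of b b' x]
    L.smult_assoc1[of b b' x] L.smult_one[of x]
  by (simp_all add: with_smult_def)

definition free_act :: "'b \<Rightarrow> (('m \<times> 'n) \<Rightarrow>\<^sub>0 int) \<Rightarrow> (('m \<times> 'n) \<Rightarrow>\<^sub>0 int)" where
  "free_act b = frag_extend (\<lambda>(x, y). frag_of (act b x, y))"

lemma free_act_simps [simp]:
  "free_act b 0 = 0" "free_act b (c - d) = free_act b c - free_act b d"
  "free_act b (c + d) = free_act b c + free_act b d"
  "free_act b (frag_of (x, y)) = frag_of (act b x, y)"
  by (simp_all add: free_act_def frag_extend_diff frag_extend_add)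

lemma free_act_closed: "c \<in> carrier F \<Longrightarrow> b \<in> carrier R \<Longrightarrow> free_act b c \<in> carrier F"
  by (induction rule: F_induct) simp_all

text \<open>Operators send each relator to a relator of the same kind; for the balancing relators this is
  the linearity over the scalars.\<close>
lemma free_act_kernel: "c \<in> K \<Longrightarrow> b \<in> carrier R \<Longrightarrow> free_act b c \<in> K"
proof (induction rule: K_induct)
  case (rel r)
  from rel(1) show ?case
    by (cases rule: relatorE) (use rel(2) in \<open>simp_all add: act_scalar relators_in_K\<close>)
qed (simp_all add: K_closed)

lemma tensor_act_coset:
  assumes "b \<in> carrier R" "c \<in> carrier F"
  shows "tensor_left_action C M N act b (cs c) = cs (free_act b c)"
proof -
  have const: "cs (free_act b d) = cs (free_act b c)" if "d \<in> cs c" for d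
    using that free_act_kernel[OF _ assms(1), of "d - c"] free_act_closed[OF assms(2,1)]
    by (intro cs_eqI) (simp_all add: cs_iff)
  have "c \<in> cs c" by (simp add: cs_iff K_closed)
  then have "(\<Union>d\<in>cs c. cs (free_act b d)) = cs (free_act b c)"
    by (intro SUP_eq_const const) blast
  then show ?thesis by (simp add: tensor_left_action_def free_act_def)
qed

lemma tensor_left_module: "left_module R (with_smult Q (tensor_left_action C M N act))"
proof -
  let ?T = "with_smult Q (tensor_left_action C M N act)"
  interpret Q: ring Q by (rule Q_ring)
  have T: "carrier ?T = cs ` carrier F" "X \<oplus>\<^bsub>?T\<^esub> Y = X \<oplus>\<^bsub>Q\<^esub> Y" "\<zero>\<^bsub>?T\<^esub> = \<zero>\<^bsub>Q\<^esub>"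
    "b \<odot>\<^bsub>?T\<^esub> X = tensor_left_action C M N act b X" for X Y b
    by (simp_all add: with_smult_def Q_carrier)
  have ag: "abelian_group ?T"
    by (rule abelian_group_cong[OF Q.is_abelian_group]) (simp_all add: with_smult_def)
  have d: "free_act (b \<oplus>\<^bsub>R\<^esub> b') c - (free_act b c + free_act b' c) \<in> K"
    if "c \<in> carrier F" "b \<in> carrier R" "b' \<in> carrier R" for b b' c
    using that(1)
  proof (induction rule: F_induct)
    case (diff c d)
    then show ?case
      using K_closed(5)[OF diff(3,4)] by (simp add: algebra_simps)
  qed (use that(2,3) relators_in_K(1)[of "act b _" "act b' _"] in \<open>simp_all add: K_closed diff_diff_eq[symmetric]\<close>)
  then have ladd: "cs (free_act (b \<oplus>\<^bsub>R\<^esub> b') c) = cs (free_act b c + free_act b' c)"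
    if "c \<in> carrier F" "b \<in> carrier R" "b' \<in> carrier R" for b b' c
    using that by (intro cs_eqI) (simp_all add: free_act_closed)
  have assoc: "free_act (b \<otimes>\<^bsub>R\<^esub> b') c = free_act b (free_act b' c)"
    if "c \<in> carrier F" "b \<in> carrier R" "b' \<in> carrier R" for b b' c
    using that by (induction rule: F_induct) simp_all
  have one: "free_act \<one>\<^bsub>R\<^esub> c = c" if "c \<in> carrier F" for c
    using that by (induction rule: F_induct) simp_all
  show ?thesis
    unfolding left_module_def left_module_axioms_def T
    by (intro conjI allI impI L.R.ring_axioms ag)
      (auto simp: tensor_act_coset free_act_closed Q_simps assoc one ladd)
qed

lemma tensor_lift_lhom:
  fixes H :: "('b, 'h) module" and h :: "'m \<Rightarrow> 'n \<Rightarrow> 'h"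
  assumes H: "left_module R H"
    and h: "\<And>x y. x \<in> carrier M \<Longrightarrow> y \<in> carrier N \<Longrightarrow> h x y \<in> carrier H"
      "\<And>x x' y. x \<in> carrier M \<Longrightarrow> x' \<in> carrier M \<Longrightarrow> y \<in> carrier N \<Longrightarrow>
        h (x \<oplus>\<^bsub>M\<^esub> x') y = h x y \<oplus>\<^bsub>H\<^esub> h x' y"
      "\<And>x y y'. x \<in> carrier M \<Longrightarrow> y \<in> carrier N \<Longrightarrow> y' \<in> carrier N \<Longrightarrow>
        h x (y \<oplus>\<^bsub>N\<^esub> y') = h x y \<oplus>\<^bsub>H\<^esub> h x y'"
      "\<And>c x y. c \<in> carrier C \<Longrightarrow> x \<in> carrier M \<Longrightarrow> y \<in> carrier N \<Longrightarrow>
        h (c \<odot>\<^bsub>M\<^esub> x) y = h x (c \<odot>\<^bsub>N\<^esub> y)"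
    and linear: "\<And>b x y. b \<in> carrier R \<Longrightarrow> x \<in> carrier M \<Longrightarrow> y \<in> carrier N \<Longrightarrow>
      h (act b x) y = b \<odot>\<^bsub>H\<^esub> h x y"
  shows "tensor_lift C M N H h \<in> lhom R (with_smult Q (tensor_left_action C M N act)) H"
proof -
  interpret H: left_module R H by (rule H)
  note lift = H.M.abelian_group_axioms h
  have *: "free_lift H h (free_act b c) = b \<odot>\<^bsub>H\<^esub> free_lift H h c"
    if "c \<in> carrier F" "b \<in> carrier R" for b c
    using that
  proof (induction rule: F_induct)
    case (diff c d)
    then show ?case
      by (simp add: free_lift_diff[OF lift] free_act_closed free_lift_closed[OF lift] a_minus_def
          H.smult_r_distr H.smult_r_minus)
  qed (simp_all add: free_lift_zero[OF lift] free_lift_of[OF lift] linear)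
  show ?thesis
    by (rule lhomI)
      (auto simp: with_smult_def tensor_lift_closed[OF lift] tensor_lift_add[OF lift]
        tensor_lift_undef[OF lift] Q_carrier tensor_act_coset tensor_lift_coset[OF lift]
        free_act_closed * free_lift_closed[OF lift] Q_simps free_lift_add[OF lift])
qed

end

end

lemma ideal_prod_zero_iff:
  assumes "ring X" "K \<subseteq> carrier X" "L \<subseteq> carrier X" "\<zero>\<^bsub>X\<^esub> \<in> K" "\<zero>\<^bsub>X\<^esub> \<in> L"
  shows "K \<cdot>\<^bsub>X\<^esub> L = {\<zero>\<^bsub>X\<^esub>} \<longleftrightarrow> (\<forall>x\<in>K. \<forall>y\<in>L. x \<otimes>\<^bsub>X\<^esub> y = \<zero>\<^bsub>X\<^esub>)"
proof
  show "\<forall>x\<in>K. \<forall>y\<in>L. x \<otimes>\<^bsub>X\<^esub> y = \<zero>\<^bsub>X\<^esub>" if "K \<cdot>\<^bsub>X\<^esub> L = {\<zero>\<^bsub>X\<^esub>}"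
    using that ideal_prod.prod[of _ K _ L X] by blast
next
  interpret X: ring X by fact
  assume z: "\<forall>x\<in>K. \<forall>y\<in>L. x \<otimes>\<^bsub>X\<^esub> y = \<zero>\<^bsub>X\<^esub>"
  have "x = \<zero>\<^bsub>X\<^esub>" if "x \<in> K \<cdot>\<^bsub>X\<^esub> L" for x
    using that by induction (use z in auto)
  moreover have "\<zero>\<^bsub>X\<^esub> \<in> K \<cdot>\<^bsub>X\<^esub> L"
    using ideal_prod.prod[OF assms(4,5), of X] by simp
  ultimately show "K \<cdot>\<^bsub>X\<^esub> L = {\<zero>\<^bsub>X\<^esub>}" by blast
qed

section \<open>Rigidity of the self-injective hull\<close>

locale semiprime_extension =
  fixes k :: "'k ring" and A :: "('k, 'a) module" and B :: "('a \<Rightarrow> 'a) set"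
    and E :: "('a \<Rightarrow> 'a, 'e) module" and \<iota> :: "'a \<Rightarrow> 'e"
  assumes alg: "assoc_algebra k A"
    and sub: "k_subalgebra k (endo_algebra k A) B"
    and mult_sub: "multiplication_algebra k A \<subseteq> B"
    and semiprime: "B_semiprime k A B"
    and hull: "injective_hull (operator_algebra k A B) (operator_module A) E \<iota>"
begin

abbreviation "R \<equiv> operator_algebra k A B"
abbreviation "M \<equiv> operator_module A"
abbreviation "H \<equiv> self_injective_hull R M E"
abbreviation "u \<equiv> \<iota> \<one>\<^bsub>A\<^esub>"
abbreviation "S \<equiv> right_endo_ring R H"
abbreviation "endo \<equiv> endo_at R H u"

sublocale A: assoc_algebra k A by (rule alg)

lemma endo_alg: "assoc_algebra k (endo_algebra k A)"
  by (rule endo_algebra_assoc_algebra[OF A.module_axioms])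

sublocale R: assoc_algebra k R
  by (rule operator_assoc_algebra[OF A.module_axioms sub])

lemma R_simps [simp]:
  "carrier R = B"
  "b \<otimes>\<^bsub>R\<^esub> b' = compose (carrier A) b b'"
  "\<one>\<^bsub>R\<^esub> = (\<lambda>x\<in>carrier A. x)"
  "b \<oplus>\<^bsub>R\<^esub> b' = (\<lambda>x\<in>carrier A. b x \<oplus>\<^bsub>A\<^esub> b' x)"
  "c \<odot>\<^bsub>R\<^esub> b = (\<lambda>x\<in>carrier A. c \<odot>\<^bsub>A\<^esub> b x)"
  by (simp_all add: operator_algebra_def endo_algebra_def)

lemma M_simps [simp]:
  "carrier M = carrier A" "x \<oplus>\<^bsub>M\<^esub> y = x \<oplus>\<^bsub>A\<^esub> y" "\<zero>\<^bsub>M\<^esub> = \<zero>\<^bsub>A\<^esub>" "b \<odot>\<^bsub>M\<^esub> x = b x"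
  by (simp_all add: operator_module_def with_smult_def)

lemma B_lhom: "b \<in> B \<Longrightarrow> b \<in> lhom k A A"
  using sub subringE(1)[of B "endo_algebra k A"] by (auto simp: k_subalgebra_def endo_algebra_def)

lemma B_closed [simp]: "b \<in> B \<Longrightarrow> x \<in> carrier A \<Longrightarrow> b x \<in> carrier A"
  using B_lhom by (rule lhom_closed)

lemma B_add: "b \<in> B \<Longrightarrow> x \<in> carrier A \<Longrightarrow> y \<in> carrier A \<Longrightarrow> b (x \<oplus>\<^bsub>A\<^esub> y) = b x \<oplus>\<^bsub>A\<^esub> b y"
  using B_lhom by (rule lhom_add)

lemma mult_in_endo: "a \<in> carrier A \<Longrightarrow> lmult A a \<in> carrier (endo_algebra k A)"
  "a \<in> carrier A \<Longrightarrow> rmult A a \<in> carrier (endo_algebra k A)"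
  using module_left_module[OF A.module_axioms]
  by (auto simp: endo_algebra_def lmult_def rmult_def A.r_distr A.l_distr A.smult_mult_left
      A.smult_mult_right intro!: restrict_lhom)

lemma mult_B: "a \<in> carrier A \<Longrightarrow> lmult A a \<in> B" "a \<in> carrier A \<Longrightarrow> rmult A a \<in> B"
proof -
  have "lmult A ` carrier A \<union> rmult A ` carrier A \<subseteq> multiplication_algebra k A"
    unfolding multiplication_algebra_def
    by (rule generated_subalgebra(2)[OF endo_alg]) (use mult_in_endo in auto)
  then show "a \<in> carrier A \<Longrightarrow> lmult A a \<in> B" "a \<in> carrier A \<Longrightarrow> rmult A a \<in> B"
    using mult_sub by auto
qed

lemma mult_apply [simp]:
  "x \<in> carrier A \<Longrightarrow> lmult A a x = a \<otimes>\<^bsub>A\<^esub> x" "x \<in> carrier A \<Longrightarrow> rmult A a x = x \<otimes>\<^bsub>A\<^esub> a"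
  by (simp_all add: lmult_def rmult_def)

lemma M_left_module: "left_module R M"
  by (rule operator_left_module[OF A.module_axioms sub])

sublocale M: left_module R M by (rule M_left_module)
sublocale H: left_module R H by (rule hull_left_module[OF M_left_module hull])

lemma iota: "\<iota> \<in> lhom R M H" "inj_on \<iota> (carrier A)"
  using hull_embedding[OF M_left_module hull] by simp_all

lemma iota_closed [simp]: "x \<in> carrier A \<Longrightarrow> \<iota> x \<in> carrier H"
  using lhom_closed[OF iota(1)] by simp

lemma iota_add: "x \<in> carrier A \<Longrightarrow> y \<in> carrier A \<Longrightarrow> \<iota> (x \<oplus>\<^bsub>A\<^esub> y) = \<iota> x \<oplus>\<^bsub>H\<^esub> \<iota> y"
  using lhom_add[OF iota(1)] by simp

lemma iota_smult: "b \<in> B \<Longrightarrow> x \<in> carrier A \<Longrightarrow> \<iota> (b x) = b \<odot>\<^bsub>H\<^esub> \<iota> x"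
  using lhom_smult[OF iota(1)] by simp

lemma iota_zero [simp]: "\<iota> \<zero>\<^bsub>A\<^esub> = \<zero>\<^bsub>H\<^esub>"
  using lhom_zero[OF M_left_module H.left_module_axioms iota(1)] by simp

lemma iota_eq [simp]: "x \<in> carrier A \<Longrightarrow> y \<in> carrier A \<Longrightarrow> \<iota> x = \<iota> y \<longleftrightarrow> x = y"
  using iota(2) by (auto simp: inj_on_def)

lemma iota_essential: "essential R H (\<iota> ` carrier A)"
  using hull_essential[OF M_left_module hull] by simp

subsection \<open>Stable ideals of a semiprime algebra\<close>

lemma stableD:
  assumes "submodule K R M"
  shows "K \<subseteq> carrier A" "\<zero>\<^bsub>A\<^esub> \<in> K"
    and "x \<in> K \<Longrightarrow> y \<in> K \<Longrightarrow> x \<oplus>\<^bsub>A\<^esub> y \<in> K"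
    and "b \<in> B \<Longrightarrow> x \<in> K \<Longrightarrow> b x \<in> K"
    and "a \<in> carrier A \<Longrightarrow> x \<in> K \<Longrightarrow> a \<otimes>\<^bsub>A\<^esub> x \<in> K"
    and "a \<in> carrier A \<Longrightarrow> x \<in> K \<Longrightarrow> x \<otimes>\<^bsub>A\<^esub> a \<in> K"
proof -
  show K: "K \<subseteq> carrier A" "\<zero>\<^bsub>A\<^esub> \<in> K"
    and "x \<in> K \<Longrightarrow> y \<in> K \<Longrightarrow> x \<oplus>\<^bsub>A\<^esub> y \<in> K"
    and b: "b \<in> B \<Longrightarrow> x \<in> K \<Longrightarrow> b x \<in> K" for b
    using assms by (simp_all add: M.submodule_iff)
  show "a \<otimes>\<^bsub>A\<^esub> x \<in> K" if "a \<in> carrier A" "x \<in> K"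
    using b[OF mult_B(1)[OF that(1)] that(2)] that K by (simp add: subset_iff)
  show "x \<otimes>\<^bsub>A\<^esub> a \<in> K" if "a \<in> carrier A" "x \<in> K"
    using b[OF mult_B(2)[OF that(1)] that(2)] that K by (simp add: subset_iff)
qed

lemma square_zero:
  assumes "submodule K R M" "\<And>x y. x \<in> K \<Longrightarrow> y \<in> K \<Longrightarrow> x \<otimes>\<^bsub>A\<^esub> y = \<zero>\<^bsub>A\<^esub>"
  shows "K = {\<zero>\<^bsub>A\<^esub>}"
proof -
  have "K \<cdot>\<^bsub>A\<^esub> K = {\<zero>\<^bsub>A\<^esub>}"
    using ideal_prod_zero_iff[OF A.ring_axioms, of K K] stableD(1,2)[OF assms(1)] assms(2) by simp
  then show ?thesis
    using semiprime assms(1) by (auto simp: B_semiprime_def stable_ideal_def)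
qed

text \<open>Stable ideals are two-sided, so their intersection contains all products; if the products
  vanish, it has square zero.\<close>
lemma annihilate_iff_disjoint:
  assumes K: "submodule K R M" and L: "submodule L R M"
  shows "(\<forall>x\<in>K. \<forall>y\<in>L. x \<otimes>\<^bsub>A\<^esub> y = \<zero>\<^bsub>A\<^esub>) \<longleftrightarrow> K \<inter> L = {\<zero>\<^bsub>A\<^esub>}"
proof
  assume "\<forall>x\<in>K. \<forall>y\<in>L. x \<otimes>\<^bsub>A\<^esub> y = \<zero>\<^bsub>A\<^esub>"
  then show "K \<inter> L = {\<zero>\<^bsub>A\<^esub>}"
    by (intro square_zero M.submodule_Int K L) auto
next
  assume KL: "K \<inter> L = {\<zero>\<^bsub>A\<^esub>}"
  have "x \<otimes>\<^bsub>A\<^esub> y \<in> K \<inter> L" if "x \<in> K" "y \<in> L" for x y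
    using stableD(1,5)[OF L] stableD(1,6)[OF K] that by (simp add: subset_iff)
  with KL show "\<forall>x\<in>K. \<forall>y\<in>L. x \<otimes>\<^bsub>A\<^esub> y = \<zero>\<^bsub>A\<^esub>" by blast
qed

text \<open>The image \<open>F\<close> of \<open>f\<close> is a stable ideal. It annihilates \<open>K\<close> because
  \<open>f(x) y = f(xy) = x f(y)\<close>, hence misses \<open>K\<close> and, \<open>K\<close> being essential in \<open>N\<close>, also
  \<open>N\<close>. The square of \<open>F\<close> lies in the image of \<open>F \<inter> N\<close> and is zero.\<close>
lemma polyform:
  assumes N: "submodule N R M" and f: "f \<in> lhom R (M\<lparr>carrier := N\<rparr>) M"
    and K: "submodule K R M" "K \<subseteq> N" "\<And>x. x \<in> K \<Longrightarrow> f x = \<zero>\<^bsub>A\<^esub>"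
    and ess: "\<And>L. submodule L R M \<Longrightarrow> L \<subseteq> N \<Longrightarrow> L \<inter> K = {\<zero>\<^bsub>A\<^esub>} \<Longrightarrow> L = {\<zero>\<^bsub>A\<^esub>}"
    and x: "x \<in> N"
  shows "f x = \<zero>\<^bsub>A\<^esub>"
proof -
  note NA = stableD(1)[OF N]
  have MN: "left_module R (M\<lparr>carrier := N\<rparr>)" by (rule M.submodule_left_module[OF N])
  have NN: "submodule N R (M\<lparr>carrier := N\<rparr>)" using N by (simp add: M.submodule_of_submodule)
  let ?F = "f ` N"
  have F: "submodule ?F R M" by (rule lhom_image[OF MN M_left_module f NN])
  have fc: "f x \<in> carrier A" if "x \<in> N" for x using lhom_closed[OF f] that by simp
  have fb: "f (b x) = b (f x)" if "b \<in> B" "x \<in> N" for b x using lhom_smult[OF f] that by simp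
  have fr: "f x \<otimes>\<^bsub>A\<^esub> y = f (x \<otimes>\<^bsub>A\<^esub> y)" if "x \<in> N" "y \<in> carrier A" for x y
    using fb[OF mult_B(2)[OF that(2)] that(1)] that NA fc by (simp add: subset_iff)
  have fl: "x \<otimes>\<^bsub>A\<^esub> f y = f (x \<otimes>\<^bsub>A\<^esub> y)" if "y \<in> N" "x \<in> carrier A" for x y
    using fb[OF mult_B(1)[OF that(2)] that(1)] that NA fc by (simp add: subset_iff)
  have "z \<otimes>\<^bsub>A\<^esub> y = \<zero>\<^bsub>A\<^esub>" if z: "z \<in> ?F" and y: "y \<in> K" for z y
  proof -
    obtain x where x: "x \<in> N" "z = f x" using z by blast
    then have "z \<otimes>\<^bsub>A\<^esub> y = x \<otimes>\<^bsub>A\<^esub> f y"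
      using fr[OF x(1)] fl[of y x] y K(2) NA by (simp add: subset_iff)
    then show ?thesis using K(3)[OF y] x(1) NA by (simp add: subset_iff)
  qed
  then have FK: "?F \<inter> K = {\<zero>\<^bsub>A\<^esub>}" using annihilate_iff_disjoint[OF F K(1)] by blast
  have "?F \<inter> N = {\<zero>\<^bsub>A\<^esub>}"
  proof (rule ess[OF M.submodule_Int[OF F N]])
    show "?F \<inter> N \<inter> K = {\<zero>\<^bsub>A\<^esub>}" using FK K(2) by blast
  qed simp
  moreover have "\<forall>z\<in>?F. \<forall>w\<in>?F. z \<otimes>\<^bsub>A\<^esub> w \<in> f ` (?F \<inter> N)"
  proof (intro ballI)
    fix z w assume zw: "z \<in> ?F" "w \<in> ?F"
    then obtain x where x: "x \<in> N" "z = f x" by blast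
    have "x \<otimes>\<^bsub>A\<^esub> w \<in> ?F \<inter> N"
      using stableD(5)[OF F, of x w] stableD(6)[OF N, of w x] stableD(1)[OF F] zw x NA
      by (simp add: subset_iff)
    moreover have "z \<otimes>\<^bsub>A\<^esub> w = f (x \<otimes>\<^bsub>A\<^esub> w)"
      using fr[OF x(1), of w] x(2) stableD(1)[OF F] zw(2) by blast
    ultimately show "z \<otimes>\<^bsub>A\<^esub> w \<in> f ` (?F \<inter> N)" by blast
  qed
  moreover have "f \<zero>\<^bsub>A\<^esub> = \<zero>\<^bsub>A\<^esub>" using lhom_zero[OF MN M_left_module f] by simp
  ultimately have "z \<otimes>\<^bsub>A\<^esub> w = \<zero>\<^bsub>A\<^esub>" if "z \<in> ?F" "w \<in> ?F" for z w
    using that by (metis empty_iff image_empty image_insert insert_iff)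
  then have "?F = {\<zero>\<^bsub>A\<^esub>}" by (rule square_zero[OF F])
  then show ?thesis using x by blast
qed

subsection \<open>Homomorphisms into the hull\<close>

text \<open>On the ideal \<open>N\<close> of elements with value in \<open>A\<close>, the map is a partial endomorphism of \<open>A\<close>
  with essential kernel, so it vanishes there. The image of \<open>g\<close> then meets \<open>A\<close> trivially, and
  \<open>A\<close> is essential in the hull.\<close>
lemma vanish_on_essential:
  assumes g: "g \<in> lhom R M H" and D: "essential R M D"
    and gD: "\<And>x. x \<in> D \<Longrightarrow> g x = \<zero>\<^bsub>H\<^esub>" and a: "a \<in> carrier A"
  shows "g a = \<zero>\<^bsub>H\<^esub>"
proof -
  let ?I = "\<iota> ` carrier A"
  define N where "N = {x \<in> carrier M. g x \<in> ?I}"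
  have N: "submodule N R M"
    unfolding N_def
    by (rule lhom_vimage[OF M_left_module H.left_module_axioms g essentialD(1)[OF iota_essential]])
  have NA: "N \<subseteq> carrier A" by (rule stableD(1)[OF N])
  have MN: "left_module R (M\<lparr>carrier := N\<rparr>)" by (rule M.submodule_left_module[OF N])
  define h where "h = (\<lambda>x\<in>N. inv_into (carrier A) \<iota> (g x))"
  have h: "h \<in> lhom R (M\<lparr>carrier := N\<rparr>) M"
    using lhom_factor[OF MN M_left_module iota(1) _ lhom_sub[OF M_left_module N g]] iota(2)
    by (simp add: h_def N_def cong: restrict_cong)
  have gh: "g x = \<iota> (h x)" if "x \<in> N" for x
    using that by (simp add: h_def N_def f_inv_into_f)
  have "h x = \<zero>\<^bsub>A\<^esub>" if "x \<in> N" for x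
  proof (rule polyform[OF N h _ _ _ _ that])
    show "submodule (D \<inter> N) R M" by (rule M.submodule_Int[OF essentialD(1)[OF D] N])
    show "h x = \<zero>\<^bsub>A\<^esub>" if x: "x \<in> D \<inter> N" for x
    proof -
      have "\<iota> (h x) = \<iota> \<zero>\<^bsub>A\<^esub>" using gh[of x] gD[of x] x by simp
      then show ?thesis
        using lhom_closed[OF h, of x] x iota_eq[of "h x" "\<zero>\<^bsub>A\<^esub>"] by simp
    qed
    fix L assume L: "submodule L R M" "L \<subseteq> N" "L \<inter> (D \<inter> N) = {\<zero>\<^bsub>A\<^esub>}"
    then have "D \<inter> L = {\<zero>\<^bsub>M\<^esub>}" by auto
    then show "L = {\<zero>\<^bsub>A\<^esub>}" using essentialD(2)[OF D L(1)] by simp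
  qed simp
  then have gN: "g x = \<zero>\<^bsub>H\<^esub>" if "x \<in> N" for x using gh[OF that] that by simp
  have "submodule (g ` carrier M) R H"
    by (rule lhom_image[OF M_left_module H.left_module_axioms g M.carrier_submodule])
  moreover have "?I \<inter> g ` carrier M = {\<zero>\<^bsub>H\<^esub>}"
  proof (intro equalityI subsetI)
    fix y assume y: "y \<in> ?I \<inter> g ` carrier M"
    from IntD2[OF y] obtain x where x: "x \<in> carrier M" "y = g x" by blast
    then have "x \<in> N" using IntD1[OF y] unfolding N_def by simp
    then show "y \<in> {\<zero>\<^bsub>H\<^esub>}" using gN[of x] x(2) by simp
  next
    fix y assume y: "y \<in> {\<zero>\<^bsub>H\<^esub>}"
    then have "y = g \<zero>\<^bsub>A\<^esub>" "y = \<iota> \<zero>\<^bsub>A\<^esub>"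
      using lhom_zero[OF M_left_module H.left_module_axioms g] by simp_all
    then show "y \<in> ?I \<inter> g ` carrier M" by (intro IntI) (rule image_eqI, assumption, simp)+
  qed
  ultimately have "g ` carrier M = {\<zero>\<^bsub>H\<^esub>}" by (rule essentialD(2)[OF iota_essential])
  then show ?thesis using a by auto
qed

lemma hull_induct:
  assumes K: "submodule K R H" and gen: "\<And>f a. f \<in> lhom R M H \<Longrightarrow> a \<in> carrier A \<Longrightarrow> f a \<in> K"
    and x: "x \<in> carrier H"
  shows "x \<in> K"
proof -
  have "trace_submodule R M H \<subseteq> K" using K gen by (intro trace_minimal) auto
  then show ?thesis
    using hull_generated_by[OF M_left_module hull] x by (auto simp: generated_by_def)
qed

lemma preimage_essential: "f \<in> lhom R M H \<Longrightarrow> essential R M {x \<in> carrier A. f x \<in> \<iota> ` carrier A}"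
  using essential_vimage[OF M_left_module H.left_module_axioms _ iota_essential] by simp

text \<open>For \<open>f\<close> from \<open>A\<close> to the hull, the composite of \<open>f\<close> and \<open>g\<close> vanishes on the elements that
  \<open>f\<close> sends to \<open>A\<close>, and these form an essential ideal. So \<open>g\<close> kills the image of every
  such \<open>f\<close>.\<close>
lemma endo_zero:
  assumes g: "g \<in> lhom R H H" and z: "\<And>a. a \<in> carrier A \<Longrightarrow> g (\<iota> a) = \<zero>\<^bsub>H\<^esub>"
    and x: "x \<in> carrier H"
  shows "g x = \<zero>\<^bsub>H\<^esub>"
proof -
  have "x \<in> {x \<in> carrier H. g x = \<zero>\<^bsub>H\<^esub>}"
  proof (rule hull_induct[OF lhom_kernel[OF H.left_module_axioms H.left_module_axioms g] _ x])
    fix f a assume f: "f \<in> lhom R M H" and a: "a \<in> carrier A"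
    have "compose (carrier M) g f a = \<zero>\<^bsub>H\<^esub>"
    proof (rule vanish_on_essential[OF lhom_compose[OF M_left_module f g] preimage_essential[OF f] _ a])
      fix y assume "y \<in> {x \<in> carrier A. f x \<in> \<iota> ` carrier A}"
      then show "compose (carrier M) g f y = \<zero>\<^bsub>H\<^esub>" using z by (auto simp: compose_def)
    qed
    then show "f a \<in> {x \<in> carrier H. g x = \<zero>\<^bsub>H\<^esub>}"
      using lhom_closed[OF f] a by (simp add: compose_def)
  qed
  then show ?thesis by simp
qed

text \<open>Rigidity: the difference of the two endomorphisms vanishes on an essential ideal of \<open>A\<close>,
  hence on \<open>A\<close>, hence on the hull.\<close>
lemma endo_eqI:
  assumes f: "f \<in> lhom R H H" and g: "g \<in> lhom R H H" and D: "essential R M D"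
    and fg: "\<And>a. a \<in> D \<Longrightarrow> f (\<iota> a) = g (\<iota> a)"
  shows "f = g"
proof (rule lhom_eqI[OF f g])
  fix x assume x: "x \<in> carrier H"
  let ?d = "\<lambda>x\<in>carrier H. f x \<oplus>\<^bsub>H\<^esub> \<ominus>\<^bsub>H\<^esub> g x"
  have d: "?d \<in> lhom R H H" by (rule lhom_diff[OF H.left_module_axioms H.left_module_axioms f g])
  have DA: "D \<subseteq> carrier A" by (rule stableD(1)[OF essentialD(1)[OF D]])
  have "?d x = \<zero>\<^bsub>H\<^esub>"
  proof (rule endo_zero[OF d _ x])
    fix a assume a: "a \<in> carrier A"
    have "compose (carrier M) ?d \<iota> a = \<zero>\<^bsub>H\<^esub>"
    proof (rule vanish_on_essential[OF lhom_compose[OF M_left_module iota(1) d] D _ a])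
      fix y assume "y \<in> D"
      then show "compose (carrier M) ?d \<iota> y = \<zero>\<^bsub>H\<^esub>"
        using fg[of y] DA lhom_closed[OF g, of "\<iota> y"] by (auto simp: compose_def H.M.r_neg)
    qed
    then show "?d (\<iota> a) = \<zero>\<^bsub>H\<^esub>" using a by (simp add: compose_def)
  qed
  then show "f x = g x"
    using x lhom_closed[OF f x] lhom_closed[OF g x] H.M.minus_equality[of "f x" "\<ominus>\<^bsub>H\<^esub> g x"]
    by simp
qed

lemma endo_eqI_one:
  assumes f: "f \<in> lhom R H H" and g: "g \<in> lhom R H H" and fg: "f u = g u"
  shows "f = g"
proof (rule endo_eqI[OF f g essential_carrier[OF M_left_module]])
  fix a assume "a \<in> carrier M"
  then have a: "a \<in> carrier A" by simp
  have *: "h (\<iota> a) = lmult A a \<odot>\<^bsub>H\<^esub> h u" if h: "h \<in> lhom R H H" for h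
    using lhom_smult[OF h, of "lmult A a" u] iota_smult[OF mult_B(1)[OF a], of "\<one>\<^bsub>A\<^esub>"] mult_B(1)[OF a] a
    by simp
  show "f (\<iota> a) = g (\<iota> a)" using *[OF f] *[OF g] fg by simp
qed

subsection \<open>Endomorphisms and invariants\<close>

abbreviation "Inv \<equiv> invariants A B H"

text \<open>In \<open>A\<close> every operator \<open>b\<close> agrees at \<open>1\<close> with the left multiplication by \<open>b(1)\<close>, and
  \<open>f\<close> is linear over both.\<close>
lemma endo_value_invariant:
  assumes "f \<in> lhom R H H"
  shows "f u \<in> Inv"
proof -
  have "b \<odot>\<^bsub>H\<^esub> f u = lmult A (b \<one>\<^bsub>A\<^esub>) \<odot>\<^bsub>H\<^esub> f u" if b: "b \<in> B" for b
  proof -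
    have "b \<odot>\<^bsub>H\<^esub> u = lmult A (b \<one>\<^bsub>A\<^esub>) \<odot>\<^bsub>H\<^esub> u"
      using iota_smult[OF b, of "\<one>\<^bsub>A\<^esub>"] iota_smult[OF mult_B(1), of "b \<one>\<^bsub>A\<^esub>" "\<one>\<^bsub>A\<^esub>"] b by simp
    then show ?thesis
      using lhom_smult[OF assms, of b u] lhom_smult[OF assms, of "lmult A (b \<one>\<^bsub>A\<^esub>)" u] b mult_B(1)
      by simp
  qed
  then show ?thesis
    using lhom_closed[OF assms, of u] by (auto simp: invariants_def)
qed

text \<open>The map \<open>a \<mapsto> a s\<close> is linear, since applying \<open>b\<close> after the multiplication by \<open>a\<close> is an
  operator with value \<open>b(a)\<close> at \<open>1\<close>; it extends to the hull by injectivity.\<close>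
lemma invariant_endo:
  assumes s: "s \<in> Inv"
  shows "\<exists>f\<in>lhom R H H. f u = s"
proof -
  have sH: "s \<in> carrier H" and sb: "\<And>b. b \<in> B \<Longrightarrow> b \<odot>\<^bsub>H\<^esub> s = lmult A (b \<one>\<^bsub>A\<^esub>) \<odot>\<^bsub>H\<^esub> s"
    using s by (auto simp: invariants_def)
  have "(\<lambda>a\<in>carrier M. lmult A a \<odot>\<^bsub>H\<^esub> s) \<in> lhom R M H"
  proof (rule restrict_lhom[OF M_left_module])
    fix a assume "a \<in> carrier M" then show "lmult A a \<odot>\<^bsub>H\<^esub> s \<in> carrier H" using sH mult_B by simp
  next
    fix a a' assume a: "a \<in> carrier M" "a' \<in> carrier M"
    have "lmult A (a \<oplus>\<^bsub>A\<^esub> a') = lmult A a \<oplus>\<^bsub>R\<^esub> lmult A a'"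
      using a by (auto simp: lmult_def A.l_distr)
    then show "lmult A (a \<oplus>\<^bsub>M\<^esub> a') \<odot>\<^bsub>H\<^esub> s = lmult A a \<odot>\<^bsub>H\<^esub> s \<oplus>\<^bsub>H\<^esub> lmult A a' \<odot>\<^bsub>H\<^esub> s"
      using H.smult_l_distr[of "lmult A a" "lmult A a'" s] a sH mult_B(1) by simp
  next
    fix b a assume b: "b \<in> carrier R" and a: "a \<in> carrier M"
    have ba: "b \<otimes>\<^bsub>R\<^esub> lmult A a \<in> B" using R.m_closed[of b "lmult A a"] a b mult_B(1) by simp
    have "b \<odot>\<^bsub>H\<^esub> (lmult A a \<odot>\<^bsub>H\<^esub> s) = (b \<otimes>\<^bsub>R\<^esub> lmult A a) \<odot>\<^bsub>H\<^esub> s"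
      using H.smult_assoc1[of b "lmult A a" s] a b sH mult_B(1) by simp
    also have "\<dots> = lmult A (b a) \<odot>\<^bsub>H\<^esub> s"
      using sb[OF ba] a b by (simp add: compose_def)
    finally show "lmult A (b \<odot>\<^bsub>M\<^esub> a) \<odot>\<^bsub>H\<^esub> s = b \<odot>\<^bsub>H\<^esub> (lmult A a \<odot>\<^bsub>H\<^esub> s)" by simp
  qed
  then obtain g where g: "g \<in> lhom R H H" "\<forall>a\<in>carrier M. g (\<iota> a) = (\<lambda>a\<in>carrier M. lmult A a \<odot>\<^bsub>H\<^esub> s) a"
    using extend_from_image[OF M_left_module hull] by blast
  have "lmult A \<one>\<^bsub>A\<^esub> = \<one>\<^bsub>R\<^esub>" by (auto simp: lmult_def)
  then have "g u = s" using g(2) H.smult_one[OF sH] by simp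
  then show ?thesis using g(1) by blast
qed

lemma endo_inj: "inj_on (\<lambda>f. f u) (lhom R H H)"
  using endo_eqI_one by (auto simp: inj_on_def)

lemma endo_at:
  assumes "s \<in> Inv"
  shows "endo s \<in> lhom R H H" "endo s u = s"
proof -
  have "s \<in> (\<lambda>f. f u) ` lhom R H H" using invariant_endo[OF assms] by auto
  then show "endo s \<in> lhom R H H" "endo s u = s"
    unfolding endo_at_def by (rule inv_into_into, rule f_inv_into_f[of s "\<lambda>f. f u"])
qed

lemma endo_at_value: "f \<in> lhom R H H \<Longrightarrow> endo (f u) = f"
  unfolding endo_at_def by (rule inv_into_f_f[OF endo_inj])

lemma endo_extension_unique:
  assumes "f \<in> lhom R M H"
  obtains g where "g \<in> lhom R H H" "\<And>a. a \<in> carrier A \<Longrightarrow> g (\<iota> a) = f a"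
  using extend_from_image[OF M_left_module hull assms] by auto

lemma hull_induct_endo:
  assumes K: "submodule K R H" and gen: "\<And>f a. f \<in> lhom R H H \<Longrightarrow> a \<in> carrier A \<Longrightarrow> f (\<iota> a) \<in> K"
    and x: "x \<in> carrier H"
  shows "x \<in> K"
proof (rule hull_induct[OF K _ x])
  fix f a assume f: "f \<in> lhom R M H" and a: "a \<in> carrier A"
  obtain g where "g \<in> lhom R H H" "\<And>a. a \<in> carrier A \<Longrightarrow> g (\<iota> a) = f a"
    by (rule endo_extension_unique[OF f]) blast
  then show "f a \<in> K" using gen[of g a] a by simp
qed

text \<open>Let \<open>I\<close> be the essential ideal on which \<open>f\<close> and \<open>g\<close> both take values in \<open>A\<close>. For
  \<open>x\<close> and \<open>y\<close> in \<open>I\<close>, both \<open>f(g(xy))\<close> and \<open>g(f(xy))\<close> equal \<open>g(x) f(y)\<close>, so the ideal \<open>D\<close>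
  where the composites agree contains all products of elements of \<open>I\<close>. A stable ideal that
  misses \<open>D\<close> meets \<open>I\<close> in an ideal with square zero; hence \<open>D\<close> is essential.\<close>
lemma endo_commute:
  assumes f: "f \<in> lhom R H H" and g: "g \<in> lhom R H H" and z: "z \<in> carrier H"
  shows "f (g z) = g (f z)"
proof -
  let ?I = "\<iota> ` carrier A"
  have fi: "compose (carrier M) f \<iota> \<in> lhom R M H" and gi: "compose (carrier M) g \<iota> \<in> lhom R M H"
    by (rule lhom_compose[OF M_left_module iota(1) f], rule lhom_compose[OF M_left_module iota(1) g])
  have fg: "compose (carrier H) f g \<in> lhom R H H" and gf: "compose (carrier H) g f \<in> lhom R H H"
    by (rule lhom_compose[OF H.left_module_axioms g f], rule lhom_compose[OF H.left_module_axioms f g])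
  have fgi: "compose (carrier M) (compose (carrier H) f g) \<iota> \<in> lhom R M H"
    and gfi: "compose (carrier M) (compose (carrier H) g f) \<iota> \<in> lhom R M H"
    by (rule lhom_compose[OF M_left_module iota(1) fg], rule lhom_compose[OF M_left_module iota(1) gf])
  define I where "I = {x \<in> carrier A. f (\<iota> x) \<in> ?I} \<inter> {x \<in> carrier A. g (\<iota> x) \<in> ?I}"
  have I: "essential R M I"
    unfolding I_def
    using essential_Int[OF M_left_module preimage_essential[OF fi] preimage_essential[OF gi]]
    by (simp add: compose_def cong: conj_cong)
  define D where "D = {x \<in> carrier A. f (g (\<iota> x)) = g (f (\<iota> x))}"
  have Ds: "submodule D R M"
    using lhom_equalizer[OF M_left_module H.left_module_axioms fgi gfi]
    by (simp add: compose_def D_def cong: conj_cong)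
  have left: "h (\<iota> (a \<otimes>\<^bsub>A\<^esub> x)) = lmult A a \<odot>\<^bsub>H\<^esub> h (\<iota> x)"
    and right: "h (\<iota> (x \<otimes>\<^bsub>A\<^esub> a)) = rmult A a \<odot>\<^bsub>H\<^esub> h (\<iota> x)"
    if h: "h \<in> lhom R H H" and "a \<in> carrier A" "x \<in> carrier A" for h a x
    using lhom_smult[OF h, of _ "\<iota> x"] iota_smult[OF mult_B(1), of a x] iota_smult[OF mult_B(2), of a x]
      mult_B[of a] that by simp_all
  have prod: "x \<otimes>\<^bsub>A\<^esub> y \<in> D" if x: "x \<in> I" and y: "y \<in> I" for x y
  proof -
    have xy: "x \<in> carrier A" "y \<in> carrier A" using x y by (auto simp: I_def)
    obtain p q where p: "p \<in> carrier A" "g (\<iota> x) = \<iota> p" and q: "q \<in> carrier A" "f (\<iota> y) = \<iota> q"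
      using x y unfolding I_def by blast
    have "f (g (\<iota> (x \<otimes>\<^bsub>A\<^esub> y))) = f (\<iota> (p \<otimes>\<^bsub>A\<^esub> y))"
      using right[OF g xy(2,1)] p iota_smult[OF mult_B(2)[OF xy(2)] p(1)] by simp
    also have "\<dots> = \<iota> (p \<otimes>\<^bsub>A\<^esub> q)"
      using left[OF f p(1) xy(2)] q iota_smult[OF mult_B(1)[OF p(1)] q(1)] by simp
    also have "\<dots> = g (\<iota> (x \<otimes>\<^bsub>A\<^esub> q))"
      using right[OF g q(1) xy(1)] p iota_smult[OF mult_B(2)[OF q(1)] p(1)] by simp
    also have "\<dots> = g (f (\<iota> (x \<otimes>\<^bsub>A\<^esub> y)))"
      using left[OF f xy] q iota_smult[OF mult_B(1)[OF xy(1)] q(1)] by simp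
    finally show ?thesis using xy by (simp add: D_def)
  qed
  have "essential R M D"
    unfolding essential_def
  proof (intro conjI allI impI Ds)
    fix L assume L: "submodule L R M" "D \<inter> L = {\<zero>\<^bsub>M\<^esub>}"
    have IL: "submodule (I \<inter> L) R M" by (rule M.submodule_Int[OF essentialD(1)[OF I] L(1)])
    have "x \<otimes>\<^bsub>A\<^esub> y = \<zero>\<^bsub>A\<^esub>" if "x \<in> I \<inter> L" "y \<in> I \<inter> L" for x y
    proof -
      have "x \<otimes>\<^bsub>A\<^esub> y \<in> D \<inter> L"
        using prod[of x y] that stableD(5)[OF L(1), of x y] stableD(1)[OF L(1)] by auto
      then show ?thesis unfolding L(2) by simp
    qed
    then have "I \<inter> L = {\<zero>\<^bsub>M\<^esub>}" using square_zero[OF IL] by simp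
    then show "L = {\<zero>\<^bsub>M\<^esub>}" by (rule essentialD(2)[OF I L(1)])
  qed
  then have "compose (carrier H) f g = compose (carrier H) g f"
    by (rule endo_eqI[OF fg gf]) (auto simp: compose_def D_def)
  from fun_cong[OF this, of z] z show ?thesis by (simp add: compose_def)
qed

end

section \<open>The ring structure on the self-injective hull\<close>

lemma with_smult_simps:
  "carrier (with_smult X a) = carrier X" "x \<otimes>\<^bsub>with_smult X a\<^esub> y = x \<otimes>\<^bsub>X\<^esub> y"
  "\<one>\<^bsub>with_smult X a\<^esub> = \<one>\<^bsub>X\<^esub>" "\<zero>\<^bsub>with_smult X a\<^esub> = \<zero>\<^bsub>X\<^esub>" "x \<oplus>\<^bsub>with_smult X a\<^esub> y = x \<oplus>\<^bsub>X\<^esub> y"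
  "c \<odot>\<^bsub>with_smult X a\<^esub> x = a c x"
  by (simp_all add: with_smult_def)

lemma ring_with_smult:
  assumes "ring X"
  shows "ring (with_smult X a)"
proof -
  interpret ring X by fact
  have "abelian_group (with_smult X a)"
    by (rule abelian_group_cong[OF is_abelian_group]) (simp_all add: with_smult_def)
  moreover have "Group.monoid (with_smult X a)"
    by (rule monoidI) (simp_all add: with_smult_simps m_assoc)
  ultimately show ?thesis
    by (intro ringI) (simp_all add: with_smult_simps l_distr r_distr)
qed

text \<open>If the kernel of \<open>\<phi>\<close> absorbs products, the product of two values does not depend on the
  chosen preimages, and \<open>\<phi>\<close> becomes a surjective ring homomorphism.\<close>
lemma transported_algebra_hom:
  assumes T: "ring T" and H: "abelian_group H" and surj: "\<phi> ` carrier T = carrier H"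
    and add: "\<And>X Y. X \<in> carrier T \<Longrightarrow> Y \<in> carrier T \<Longrightarrow> \<phi> (X \<oplus>\<^bsub>T\<^esub> Y) = \<phi> X \<oplus>\<^bsub>H\<^esub> \<phi> Y"
    and ker: "\<And>X Y. X \<in> carrier T \<Longrightarrow> Y \<in> carrier T \<Longrightarrow> \<phi> X = \<zero>\<^bsub>H\<^esub> \<Longrightarrow> \<phi> (X \<otimes>\<^bsub>T\<^esub> Y) = \<zero>\<^bsub>H\<^esub>"
      "\<And>X Y. X \<in> carrier T \<Longrightarrow> Y \<in> carrier T \<Longrightarrow> \<phi> Y = \<zero>\<^bsub>H\<^esub> \<Longrightarrow> \<phi> (X \<otimes>\<^bsub>T\<^esub> Y) = \<zero>\<^bsub>H\<^esub>"
    and u: "u = \<phi> \<one>\<^bsub>T\<^esub>"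
  shows "\<phi> \<in> ring_hom T (transported_algebra R T \<phi> H u)" "ring (transported_algebra R T \<phi> H u)"
proof -
  interpret T: ring T by fact
  interpret H: abelian_group H by fact
  let ?X = "transported_algebra R T \<phi> H u"
  have clo: "\<phi> X \<in> carrier H" if "X \<in> carrier T" for X using surj that by auto
  have z: "\<phi> \<zero>\<^bsub>T\<^esub> = \<zero>\<^bsub>H\<^esub>"
    using add[of "\<zero>\<^bsub>T\<^esub>" "\<zero>\<^bsub>T\<^esub>"] clo[of "\<zero>\<^bsub>T\<^esub>"] by simp
  have diff: "\<phi> (X \<ominus>\<^bsub>T\<^esub> Y) = \<phi> X \<ominus>\<^bsub>H\<^esub> \<phi> Y" if "X \<in> carrier T" "Y \<in> carrier T" for X Y
  proof -
    have "\<phi> (\<ominus>\<^bsub>T\<^esub> Y) = \<ominus>\<^bsub>H\<^esub> \<phi> Y"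
      using add[of "\<ominus>\<^bsub>T\<^esub> Y" Y] that clo z by (intro H.minus_equality[symmetric]) (simp_all add: T.l_neg)
    then show ?thesis using that by (simp add: a_minus_def add)
  qed
  have diff0: "\<phi> (X \<ominus>\<^bsub>T\<^esub> Y) = \<zero>\<^bsub>H\<^esub>" if "X \<in> carrier T" "Y \<in> carrier T" "\<phi> X = \<phi> Y" for X Y
    using that clo[of Y] diff[OF that(1,2)] by (simp add: a_minus_def H.r_neg)
  have diffD: "\<phi> X = \<phi> Y" if "X \<in> carrier T" "Y \<in> carrier T" "\<phi> (X \<ominus>\<^bsub>T\<^esub> Y) = \<zero>\<^bsub>H\<^esub>" for X Y
    using that clo[of X] clo[of Y] diff[OF that(1,2)] H.minus_equality[of "\<phi> X" "\<ominus>\<^bsub>H\<^esub> \<phi> Y"]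
    by (simp add: a_minus_def)
  have inv: "inv_into (carrier T) \<phi> (\<phi> X) \<in> carrier T" "\<phi> (inv_into (carrier T) \<phi> (\<phi> X)) = \<phi> X"
    if "X \<in> carrier T" for X
    using that by (auto intro!: inv_into_into f_inv_into_f)
  have mult: "\<phi> (X' \<otimes>\<^bsub>T\<^esub> Y') = \<phi> (X \<otimes>\<^bsub>T\<^esub> Y)"
    if c: "X \<in> carrier T" "X' \<in> carrier T" "Y \<in> carrier T" "Y' \<in> carrier T"
      and e: "\<phi> X' = \<phi> X" "\<phi> Y' = \<phi> Y" for X X' Y Y'
  proof -
    have "X' \<otimes>\<^bsub>T\<^esub> Y' \<ominus>\<^bsub>T\<^esub> X \<otimes>\<^bsub>T\<^esub> Y' = (X' \<ominus>\<^bsub>T\<^esub> X) \<otimes>\<^bsub>T\<^esub> Y'"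
      using c by (simp add: a_minus_def T.l_distr T.l_minus)
    then have "\<phi> (X' \<otimes>\<^bsub>T\<^esub> Y') = \<phi> (X \<otimes>\<^bsub>T\<^esub> Y')"
      using c ker(1)[OF _ c(4) diff0[OF c(2,1) e(1)]] by (intro diffD) simp_all
    also have "X \<otimes>\<^bsub>T\<^esub> Y' \<ominus>\<^bsub>T\<^esub> X \<otimes>\<^bsub>T\<^esub> Y = X \<otimes>\<^bsub>T\<^esub> (Y' \<ominus>\<^bsub>T\<^esub> Y)"
      using c by (simp add: a_minus_def T.r_distr T.r_minus)
    then have "\<phi> (X \<otimes>\<^bsub>T\<^esub> Y') = \<phi> (X \<otimes>\<^bsub>T\<^esub> Y)"
      using c ker(2)[OF c(1) _ diff0[OF c(4,3) e(2)]] by (intro diffD) simp_all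
    finally show ?thesis .
  qed
  show hom: "\<phi> \<in> ring_hom T ?X"
  proof (rule ring_hom_memI)
    fix X Y assume XY: "X \<in> carrier T" "Y \<in> carrier T"
    show "\<phi> (X \<otimes>\<^bsub>T\<^esub> Y) = \<phi> X \<otimes>\<^bsub>?X\<^esub> \<phi> Y"
      using mult[OF XY(1) inv(1)[OF XY(1)] XY(2) inv(1)[OF XY(2)] inv(2)[OF XY(1)] inv(2)[OF XY(2)]]
      by (simp add: transported_algebra_def)
  qed (simp_all add: transported_algebra_def clo add u)
  have "?X\<lparr>carrier := \<phi> ` carrier T, zero := \<phi> \<zero>\<^bsub>T\<^esub>\<rparr> = ?X"
    by (simp add: surj z transported_algebra_def)
  then show "ring ?X" using T.ring_hom_imp_img_ring[OF hom] by simp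
qed

context semiprime_extension
begin

subsection \<open>The ring of endomorphisms and the ring of invariants\<close>

lemma S_simps [simp]:
  "carrier S = lhom R H H" "x \<in> carrier H \<Longrightarrow> (f \<oplus>\<^bsub>S\<^esub> g) x = f x \<oplus>\<^bsub>H\<^esub> g x"
  "x \<in> carrier H \<Longrightarrow> (f \<otimes>\<^bsub>S\<^esub> g) x = g (f x)" "\<one>\<^bsub>S\<^esub> = (\<lambda>x\<in>carrier H. x)" "\<zero>\<^bsub>S\<^esub> = (\<lambda>x\<in>carrier H. \<zero>\<^bsub>H\<^esub>)"
  by (simp_all add: right_endo_ring_def compose_def)

lemma S_ring: "ring S"
  by (rule right_endo_ring_ring[OF H.left_module_axioms])

sublocale S: ring S by (rule S_ring)

lemma S_closed:
  "f \<in> lhom R H H \<Longrightarrow> g \<in> lhom R H H \<Longrightarrow> f \<otimes>\<^bsub>S\<^esub> g \<in> lhom R H H"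
  "f \<in> lhom R H H \<Longrightarrow> g \<in> lhom R H H \<Longrightarrow> f \<oplus>\<^bsub>S\<^esub> g \<in> lhom R H H"
  using S.m_closed[of f g] S.a_closed[of f g] by simp_all

lemma S_comm: "f \<in> lhom R H H \<Longrightarrow> g \<in> lhom R H H \<Longrightarrow> f \<otimes>\<^bsub>S\<^esub> g = g \<otimes>\<^bsub>S\<^esub> f"
  by (rule lhom_eqI[of _ R H H]) (simp_all add: S_closed endo_commute)

lemma S_cring: "cring S"
  using S.ring_axioms S_comm
  by (simp add: cring_def comm_monoid_def comm_monoid_axioms_def S.monoid_axioms)

lemma endo_iota:
  assumes "f \<in> lhom R H H" "a \<in> carrier A"
  shows "f (\<iota> a) = lmult A a \<odot>\<^bsub>H\<^esub> f u"
  using lhom_smult[OF assms(1), of "lmult A a" u] iota_smult[OF mult_B(1)[OF assms(2)], of "\<one>\<^bsub>A\<^esub>"]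
    mult_B(1)[OF assms(2)] assms(2) by simp

lemma endo_iota_smult:
  assumes "f \<in> lhom R H H" "a \<in> carrier A" "b \<in> B"
  shows "f (\<iota> (b a)) = b \<odot>\<^bsub>H\<^esub> f (\<iota> a)"
  using lhom_smult[OF assms(1), of b "\<iota> a"] iota_smult assms by simp

lemma endo_iota_mult:
  assumes "f \<in> lhom R H H" "a \<in> carrier A" "b \<in> carrier A"
  shows "f (\<iota> (a \<otimes>\<^bsub>A\<^esub> b)) = lmult A a \<odot>\<^bsub>H\<^esub> f (\<iota> b)"
    "f (\<iota> (a \<otimes>\<^bsub>A\<^esub> b)) = rmult A b \<odot>\<^bsub>H\<^esub> f (\<iota> a)"
  using endo_iota_smult[OF assms(1,3) mult_B(1)[OF assms(2)]]
    endo_iota_smult[OF assms(1,2) mult_B(2)[OF assms(3)]] assms by simp_all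

abbreviation "Chat \<equiv> invariant_ring k A B H u"

lemma Chat_simps [simp]:
  "carrier Chat = Inv" "\<one>\<^bsub>Chat\<^esub> = u" "\<zero>\<^bsub>Chat\<^esub> = \<zero>\<^bsub>H\<^esub>" "s \<oplus>\<^bsub>Chat\<^esub> t = s \<oplus>\<^bsub>H\<^esub> t"
  "s \<otimes>\<^bsub>Chat\<^esub> t = (endo s \<otimes>\<^bsub>S\<^esub> endo t) u"
  by (simp_all add: invariant_ring_def Let_def)

text \<open>Both operations of the ring of invariants are transported from the endomorphisms along
  evaluation at \<open>1\<close>.\<close>
lemma value_hom: "(\<lambda>f. f u) \<in> ring_iso S Chat"
proof (rule ring_iso_memI)
  show "bij_betw (\<lambda>f. f u) (carrier S) (carrier Chat)"
    using endo_inj endo_value_invariant invariant_endo by (auto simp: bij_betw_def)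
qed (simp_all add: endo_value_invariant endo_at_value)

lemma Chat_cring: "cring Chat"
proof -
  have "Chat\<lparr>zero := \<zero>\<^bsub>S\<^esub> u\<rparr> = Chat"
    by (simp add: invariant_ring_def Let_def)
  then show ?thesis
    using cring.ring_iso_imp_img_cring[OF S_cring value_hom] by (simp only:)
qed

sublocale Chat: cring Chat by (rule Chat_cring)

lemma endo_at_hom:
  assumes "s \<in> Inv" "t \<in> Inv"
  shows "endo (s \<oplus>\<^bsub>H\<^esub> t) = endo s \<oplus>\<^bsub>S\<^esub> endo t" "endo (s \<otimes>\<^bsub>Chat\<^esub> t) = endo s \<otimes>\<^bsub>S\<^esub> endo t"
proof -
  note st = endo_at[OF assms(1)] endo_at[OF assms(2)]
  show "endo (s \<oplus>\<^bsub>H\<^esub> t) = endo s \<oplus>\<^bsub>S\<^esub> endo t"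
    using endo_at_value[OF S_closed(2)[OF st(1,3)]] st by simp
  show "endo (s \<otimes>\<^bsub>Chat\<^esub> t) = endo s \<otimes>\<^bsub>S\<^esub> endo t"
    using endo_at_value[OF S_closed(1)[OF st(1,3)]] by simp
qed

lemma endo_at_apply:
  assumes "s \<in> Inv" "t \<in> Inv" "x \<in> carrier H"
  shows "endo (s \<oplus>\<^bsub>H\<^esub> t) x = endo s x \<oplus>\<^bsub>H\<^esub> endo t x" "endo (s \<otimes>\<^bsub>Chat\<^esub> t) x = endo t (endo s x)"
  unfolding endo_at_hom[OF assms(1,2)] using assms(3) by simp_all

lemma endo_at_one: "endo u = (\<lambda>x\<in>carrier H. x)"
  using endo_at_value[OF lhom_id[OF H.left_module_axioms]] by simp

lemma endo_at_image: "endo ` Inv = lhom R H H"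
proof
  show "lhom R H H \<subseteq> endo ` Inv"
  proof
    fix f assume f: "f \<in> lhom R H H"
    then show "f \<in> endo ` Inv"
      using endo_at_value[OF f] endo_value_invariant[OF f] by (metis image_eqI)
  qed
qed (auto simp: endo_at)

subsection \<open>The tensor product\<close>

abbreviation "C \<equiv> A\<lparr>carrier := invariants A B M\<rparr>"
abbreviation "A\<^sub>C \<equiv> with_smult A (monoid.mult A)"
abbreviation "S\<^sub>C \<equiv> with_smult S (\<lambda>c f. endo (\<iota> c) \<otimes>\<^bsub>S\<^esub> f)"
abbreviation "T \<equiv> with_smult (tensor_algebra C A\<^sub>C S\<^sub>C) (tensor_left_action C A\<^sub>C S\<^sub>C (\<lambda>b x. b x))"
abbreviation "\<phi> \<equiv> tensor_lift C A\<^sub>C S\<^sub>C H (\<lambda>a f. f (\<iota> a))"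

text \<open>Invariants of \<open>A\<close> are central because right multiplications belong to \<open>B\<close>. Applying the
  invariance to \<open>b\<close> composed with a left multiplication shows that operators of \<open>B\<close> are linear
  over the invariants.\<close>
lemma base_invariant:
  assumes "c \<in> invariants A B M"
  shows "c \<in> carrier A" "b \<in> B \<Longrightarrow> b c = b \<one>\<^bsub>A\<^esub> \<otimes>\<^bsub>A\<^esub> c" "\<iota> c \<in> Inv"
    and "a \<in> carrier A \<Longrightarrow> a \<otimes>\<^bsub>A\<^esub> c = c \<otimes>\<^bsub>A\<^esub> a"
    and "b \<in> B \<Longrightarrow> a \<in> carrier A \<Longrightarrow> b (c \<otimes>\<^bsub>A\<^esub> a) = c \<otimes>\<^bsub>A\<^esub> b a"
proof -
  show c: "c \<in> carrier A" using assms by (simp add: invariants_def)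
  show inv: "b c = b \<one>\<^bsub>A\<^esub> \<otimes>\<^bsub>A\<^esub> c" if "b \<in> B" for b
    using assms c that by (simp add: invariants_def)
  have "b \<odot>\<^bsub>H\<^esub> \<iota> c = lmult A (b \<one>\<^bsub>A\<^esub>) \<odot>\<^bsub>H\<^esub> \<iota> c" if b: "b \<in> B" for b
    using iota_smult[OF b c] iota_smult[OF mult_B(1) c, of "b \<one>\<^bsub>A\<^esub>"] inv[OF b] b c by simp
  then show "\<iota> c \<in> Inv" using c by (simp add: invariants_def)
  show comm: "a \<otimes>\<^bsub>A\<^esub> c = c \<otimes>\<^bsub>A\<^esub> a" if "a \<in> carrier A" for a
    using inv[OF mult_B(2)[OF that]] c that by simp
  show "b (c \<otimes>\<^bsub>A\<^esub> a) = c \<otimes>\<^bsub>A\<^esub> b a" if b: "b \<in> B" and a: "a \<in> carrier A"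
  proof -
    have ba: "b \<otimes>\<^bsub>R\<^esub> lmult A a \<in> B" using R.m_closed[of b "lmult A a"] a b mult_B(1) by simp
    have "b (c \<otimes>\<^bsub>A\<^esub> a) = (b \<otimes>\<^bsub>R\<^esub> lmult A a) c" using comm[OF a] a c by (simp add: compose_def)
    also have "\<dots> = b a \<otimes>\<^bsub>A\<^esub> c" using inv[OF ba] a by (simp add: compose_def)
    finally show ?thesis using comm a b by simp
  qed
qed

text \<open>The two actions of an invariant on \<open>A\<close>, by multiplication and through the endomorphism of
  the hull, agree; this is the balancing condition for \<open>\<phi>\<close>.\<close>
lemma scalar_endo:
  assumes "c \<in> invariants A B M" "a \<in> carrier A"
  shows "endo (\<iota> c) (\<iota> a) = \<iota> (c \<otimes>\<^bsub>A\<^esub> a)"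
  using endo_iota[OF endo_at(1)[OF base_invariant(3)[OF assms(1)]] assms(2)]
    endo_at(2)[OF base_invariant(3)[OF assms(1)]] iota_smult[OF mult_B(1)[OF assms(2)], of c]
    base_invariant(1,4)[OF assms(1)] assms(2) by simp

sublocale tens: tensor_rings C A\<^sub>C S\<^sub>C
proof (rule tensor_rings.intro)
  show "ring A\<^sub>C" by (rule ring_with_smult) (rule A.ring_axioms)
  show "ring S\<^sub>C" by (rule ring_with_smult[OF S_ring])
next
  fix c x y assume "c \<in> carrier C" "x \<in> carrier A\<^sub>C" "y \<in> carrier A\<^sub>C"
  then have *: "c \<in> invariants A B M" "x \<in> carrier A" "y \<in> carrier A" by (simp_all add: with_smult_simps)
  note c = base_invariant(1)[OF *(1)]
  show "(c \<odot>\<^bsub>A\<^sub>C\<^esub> x) \<otimes>\<^bsub>A\<^sub>C\<^esub> y = c \<odot>\<^bsub>A\<^sub>C\<^esub> (x \<otimes>\<^bsub>A\<^sub>C\<^esub> y)"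
    using * c by (simp add: with_smult_simps A.m_assoc)
  show "x \<otimes>\<^bsub>A\<^sub>C\<^esub> (c \<odot>\<^bsub>A\<^sub>C\<^esub> y) = c \<odot>\<^bsub>A\<^sub>C\<^esub> (x \<otimes>\<^bsub>A\<^sub>C\<^esub> y)"
    using * c base_invariant(4)[OF *(1,2)] by (simp add: with_smult_simps A.m_assoc[symmetric])
next
  fix c x assume "c \<in> carrier C" "x \<in> carrier A\<^sub>C"
  then show "c \<odot>\<^bsub>A\<^sub>C\<^esub> x \<in> carrier A\<^sub>C" using base_invariant(1) by (simp add: with_smult_simps)
next
  fix c f assume "c \<in> carrier C" "f \<in> carrier S\<^sub>C"
  then show "c \<odot>\<^bsub>S\<^sub>C\<^esub> f \<in> carrier S\<^sub>C"
    using base_invariant(3) endo_at(1) by (simp add: with_smult_simps S_closed)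
next
  fix c f g assume "c \<in> carrier C" "f \<in> carrier S\<^sub>C" "g \<in> carrier S\<^sub>C"
  then have *: "endo (\<iota> c) \<in> carrier S" "f \<in> carrier S" "g \<in> carrier S"
    using base_invariant(3) endo_at(1) by (simp_all add: with_smult_simps)
  show "(c \<odot>\<^bsub>S\<^sub>C\<^esub> f) \<otimes>\<^bsub>S\<^sub>C\<^esub> g = c \<odot>\<^bsub>S\<^sub>C\<^esub> (f \<otimes>\<^bsub>S\<^sub>C\<^esub> g)"
    using S.m_assoc[OF *] by (simp add: with_smult_simps)
  show "f \<otimes>\<^bsub>S\<^sub>C\<^esub> (c \<odot>\<^bsub>S\<^sub>C\<^esub> g) = c \<odot>\<^bsub>S\<^sub>C\<^esub> (f \<otimes>\<^bsub>S\<^sub>C\<^esub> g)"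
    using S.m_assoc[OF *] S.m_assoc[OF *(2,1,3)] S_comm[of f "endo (\<iota> c)"] *
    by (simp add: with_smult_simps)
qed

lemma act: "left_module R (with_smult A\<^sub>C (\<lambda>b x. b x))"
  using M_left_module by (simp add: operator_module_def with_smult_def)

lemma act_scalar:
  "b \<in> carrier R \<Longrightarrow> c \<in> carrier C \<Longrightarrow> x \<in> carrier A\<^sub>C \<Longrightarrow> b (c \<odot>\<^bsub>A\<^sub>C\<^esub> x) = c \<odot>\<^bsub>A\<^sub>C\<^esub> b x"
  using base_invariant(5) by (simp add: with_smult_simps)

lemma T_left_module: "left_module R T"
  by (rule tens.tensor_left_module[OF act act_scalar])

lemma \<phi>_lhom: "\<phi> \<in> lhom R T H"
  by (rule tens.tensor_lift_lhom[where act = "\<lambda>b x. b x" and h = "\<lambda>a f. f (\<iota> a)", OF act])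
    (use H.left_module_axioms in \<open>simp_all add: with_smult_simps lhom_closed iota_add lhom_add scalar_endo
      endo_iota_smult base_invariant(5)\<close>)

lemma \<phi>_pure:
  assumes "a \<in> carrier A" "f \<in> lhom R H H"
  shows "\<phi> (pure_tensor C A\<^sub>C S\<^sub>C a f) = f (\<iota> a)"
  by (rule tens.tensor_lift_pure[where h = "\<lambda>a f. f (\<iota> a)"])
    (use H.M.abelian_group_axioms assms in
      \<open>simp_all add: with_smult_simps lhom_closed iota_add lhom_add scalar_endo\<close>)

lemma T_ring: "ring T"
  by (rule ring_with_smult[OF tens.Q_ring])

sublocale T: ring T by (rule T_ring)

lemma T_carrier: "carrier T = carrier tens.Q"
  by (simp add: with_smult_simps)

lemma T_pure:
  assumes "a \<in> carrier A" "b \<in> carrier A" "f \<in> lhom R H H" "g \<in> lhom R H H"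
  shows "tens.pure a f \<in> carrier T"
    "tens.pure a f \<otimes>\<^bsub>T\<^esub> tens.pure b g = tens.pure (a \<otimes>\<^bsub>A\<^esub> b) (f \<otimes>\<^bsub>S\<^esub> g)"
  using assms tens.pure_closed[of a f] tens.pure_mult[of a f b g] by (simp_all add: with_smult_simps)

lemma T_induct [consumes 1, case_names zero pure diff]:
  assumes X: "X \<in> carrier T" and "Z \<zero>\<^bsub>T\<^esub>"
    and "\<And>a f. a \<in> carrier A \<Longrightarrow> f \<in> lhom R H H \<Longrightarrow> Z (tens.pure a f)"
    and "\<And>X Y. X \<in> carrier T \<Longrightarrow> Y \<in> carrier T \<Longrightarrow> Z X \<Longrightarrow> Z Y \<Longrightarrow> Z (X \<ominus>\<^bsub>T\<^esub> Y)"
  shows "Z X"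
proof -
  have m: "X \<ominus>\<^bsub>tens.Q\<^esub> Y = X \<ominus>\<^bsub>T\<^esub> Y" if "X \<in> carrier T" "Y \<in> carrier T" for X Y
  proof -
    interpret Q: ring tens.Q by (rule tens.Q_ring)
    have "\<ominus>\<^bsub>T\<^esub> Y = \<ominus>\<^bsub>tens.Q\<^esub> Y"
      using that(2) Q.l_neg[of Y] Q.a_inv_closed[of Y]
      by (intro T.minus_equality) (simp_all only: with_smult_simps)
    then show ?thesis by (simp add: a_minus_def with_smult_simps)
  qed
  have "X \<in> carrier tens.Q" using X by (simp add: T_carrier)
  then show ?thesis
  proof (induction rule: tens.tensor_induct)
    case zero then show ?case using assms(2) by (simp add: with_smult_simps)
  next
    case (pure x y) then show ?case using assms(3) by (simp add: with_smult_simps)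
  next
    case (diff X Y) then show ?case using assms(4)[of X Y] m[of X Y] by (simp add: T_carrier)
  qed
qed

lemma \<phi>_closed: "X \<in> carrier T \<Longrightarrow> \<phi> X \<in> carrier H"
  using \<phi>_lhom by (rule lhom_closed)

lemma \<phi>_zero: "\<phi> \<zero>\<^bsub>T\<^esub> = \<zero>\<^bsub>H\<^esub>"
  by (rule lhom_zero[OF T_left_module H.left_module_axioms \<phi>_lhom])

lemma \<phi>_diff: "X \<in> carrier T \<Longrightarrow> Y \<in> carrier T \<Longrightarrow> \<phi> (X \<ominus>\<^bsub>T\<^esub> Y) = \<phi> X \<ominus>\<^bsub>H\<^esub> \<phi> Y"
  using lhom_add[OF \<phi>_lhom, of X "\<ominus>\<^bsub>T\<^esub> Y"] lhom_minus[OF T_left_module H.left_module_axioms \<phi>_lhom, of Y]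
  by (simp add: a_minus_def)

text \<open>The image is a submodule that contains all \<open>f(a)\<close>, and these generate the hull.\<close>
lemma \<phi>_surj: "\<phi> ` carrier T = carrier H"
proof
  show "\<phi> ` carrier T \<subseteq> carrier H" using \<phi>_closed by blast
  have im: "submodule (\<phi> ` carrier T) R H"
    by (rule lhom_image[OF T_left_module H.left_module_axioms \<phi>_lhom left_module.carrier_submodule[OF T_left_module]])
  show "carrier H \<subseteq> \<phi> ` carrier T"
  proof
    fix x assume x: "x \<in> carrier H"
    show "x \<in> \<phi> ` carrier T"
    proof (rule hull_induct_endo[OF im _ x])
      fix f a assume fa: "f \<in> lhom R H H" "a \<in> carrier A"
      then show "f (\<iota> a) \<in> \<phi> ` carrier T"
        by (intro image_eqI[of _ _ "tens.pure a f"] \<phi>_pure[symmetric] T_pure(1))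
    qed
  qed
qed

text \<open>Multiplying by a pure tensor acts on values through an endomorphism followed by an operator
  of \<open>B\<close>, so the kernel of \<open>\<phi>\<close> absorbs products on both sides. For the multiplication from the
  left this uses the commutativity of \<open>S\<close>.\<close>
lemma \<phi>_mult_pure:
  assumes X: "X \<in> carrier T" and a: "a \<in> carrier A" and f: "f \<in> lhom R H H"
  shows "\<phi> (tens.pure a f \<otimes>\<^bsub>T\<^esub> X) = lmult A a \<odot>\<^bsub>H\<^esub> f (\<phi> X)"
    and "\<phi> (X \<otimes>\<^bsub>T\<^esub> tens.pure a f) = rmult A a \<odot>\<^bsub>H\<^esub> f (\<phi> X)"
proof -
  note p = T_pure(1)[OF a a f f]
  have lr: "lmult A a \<in> B" "rmult A a \<in> B" using mult_B a by auto
  have fd: "f (x \<ominus>\<^bsub>H\<^esub> y) = f x \<ominus>\<^bsub>H\<^esub> f y" if "x \<in> carrier H" "y \<in> carrier H" for x y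
    using that lhom_add[OF f, of x "\<ominus>\<^bsub>H\<^esub> y"] lhom_minus[OF H.left_module_axioms H.left_module_axioms f, of y]
    by (simp add: a_minus_def)
  have bd: "b \<odot>\<^bsub>H\<^esub> (x \<ominus>\<^bsub>H\<^esub> y) = b \<odot>\<^bsub>H\<^esub> x \<ominus>\<^bsub>H\<^esub> b \<odot>\<^bsub>H\<^esub> y" if "b \<in> B" "x \<in> carrier H" "y \<in> carrier H" for b x y
    using that by (simp add: a_minus_def H.smult_r_distr H.smult_r_minus)
  have fz: "f \<zero>\<^bsub>H\<^esub> = \<zero>\<^bsub>H\<^esub>" by (rule lhom_zero[OF H.left_module_axioms H.left_module_axioms f])
  from X show "\<phi> (tens.pure a f \<otimes>\<^bsub>T\<^esub> X) = lmult A a \<odot>\<^bsub>H\<^esub> f (\<phi> X)"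
  proof (induction rule: T_induct)
    case zero
    then show ?case using p lr fz by (simp add: \<phi>_zero)
  next
    case (pure b g)
    then show ?case
      using f a by (simp add: T_pure \<phi>_pure S_closed endo_iota_mult(1) endo_commute[OF f] lhom_smult[OF f] mult_B
          lhom_closed)
  next
    case (diff X Y)
    have "tens.pure a f \<otimes>\<^bsub>T\<^esub> (X \<ominus>\<^bsub>T\<^esub> Y) = tens.pure a f \<otimes>\<^bsub>T\<^esub> X \<ominus>\<^bsub>T\<^esub> tens.pure a f \<otimes>\<^bsub>T\<^esub> Y"
      using p diff(1,2) by (simp add: a_minus_def T.r_distr T.r_minus)
    then show ?case
      using p diff lr by (simp add: \<phi>_diff fd bd \<phi>_closed lhom_closed[OF f])
  qed
  from X show "\<phi> (X \<otimes>\<^bsub>T\<^esub> tens.pure a f) = rmult A a \<odot>\<^bsub>H\<^esub> f (\<phi> X)"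
  proof (induction rule: T_induct)
    case zero
    then show ?case using p lr fz by (simp add: \<phi>_zero)
  next
    case (pure b g)
    then show ?case
      using f a by (simp add: T_pure \<phi>_pure S_closed endo_iota_mult(2) lhom_smult mult_B lhom_closed)
  next
    case (diff X Y)
    have "(X \<ominus>\<^bsub>T\<^esub> Y) \<otimes>\<^bsub>T\<^esub> tens.pure a f = X \<otimes>\<^bsub>T\<^esub> tens.pure a f \<ominus>\<^bsub>T\<^esub> Y \<otimes>\<^bsub>T\<^esub> tens.pure a f"
      using p diff(1,2) by (simp add: a_minus_def T.l_distr T.l_minus)
    then show ?case
      using p diff lr by (simp add: \<phi>_diff fd bd \<phi>_closed lhom_closed[OF f])
  qed
qed

lemma \<phi>_kernel_absorbs:
  assumes "X \<in> carrier T" "Y \<in> carrier T" "\<phi> X = \<zero>\<^bsub>H\<^esub>"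
  shows "\<phi> (X \<otimes>\<^bsub>T\<^esub> Y) = \<zero>\<^bsub>H\<^esub>" "\<phi> (Y \<otimes>\<^bsub>T\<^esub> X) = \<zero>\<^bsub>H\<^esub>"
proof -
  have fz: "f \<zero>\<^bsub>H\<^esub> = \<zero>\<^bsub>H\<^esub>" if "f \<in> lhom R H H" for f
    using that by (rule lhom_zero[OF H.left_module_axioms H.left_module_axioms])
  from assms(2) show "\<phi> (X \<otimes>\<^bsub>T\<^esub> Y) = \<zero>\<^bsub>H\<^esub>"
  proof (induction rule: T_induct)
    case (diff Y Z)
    have "X \<otimes>\<^bsub>T\<^esub> (Y \<ominus>\<^bsub>T\<^esub> Z) = X \<otimes>\<^bsub>T\<^esub> Y \<ominus>\<^bsub>T\<^esub> X \<otimes>\<^bsub>T\<^esub> Z"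
      using assms(1) diff(1,2) by (simp add: a_minus_def T.r_distr T.r_minus)
    moreover have "\<zero>\<^bsub>H\<^esub> \<ominus>\<^bsub>H\<^esub> \<zero>\<^bsub>H\<^esub> = \<zero>\<^bsub>H\<^esub>" by (simp add: a_minus_def)
    ultimately show ?case using diff assms(1) by (simp add: \<phi>_diff)
  qed (use assms in \<open>simp_all add: \<phi>_zero \<phi>_mult_pure fz mult_B\<close>)
  from assms(2) show "\<phi> (Y \<otimes>\<^bsub>T\<^esub> X) = \<zero>\<^bsub>H\<^esub>"
  proof (induction rule: T_induct)
    case (diff Y Z)
    have "(Y \<ominus>\<^bsub>T\<^esub> Z) \<otimes>\<^bsub>T\<^esub> X = Y \<otimes>\<^bsub>T\<^esub> X \<ominus>\<^bsub>T\<^esub> Z \<otimes>\<^bsub>T\<^esub> X"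
      using assms(1) diff(1,2) by (simp add: a_minus_def T.l_distr T.l_minus)
    moreover have "\<zero>\<^bsub>H\<^esub> \<ominus>\<^bsub>H\<^esub> \<zero>\<^bsub>H\<^esub> = \<zero>\<^bsub>H\<^esub>" by (simp add: a_minus_def)
    ultimately show ?case using diff assms(1) by (simp add: \<phi>_diff)
  qed (use assms in \<open>simp_all add: \<phi>_zero \<phi>_mult_pure fz mult_B\<close>)
qed

lemma kernel_ideal: "ideal (a_kernel T H \<phi>) T"
proof (rule idealI[OF T_ring])
  have "submodule (a_kernel T H \<phi>) R T"
    using lhom_kernel[OF T_left_module H.left_module_axioms \<phi>_lhom] by (simp add: a_kernel_def')
  then show "subgroup (a_kernel T H \<phi>) (add_monoid T)" by (simp add: submodule_def)
qed (use \<phi>_kernel_absorbs in \<open>auto simp: a_kernel_def'\<close>)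

subsection \<open>The multiplication\<close>

abbreviation "HA \<equiv> transported_algebra R T \<phi> H u"

lemma HA_simps [simp]:
  "carrier HA = carrier H" "x \<oplus>\<^bsub>HA\<^esub> y = x \<oplus>\<^bsub>H\<^esub> y" "\<zero>\<^bsub>HA\<^esub> = \<zero>\<^bsub>H\<^esub>" "\<one>\<^bsub>HA\<^esub> = u"
  "c \<odot>\<^bsub>HA\<^esub> x = (c \<odot>\<^bsub>R\<^esub> \<one>\<^bsub>R\<^esub>) \<odot>\<^bsub>H\<^esub> x"
  by (simp_all add: transported_algebra_def)

lemma T_one: "u = \<phi> \<one>\<^bsub>T\<^esub>"
  using \<phi>_pure[of "\<one>\<^bsub>A\<^esub>" "\<one>\<^bsub>S\<^esub>"] lhom_id[OF H.left_module_axioms] tens.pure_one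
  by (simp add: with_smult_simps)

lemma HA_hom: "\<phi> \<in> ring_hom T HA" and HA_ring: "ring HA"
  using transported_algebra_hom[OF T_ring H.M.abelian_group_axioms \<phi>_surj _ _ _ T_one, of R]
    lhom_add[OF \<phi>_lhom] \<phi>_kernel_absorbs by simp_all

sublocale HA: ring HA by (rule HA_ring)

lemma HA_mult_gen:
  assumes "a \<in> carrier A" "f \<in> lhom R H H" "x \<in> carrier H"
  shows "f (\<iota> a) \<otimes>\<^bsub>HA\<^esub> x = lmult A a \<odot>\<^bsub>H\<^esub> f x" "x \<otimes>\<^bsub>HA\<^esub> f (\<iota> a) = rmult A a \<odot>\<^bsub>H\<^esub> f x"
proof -
  have "x \<in> \<phi> ` carrier T" using assms(3) \<phi>_surj by simp
  then obtain X where X: "X \<in> carrier T" "x = \<phi> X" by blast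
  note p = T_pure(1)[OF assms(1,1,2,2)]
  show "f (\<iota> a) \<otimes>\<^bsub>HA\<^esub> x = lmult A a \<odot>\<^bsub>H\<^esub> f x"
    using ring_hom_mult[OF HA_hom p X(1)] \<phi>_mult_pure(1)[OF X(1) assms(1,2)] \<phi>_pure[OF assms(1,2)] X(2)
    by simp
  show "x \<otimes>\<^bsub>HA\<^esub> f (\<iota> a) = rmult A a \<odot>\<^bsub>H\<^esub> f x"
    using ring_hom_mult[OF HA_hom X(1) p] \<phi>_mult_pure(2)[OF X(1) assms(1,2)] \<phi>_pure[OF assms(1,2)] X(2)
    by simp
qed

lemma HA_mult_gens:
  assumes "a \<in> carrier A" "b \<in> carrier A" "f \<in> lhom R H H" "g \<in> lhom R H H"
  shows "f (\<iota> a) \<otimes>\<^bsub>HA\<^esub> g (\<iota> b) = g (f (\<iota> (a \<otimes>\<^bsub>A\<^esub> b)))"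
  using HA_mult_gen(1)[OF assms(1,3), of "g (\<iota> b)"] assms
  by (simp add: lhom_closed endo_iota_mult(1) lhom_smult mult_B endo_commute[OF assms(3,4)])

text \<open>An operator of \<open>B\<close> need not be linear for the multiplication of the hull, so identities
  between products are proved by additivity from the elements \<open>f(a)\<close> and not by comparing
  submodules.\<close>
lemma HA_induct [consumes 1, case_names zero gen diff]:
  assumes x: "x \<in> carrier H" and "Z \<zero>\<^bsub>H\<^esub>"
    and "\<And>a f. a \<in> carrier A \<Longrightarrow> f \<in> lhom R H H \<Longrightarrow> Z (f (\<iota> a))"
    and "\<And>x y. x \<in> carrier H \<Longrightarrow> y \<in> carrier H \<Longrightarrow> Z x \<Longrightarrow> Z y \<Longrightarrow> Z (x \<ominus>\<^bsub>H\<^esub> y)"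
  shows "Z x"
proof -
  have "x \<in> \<phi> ` carrier T" using x \<phi>_surj by simp
  then obtain X where X: "X \<in> carrier T" "x = \<phi> X" by blast
  from X(1) have "Z (\<phi> X)"
    by (induction rule: T_induct) (simp_all add: \<phi>_zero \<phi>_pure \<phi>_diff \<phi>_closed assms(2-))
  with X(2) show ?thesis by simp
qed

lemma iota_hom: "\<iota> \<in> ring_hom A HA"
proof (rule ring_hom_memI)
  fix a b assume ab: "a \<in> carrier A" "b \<in> carrier A"
  show "\<iota> (a \<otimes>\<^bsub>A\<^esub> b) = \<iota> a \<otimes>\<^bsub>HA\<^esub> \<iota> b"
    using HA_mult_gens[OF ab lhom_id[OF H.left_module_axioms] lhom_id[OF H.left_module_axioms]] ab by simp
qed (simp_all add: iota_add)

lemma HA_mult_invariants: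
  assumes "a \<in> carrier A" "b \<in> carrier A" "s \<in> Inv" "t \<in> Inv"
  shows "endo s (\<iota> a) \<otimes>\<^bsub>HA\<^esub> endo t (\<iota> b) = endo (s \<otimes>\<^bsub>Chat\<^esub> t) (\<iota> (a \<otimes>\<^bsub>A\<^esub> b))"
  using HA_mult_gens[OF assms(1,2) endo_at(1)[OF assms(3)] endo_at(1)[OF assms(4)]]
    endo_at_apply(2)[OF assms(3,4)] assms(1,2) by (simp only: iota_closed A.m_closed)

end

context semiprime_extension
begin

subsection \<open>The extended algebra of operators\<close>

declare HA_simps(5) [simp del]

text \<open>The scalar \<open>c\<close> as an element of \<open>B\<close>.\<close>
definition "scalar c = (\<lambda>x\<in>carrier A. c \<odot>\<^bsub>A\<^esub> x)"

lemma HA_smult: "c \<odot>\<^bsub>HA\<^esub> x = scalar c \<odot>\<^bsub>H\<^esub> x"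
proof -
  have "c \<odot>\<^bsub>R\<^esub> \<one>\<^bsub>R\<^esub> = scalar c" by (auto simp: scalar_def)
  then show ?thesis by (simp only: HA_simps(5))
qed

lemma scalar_B: "c \<in> carrier k \<Longrightarrow> scalar c \<in> B"
proof -
  assume "c \<in> carrier k"
  then have "c \<odot>\<^bsub>R\<^esub> \<one>\<^bsub>R\<^esub> \<in> carrier R" by (intro R.smult_closed R.one_closed)
  moreover have "c \<odot>\<^bsub>R\<^esub> \<one>\<^bsub>R\<^esub> = scalar c" by (auto simp: scalar_def)
  ultimately show "scalar c \<in> B" by (simp only: R_simps(1))
qed

lemma scalar_simps:
  "x \<in> carrier A \<Longrightarrow> scalar c x = c \<odot>\<^bsub>A\<^esub> x"
  "c \<in> carrier k \<Longrightarrow> d \<in> carrier k \<Longrightarrow> scalar (c \<oplus>\<^bsub>k\<^esub> d) = scalar c \<oplus>\<^bsub>R\<^esub> scalar d"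
  "c \<in> carrier k \<Longrightarrow> d \<in> carrier k \<Longrightarrow> scalar (c \<otimes>\<^bsub>k\<^esub> d) = scalar c \<otimes>\<^bsub>R\<^esub> scalar d"
  "scalar \<one>\<^bsub>k\<^esub> = \<one>\<^bsub>R\<^esub>"
  "c \<in> carrier k \<Longrightarrow> b \<in> B \<Longrightarrow> scalar c \<otimes>\<^bsub>R\<^esub> b = b \<otimes>\<^bsub>R\<^esub> scalar c"
  by (auto simp: scalar_def compose_def A.smult_l_distr A.smult_assoc1 lhom_smult[OF B_lhom])

lemma HA_module: "module k HA"
proof (rule moduleI[OF A.R.is_cring HA.is_abelian_group])
  note s = scalar_B
  fix a b x y assume a: "a \<in> carrier k" and x: "x \<in> carrier HA"
  show "a \<odot>\<^bsub>HA\<^esub> x \<in> carrier HA" using a x s by (simp add: HA_smult)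
next
  fix x assume x: "x \<in> carrier HA"
  then show "\<one>\<^bsub>k\<^esub> \<odot>\<^bsub>HA\<^esub> x = x" unfolding HA_smult scalar_simps(4) by (intro H.smult_one) simp
next
  fix a b x assume "a \<in> carrier k" "b \<in> carrier k" "x \<in> carrier HA"
  then show "(a \<oplus>\<^bsub>k\<^esub> b) \<odot>\<^bsub>HA\<^esub> x = a \<odot>\<^bsub>HA\<^esub> x \<oplus>\<^bsub>HA\<^esub> b \<odot>\<^bsub>HA\<^esub> x"
    "(a \<otimes>\<^bsub>k\<^esub> b) \<odot>\<^bsub>HA\<^esub> x = a \<odot>\<^bsub>HA\<^esub> (b \<odot>\<^bsub>HA\<^esub> x)"
    using H.smult_l_distr[of "scalar a" "scalar b" x] H.smult_assoc1[of "scalar a" "scalar b" x] scalar_B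
    by (simp_all only: HA_smult scalar_simps(2,3) R_simps(1) HA_simps)
next
  fix a x y assume "a \<in> carrier k" "x \<in> carrier HA" "y \<in> carrier HA"
  then show "a \<odot>\<^bsub>HA\<^esub> (x \<oplus>\<^bsub>HA\<^esub> y) = a \<odot>\<^bsub>HA\<^esub> x \<oplus>\<^bsub>HA\<^esub> a \<odot>\<^bsub>HA\<^esub> y"
    using scalar_B by (simp add: HA_smult H.smult_r_distr)
qed

lemma H_smult_diff:
  "b \<in> B \<Longrightarrow> x \<in> carrier H \<Longrightarrow> y \<in> carrier H \<Longrightarrow> b \<odot>\<^bsub>H\<^esub> (x \<ominus>\<^bsub>H\<^esub> y) = b \<odot>\<^bsub>H\<^esub> x \<ominus>\<^bsub>H\<^esub> b \<odot>\<^bsub>H\<^esub> y"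
  by (simp add: a_minus_def H.smult_r_distr H.smult_r_minus)

lemma HA_minus: "x \<in> carrier H \<Longrightarrow> y \<in> carrier H \<Longrightarrow> x \<ominus>\<^bsub>HA\<^esub> y = x \<ominus>\<^bsub>H\<^esub> y"
proof -
  assume xy: "x \<in> carrier H" "y \<in> carrier H"
  then have "\<ominus>\<^bsub>HA\<^esub> y = \<ominus>\<^bsub>H\<^esub> y" by (intro HA.minus_equality) (simp_all add: H.M.l_neg)
  then show ?thesis by (simp add: a_minus_def)
qed

lemma HA_distrib:
  assumes "x \<in> carrier H" "y \<in> carrier H" "z \<in> carrier H"
  shows "(x \<ominus>\<^bsub>H\<^esub> y) \<otimes>\<^bsub>HA\<^esub> z = x \<otimes>\<^bsub>HA\<^esub> z \<ominus>\<^bsub>H\<^esub> y \<otimes>\<^bsub>HA\<^esub> z"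
    "z \<otimes>\<^bsub>HA\<^esub> (x \<ominus>\<^bsub>H\<^esub> y) = z \<otimes>\<^bsub>HA\<^esub> x \<ominus>\<^bsub>H\<^esub> z \<otimes>\<^bsub>HA\<^esub> y"
proof -
  have c: "x \<otimes>\<^bsub>HA\<^esub> z \<in> carrier H" "y \<otimes>\<^bsub>HA\<^esub> z \<in> carrier H" "z \<otimes>\<^bsub>HA\<^esub> x \<in> carrier H" "z \<otimes>\<^bsub>HA\<^esub> y \<in> carrier H"
    using HA.m_closed assms by simp_all
  have "(x \<ominus>\<^bsub>HA\<^esub> y) \<otimes>\<^bsub>HA\<^esub> z = x \<otimes>\<^bsub>HA\<^esub> z \<ominus>\<^bsub>HA\<^esub> y \<otimes>\<^bsub>HA\<^esub> z"
    "z \<otimes>\<^bsub>HA\<^esub> (x \<ominus>\<^bsub>HA\<^esub> y) = z \<otimes>\<^bsub>HA\<^esub> x \<ominus>\<^bsub>HA\<^esub> z \<otimes>\<^bsub>HA\<^esub> y"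
    using assms HA.l_distr[of x "\<ominus>\<^bsub>HA\<^esub> y" z] HA.r_distr[of x "\<ominus>\<^bsub>HA\<^esub> y" z] HA.l_minus[of y z] HA.r_minus[of z y]
      HA.a_inv_closed[of y] by (simp_all add: a_minus_def)
  then show "(x \<ominus>\<^bsub>H\<^esub> y) \<otimes>\<^bsub>HA\<^esub> z = x \<otimes>\<^bsub>HA\<^esub> z \<ominus>\<^bsub>H\<^esub> y \<otimes>\<^bsub>HA\<^esub> z"
    "z \<otimes>\<^bsub>HA\<^esub> (x \<ominus>\<^bsub>H\<^esub> y) = z \<otimes>\<^bsub>HA\<^esub> x \<ominus>\<^bsub>H\<^esub> z \<otimes>\<^bsub>HA\<^esub> y"
    using assms c by (simp_all add: HA_minus)
qed

lemma HA_mult_closed: "x \<in> carrier H \<Longrightarrow> y \<in> carrier H \<Longrightarrow> x \<otimes>\<^bsub>HA\<^esub> y \<in> carrier H"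
  using HA.m_closed by simp

text \<open>On generators the action of \<open>c\<close> amounts to replacing \<open>a\<close> by \<open>c a\<close>, where it passes through
  left and right multiplications of \<open>A\<close>.\<close>
lemma scalar_mult:
  assumes c: "c \<in> carrier k" and x: "x \<in> carrier H" and y: "y \<in> carrier H"
  shows "(scalar c \<odot>\<^bsub>H\<^esub> x) \<otimes>\<^bsub>HA\<^esub> y = scalar c \<odot>\<^bsub>H\<^esub> (x \<otimes>\<^bsub>HA\<^esub> y)"
    and "x \<otimes>\<^bsub>HA\<^esub> (scalar c \<odot>\<^bsub>H\<^esub> y) = scalar c \<odot>\<^bsub>H\<^esub> (x \<otimes>\<^bsub>HA\<^esub> y)"
proof -
  note s = scalar_B[OF c]
  have gen: "scalar c \<odot>\<^bsub>H\<^esub> f (\<iota> a) = f (\<iota> (c \<odot>\<^bsub>A\<^esub> a))" if "f \<in> lhom R H H" "a \<in> carrier A" for f a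
    using endo_iota_smult[OF that s] that c by (simp add: scalar_simps)
  have comm: "b \<odot>\<^bsub>H\<^esub> (scalar c \<odot>\<^bsub>H\<^esub> z) = scalar c \<odot>\<^bsub>H\<^esub> (b \<odot>\<^bsub>H\<^esub> z)" if "b \<in> B" "z \<in> carrier H" for b z
    using that H.smult_assoc1[of b "scalar c" z] H.smult_assoc1[of "scalar c" b z] s scalar_simps(5)[OF c that(1)]
    by (simp only: R_simps(1))
  have sc_mult: "lmult A (c \<odot>\<^bsub>A\<^esub> a) = scalar c \<otimes>\<^bsub>R\<^esub> lmult A a" "rmult A (c \<odot>\<^bsub>A\<^esub> a) = scalar c \<otimes>\<^bsub>R\<^esub> rmult A a"
    if "a \<in> carrier A" for a
    using that c by (auto simp: lmult_def rmult_def scalar_def compose_def A.smult_mult_left A.smult_mult_right)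
  from x show "(scalar c \<odot>\<^bsub>H\<^esub> x) \<otimes>\<^bsub>HA\<^esub> y = scalar c \<odot>\<^bsub>H\<^esub> (x \<otimes>\<^bsub>HA\<^esub> y)"
  proof (induction rule: HA_induct)
    case zero
    then show ?case using s y HA.l_null[of y] by simp
  next
    case (gen a f)
    then show ?case
      using y c s H.smult_assoc1[of "scalar c" "lmult A a" "f y"] mult_B(1)[OF gen(1)] lhom_closed[OF gen(2) y]
      by (simp only: \<open>\<And>f a. _ \<Longrightarrow> _ \<Longrightarrow> scalar c \<odot>\<^bsub>H\<^esub> f (\<iota> a) = _\<close> HA_mult_gen(1) A.smult_closed sc_mult R_simps(1))
  next
    case (diff x z)
    then show ?case using s y by (simp add: H_smult_diff HA_distrib HA_mult_closed)
  qed
  from y show "x \<otimes>\<^bsub>HA\<^esub> (scalar c \<odot>\<^bsub>H\<^esub> y) = scalar c \<odot>\<^bsub>H\<^esub> (x \<otimes>\<^bsub>HA\<^esub> y)"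
  proof (induction rule: HA_induct)
    case zero
    then show ?case using s x HA.r_null[of x] by simp
  next
    case (gen a f)
    then show ?case
      using x c s H.smult_assoc1[of "scalar c" "rmult A a" "f x"] mult_B(2)[OF gen(1)] lhom_closed[OF gen(2) x]
      by (simp only: \<open>\<And>f a. _ \<Longrightarrow> _ \<Longrightarrow> scalar c \<odot>\<^bsub>H\<^esub> f (\<iota> a) = _\<close> HA_mult_gen(2) A.smult_closed sc_mult R_simps(1))
  next
    case (diff y z)
    then show ?case using s x by (simp add: H_smult_diff HA_distrib HA_mult_closed)
  qed
qed

lemma HA_assoc_algebra: "assoc_algebra k HA"
  using HA_module HA_ring scalar_mult
  by (simp add: assoc_algebra_def assoc_algebra_axioms_def HA_smult)

abbreviation "EA \<equiv> endo_algebra k HA"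

lemma EA_assoc_algebra: "assoc_algebra k EA"
  by (rule endo_algebra_assoc_algebra[OF HA_module])

sublocale EA: assoc_algebra k EA by (rule EA_assoc_algebra)

lemma EA_simps [simp]:
  "carrier EA = lhom k HA HA" "x \<in> carrier H \<Longrightarrow> (\<beta> \<oplus>\<^bsub>EA\<^esub> \<gamma>) x = \<beta> x \<oplus>\<^bsub>H\<^esub> \<gamma> x"
  "x \<in> carrier H \<Longrightarrow> (\<beta> \<otimes>\<^bsub>EA\<^esub> \<gamma>) x = \<beta> (\<gamma> x)" "x \<in> carrier H \<Longrightarrow> \<one>\<^bsub>EA\<^esub> x = x"
  "x \<in> carrier H \<Longrightarrow> \<zero>\<^bsub>EA\<^esub> x = \<zero>\<^bsub>H\<^esub>"
  "x \<in> carrier H \<Longrightarrow> (c \<odot>\<^bsub>EA\<^esub> \<beta>) x = scalar c \<odot>\<^bsub>H\<^esub> \<beta> x"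
  by (simp_all add: endo_algebra_def compose_def HA_smult)

text \<open>The operator that \<open>b\<close> induces on the hull, as a \<open>k\<close>-endomorphism.\<close>
definition opB :: "('a \<Rightarrow> 'a) \<Rightarrow> 'e \<Rightarrow> 'e" where
  "opB b = (\<lambda>x\<in>carrier H. b \<odot>\<^bsub>H\<^esub> x)"

lemma opB_apply [simp]: "x \<in> carrier H \<Longrightarrow> opB b x = b \<odot>\<^bsub>H\<^esub> x"
  by (simp add: opB_def)

lemma opB_lhom: "b \<in> B \<Longrightarrow> opB b \<in> lhom k HA HA"
proof -
  assume b: "b \<in> B"
  have "restrict (\<lambda>x. b \<odot>\<^bsub>H\<^esub> x) (carrier HA) \<in> lhom k HA HA"
  proof (rule restrict_lhom[OF module_left_module[OF HA_module]])
    fix c x assume c: "c \<in> carrier k" and x: "x \<in> carrier HA"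
    show "b \<odot>\<^bsub>H\<^esub> (c \<odot>\<^bsub>HA\<^esub> x) = c \<odot>\<^bsub>HA\<^esub> (b \<odot>\<^bsub>H\<^esub> x)"
      using b x H.smult_assoc1[of b "scalar c" x] H.smult_assoc1[of "scalar c" b x] scalar_B[OF c] scalar_simps(5)[OF c b]
      by (simp only: R_simps(1) HA_smult HA_simps)
  qed (use b in \<open>simp_all add: H.smult_r_distr\<close>)
  then show ?thesis by (simp add: opB_def)
qed

lemma S_lhom_k: "f \<in> lhom R H H \<Longrightarrow> f \<in> lhom k HA HA"
proof -
  assume f: "f \<in> lhom R H H"
  show ?thesis
    by (rule lhomI)
      (simp_all add: lhom_closed[OF f] lhom_undef[OF f] lhom_add[OF f] HA_smult lhom_smult[OF f] scalar_B)
qed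

abbreviation "gens \<equiv> (\<lambda>b. \<lambda>x\<in>carrier H. b \<odot>\<^bsub>H\<^esub> x) ` B \<union> endo ` carrier Chat"
definition "Bhat = generated_subalgebra k EA gens"

lemma gens_eq: "gens = opB ` B \<union> lhom R H H"
  by (simp add: opB_def[abs_def] endo_at_image)

lemma Bhat_subalgebra: "k_subalgebra k EA Bhat" and gens_Bhat: "gens \<subseteq> Bhat"
proof -
  have "gens \<subseteq> carrier EA" using opB_lhom S_lhom_k unfolding gens_eq by auto
  from generated_subalgebra[OF EA_assoc_algebra this]
  show "k_subalgebra k EA Bhat" "gens \<subseteq> Bhat" unfolding Bhat_def .
qed

lemma Bhat_opB: "b \<in> B \<Longrightarrow> opB b \<in> Bhat" and Bhat_endo: "f \<in> lhom R H H \<Longrightarrow> f \<in> Bhat"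
  using gens_Bhat unfolding gens_eq by auto

lemma Bhat_closed:
  "\<beta> \<in> Bhat \<Longrightarrow> \<beta> \<in> lhom k HA HA" "\<beta> \<in> Bhat \<Longrightarrow> \<gamma> \<in> Bhat \<Longrightarrow> \<beta> \<otimes>\<^bsub>EA\<^esub> \<gamma> \<in> Bhat"
  "\<beta> \<in> Bhat \<Longrightarrow> \<gamma> \<in> Bhat \<Longrightarrow> \<beta> \<ominus>\<^bsub>EA\<^esub> \<gamma> \<in> Bhat" "\<zero>\<^bsub>EA\<^esub> \<in> Bhat"
proof -
  have s: "subring Bhat EA" using Bhat_subalgebra by (simp add: k_subalgebra_def)
  show "\<beta> \<in> Bhat \<Longrightarrow> \<beta> \<in> lhom k HA HA" using subringE(1)[OF s] by auto
  show "\<beta> \<in> Bhat \<Longrightarrow> \<gamma> \<in> Bhat \<Longrightarrow> \<beta> \<otimes>\<^bsub>EA\<^esub> \<gamma> \<in> Bhat" by (rule subringE(6)[OF s])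
  show "\<beta> \<in> Bhat \<Longrightarrow> \<gamma> \<in> Bhat \<Longrightarrow> \<beta> \<ominus>\<^bsub>EA\<^esub> \<gamma> \<in> Bhat"
    unfolding a_minus_def by (intro subringE(7)[OF s] subringE(5)[OF s])
  show "\<zero>\<^bsub>EA\<^esub> \<in> Bhat" by (rule subringE(2)[OF s])
qed

text \<open>The elements with the property form a subalgebra that contains the generators.\<close>
lemma Bhat_induct [consumes 1, case_names op endo add mult smult]:
  assumes "\<beta> \<in> Bhat"
    and op: "\<And>b. b \<in> B \<Longrightarrow> Z (opB b)" and en: "\<And>f. f \<in> lhom R H H \<Longrightarrow> Z f"
    and ad: "\<And>\<beta> \<gamma>. \<beta> \<in> lhom k HA HA \<Longrightarrow> \<gamma> \<in> lhom k HA HA \<Longrightarrow> Z \<beta> \<Longrightarrow> Z \<gamma> \<Longrightarrow> Z (\<beta> \<oplus>\<^bsub>EA\<^esub> \<gamma>)"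
    and mu: "\<And>\<beta> \<gamma>. \<beta> \<in> lhom k HA HA \<Longrightarrow> \<gamma> \<in> lhom k HA HA \<Longrightarrow> Z \<beta> \<Longrightarrow> Z \<gamma> \<Longrightarrow> Z (\<beta> \<otimes>\<^bsub>EA\<^esub> \<gamma>)"
    and sm: "\<And>c \<beta>. c \<in> carrier k \<Longrightarrow> \<beta> \<in> lhom k HA HA \<Longrightarrow> Z \<beta> \<Longrightarrow> Z (c \<odot>\<^bsub>EA\<^esub> \<beta>)"
  shows "Z \<beta>"
proof -
  let ?V = "{\<beta> \<in> carrier EA. Z \<beta>}"
  have "subring ?V EA"
  proof (rule EA.subringI)
    have "\<one>\<^bsub>EA\<^esub> = (\<lambda>x\<in>carrier H. x)" by (simp add: endo_algebra_def)
    then show "\<one>\<^bsub>EA\<^esub> \<in> ?V" using en[OF lhom_id[OF H.left_module_axioms]] EA.one_closed by simp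
  next
    fix \<beta> assume b: "\<beta> \<in> ?V"
\<comment> \<open>negatives are scalar multiples\<close>
    have "(\<ominus>\<^bsub>k\<^esub> \<one>\<^bsub>k\<^esub>) \<odot>\<^bsub>EA\<^esub> \<beta> = \<ominus>\<^bsub>EA\<^esub> \<beta>"
      using b EA.smult_l_minus[of "\<one>\<^bsub>k\<^esub>" \<beta>] by simp
    then show "\<ominus>\<^bsub>EA\<^esub> \<beta> \<in> ?V"
      using b sm[of "\<ominus>\<^bsub>k\<^esub> \<one>\<^bsub>k\<^esub>" \<beta>] EA.a_inv_closed[of \<beta>] by simp
  next
    fix \<beta> \<gamma> assume "\<beta> \<in> ?V" "\<gamma> \<in> ?V"
    then show "\<beta> \<otimes>\<^bsub>EA\<^esub> \<gamma> \<in> ?V" "\<beta> \<oplus>\<^bsub>EA\<^esub> \<gamma> \<in> ?V"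
      using mu ad EA.m_closed[of \<beta> \<gamma>] EA.a_closed[of \<beta> \<gamma>] by simp_all
  qed auto
  then have "k_subalgebra k EA ?V"
    using sm EA.smult_closed unfolding k_subalgebra_def by auto
  moreover have "gens \<subseteq> ?V"
    unfolding gens_eq using op en opB_lhom S_lhom_k by auto
  ultimately show ?thesis
    using generated_subalgebra_minimal[of k EA ?V gens] assms(1) unfolding Bhat_def by blast
qed

lemma lmult_HA_gen:
  assumes "a \<in> carrier A" "f \<in> lhom R H H"
  shows "lmult HA (f (\<iota> a)) = opB (lmult A a) \<otimes>\<^bsub>EA\<^esub> f" "rmult HA (f (\<iota> a)) = opB (rmult A a) \<otimes>\<^bsub>EA\<^esub> f"
  by (auto simp: lmult_def[of HA] rmult_def[of HA] endo_algebra_def compose_def HA_mult_gen assms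
      lhom_closed[OF assms(2)])

lemma HA_mult_lhom:
  assumes "x \<in> carrier H"
  shows "lmult HA x \<in> lhom k HA HA" "rmult HA x \<in> lhom k HA HA"
proof -
  note LM = module_left_module[OF HA_module]
  show "lmult HA x \<in> lhom k HA HA" unfolding lmult_def
    by (rule restrict_lhom[OF LM])
      (use assms HA.r_distr[of _ _ x] in \<open>simp_all add: HA_mult_closed HA_smult scalar_mult\<close>)
  show "rmult HA x \<in> lhom k HA HA" unfolding rmult_def
    by (rule restrict_lhom[OF LM])
      (use assms HA.l_distr[of _ _ x] in \<open>simp_all add: HA_mult_closed HA_smult scalar_mult\<close>)
qed

lemma EA_minus_apply:
  assumes "\<beta> \<in> lhom k HA HA" "\<gamma> \<in> lhom k HA HA" "x \<in> carrier H"
  shows "(\<beta> \<ominus>\<^bsub>EA\<^esub> \<gamma>) x = \<beta> x \<ominus>\<^bsub>H\<^esub> \<gamma> x"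
proof -
  have c: "\<beta> x \<in> carrier H" "\<gamma> x \<in> carrier H" "(\<beta> \<ominus>\<^bsub>EA\<^esub> \<gamma>) x \<in> carrier H"
    using assms EA.minus_closed[of \<beta> \<gamma>] lhom_closed[of _ k HA HA x] by simp_all
  have "\<beta> \<ominus>\<^bsub>EA\<^esub> \<gamma> \<oplus>\<^bsub>EA\<^esub> \<gamma> = \<beta>"
    using assms EA.a_assoc[of \<beta> "\<ominus>\<^bsub>EA\<^esub> \<gamma>" \<gamma>] EA.l_neg[of \<gamma>] EA.r_zero[of \<beta>] EA.a_inv_closed[of \<gamma>]
    by (simp add: a_minus_def)
  then have "(\<beta> \<ominus>\<^bsub>EA\<^esub> \<gamma>) x \<oplus>\<^bsub>H\<^esub> \<gamma> x = \<beta> x"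
    using EA_simps(2)[OF assms(3), of "\<beta> \<ominus>\<^bsub>EA\<^esub> \<gamma>" \<gamma>] by simp
  then have "\<beta> x \<ominus>\<^bsub>H\<^esub> \<gamma> x = (\<beta> \<ominus>\<^bsub>EA\<^esub> \<gamma>) x \<oplus>\<^bsub>H\<^esub> \<gamma> x \<oplus>\<^bsub>H\<^esub> \<ominus>\<^bsub>H\<^esub> \<gamma> x" by (simp add: a_minus_def)
  also have "\<dots> = (\<beta> \<ominus>\<^bsub>EA\<^esub> \<gamma>) x" using c by (simp add: H.M.a_assoc H.M.r_neg)
  finally show ?thesis by simp
qed

text \<open>Multiplication by \<open>f(a)\<close> is \<open>f\<close> followed by an operator of \<open>B\<close>, on either side.\<close>
lemma HA_mult_Bhat:
  assumes "x \<in> carrier H"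
  shows "lmult HA x \<in> Bhat \<and> rmult HA x \<in> Bhat"
  using assms
proof (induction rule: HA_induct)
  case zero
  have "lmult HA \<zero>\<^bsub>H\<^esub> = \<zero>\<^bsub>EA\<^esub>" "rmult HA \<zero>\<^bsub>H\<^esub> = \<zero>\<^bsub>EA\<^esub>"
    using HA.l_null HA.r_null by (auto simp: lmult_def rmult_def endo_algebra_def)
  then show ?case using Bhat_closed(4) by simp
next
  case (gen a f)
  then show ?case
    unfolding lmult_HA_gen[OF gen] using mult_B by (intro conjI Bhat_closed(2) Bhat_opB Bhat_endo) auto
next
  case (diff x y)
  have c: "x \<ominus>\<^bsub>H\<^esub> y \<in> carrier H" using diff(1,2) by (simp add: a_minus_def)
  have "lmult HA (x \<ominus>\<^bsub>H\<^esub> y) = lmult HA x \<ominus>\<^bsub>EA\<^esub> lmult HA y"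
    using diff(1,2) c EA.minus_closed[of "lmult HA x" "lmult HA y"] HA_mult_lhom
    by (intro lhom_eqI[of _ k HA HA]) (simp_all add: EA_minus_apply, simp_all add: lmult_def HA_distrib)
  moreover have "rmult HA (x \<ominus>\<^bsub>H\<^esub> y) = rmult HA x \<ominus>\<^bsub>EA\<^esub> rmult HA y"
    using diff(1,2) c EA.minus_closed[of "rmult HA x" "rmult HA y"] HA_mult_lhom
    by (intro lhom_eqI[of _ k HA HA]) (simp_all add: EA_minus_apply, simp_all add: rmult_def HA_distrib)
  ultimately show ?case using diff(3,4) Bhat_closed(3) by simp
qed

lemma lmult_in_multiplication_algebra: "lmult HA ` carrier HA \<subseteq> multiplication_algebra k HA"
  unfolding multiplication_algebra_def
  using generated_subalgebra(2)[OF EA_assoc_algebra, of "lmult HA ` carrier HA \<union> rmult HA ` carrier HA"] HA_mult_lhom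
  by auto

lemma multiplication_algebra_in_Bhat: "multiplication_algebra k HA \<subseteq> Bhat"
  unfolding multiplication_algebra_def
  using HA_mult_Bhat by (intro generated_subalgebra_minimal Bhat_subalgebra) auto

abbreviation "Rhat \<equiv> operator_algebra k HA Bhat"
abbreviation "Mhat \<equiv> operator_module HA"

lemmas Rhat_simps = operator_algebra_simps[of k HA Bhat]

lemma Mhat_simps:
  "carrier Mhat = carrier H" "x \<oplus>\<^bsub>Mhat\<^esub> y = x \<oplus>\<^bsub>H\<^esub> y" "\<zero>\<^bsub>Mhat\<^esub> = \<zero>\<^bsub>H\<^esub>" "\<beta> \<odot>\<^bsub>Mhat\<^esub> x = \<beta> x"
  by (simp_all only: operator_module_simps HA_simps)

lemma Mhat_left_module: "left_module Rhat Mhat"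
  by (rule operator_left_module[OF HA_module Bhat_subalgebra])

lemma Bhat_extension: "module_structure_extension k HA Rhat (lmult HA) (\<lambda>b. b)"
proof -
  have "lmult HA \<in> ring_hom HA Rhat"
  proof (rule ring_hom_memI)
    fix x y assume "x \<in> carrier HA" "y \<in> carrier HA"
    then have xy: "x \<in> carrier H" "y \<in> carrier H" by simp_all
    show "lmult HA (x \<otimes>\<^bsub>HA\<^esub> y) = lmult HA x \<otimes>\<^bsub>Rhat\<^esub> lmult HA y"
      using xy HA.m_assoc[of x y] HA_mult_closed by (auto simp: Rhat_simps lmult_def endo_algebra_def compose_def)
    show "lmult HA (x \<oplus>\<^bsub>HA\<^esub> y) = lmult HA x \<oplus>\<^bsub>Rhat\<^esub> lmult HA y"
      using xy HA.l_distr[of x y] by (auto simp: Rhat_simps lmult_def endo_algebra_def)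
  next
    show "lmult HA \<one>\<^bsub>HA\<^esub> = \<one>\<^bsub>Rhat\<^esub>"
      using HA.l_one by (auto simp: Rhat_simps lmult_def endo_algebra_def)
  qed (use HA_mult_Bhat in \<open>simp add: Rhat_simps\<close>)
  moreover have "inj_on (lmult HA) (carrier HA)"
  proof (rule inj_onI)
    fix x y assume xy: "x \<in> carrier HA" "y \<in> carrier HA" "lmult HA x = lmult HA y"
    then have "lmult HA x u = lmult HA y u" by simp
    then show "x = y" using xy HA.r_one[of x] HA.r_one[of y] by (simp add: lmult_def)
  qed
  moreover have "lmult HA (c \<odot>\<^bsub>HA\<^esub> x) = c \<odot>\<^bsub>Rhat\<^esub> lmult HA x" if "c \<in> carrier k" "x \<in> carrier HA" for c x
    using that scalar_mult(1)[OF that(1)] by (auto simp: Rhat_simps lmult_def endo_algebra_def HA_smult)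
  moreover have "assoc_algebra k Rhat"
    by (rule operator_assoc_algebra[OF HA_module Bhat_subalgebra])
  moreover have "(\<lambda>b. b) \<in> ring_hom Rhat EA"
    using Bhat_closed(1) by (intro ring_hom_memI) (simp_all add: Rhat_simps)
  ultimately show ?thesis
    using HA_assoc_algebra by (simp add: module_structure_extension_def)
qed

text \<open>Stability only has to be tested on the generators of the larger algebra.\<close>
lemma stable_hull_iff:
  "stable_ideal k HA Bhat K \<longleftrightarrow> submodule K R H \<and> (\<forall>f\<in>lhom R H H. \<forall>x\<in>K. f x \<in> K)" (is "?l \<longleftrightarrow> ?r")
proof
  assume ?l
  then have K: "K \<subseteq> carrier H" "\<zero>\<^bsub>H\<^esub> \<in> K" "\<And>x y. x \<in> K \<Longrightarrow> y \<in> K \<Longrightarrow> x \<oplus>\<^bsub>H\<^esub> y \<in> K"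
    "\<And>\<beta> x. \<beta> \<in> Bhat \<Longrightarrow> x \<in> K \<Longrightarrow> \<beta> x \<in> K"
    by (simp_all add: stable_ideal_def left_module.submodule_iff[OF Mhat_left_module] Mhat_simps Rhat_simps)
  have "b \<odot>\<^bsub>H\<^esub> x \<in> K" if "b \<in> B" "x \<in> K" for b x
    using K(4)[OF Bhat_opB[OF that(1)] that(2)] K(1) that(2) by (simp add: subset_iff)
  then show ?r using K Bhat_endo by (auto simp: H.submodule_iff)
next
  assume r: ?r
  then have K: "K \<subseteq> carrier H" "\<zero>\<^bsub>H\<^esub> \<in> K" "\<And>x y. x \<in> K \<Longrightarrow> y \<in> K \<Longrightarrow> x \<oplus>\<^bsub>H\<^esub> y \<in> K"
    "\<And>b x. b \<in> B \<Longrightarrow> x \<in> K \<Longrightarrow> b \<odot>\<^bsub>H\<^esub> x \<in> K" "\<And>f x. f \<in> lhom R H H \<Longrightarrow> x \<in> K \<Longrightarrow> f x \<in> K"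
    by (auto simp: H.submodule_iff)
  have KH: "x \<in> carrier H" if "x \<in> K" for x using K(1) that by auto
  have "\<forall>x\<in>K. \<beta> x \<in> K" if "\<beta> \<in> Bhat" for \<beta>
    using that by (induction rule: Bhat_induct) (simp_all add: K KH scalar_B)
  then show ?l
    using K by (simp add: stable_ideal_def left_module.submodule_iff[OF Mhat_left_module] Mhat_simps Rhat_simps)
qed

end

context semiprime_extension
begin

section \<open>The quotient module\<close>

text \<open>The embedding restricts to a homomorphism from every submodule into the hull, and this
  restriction is zero on a torsion submodule.\<close>
lemma A_torsion_free: "torsion_submodule R M H M = {\<zero>\<^bsub>M\<^esub>}"
proof -
  have "T \<subseteq> {\<zero>\<^bsub>M\<^esub>}" if T: "submodule T R M" "lambek_torsion R M H (M\<lparr>carrier := T\<rparr>)" for T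
  proof
    fix x assume x: "x \<in> T"
    have "restrict \<iota> T \<in> lhom R (M\<lparr>carrier := T\<rparr>) H"
      by (rule lhom_sub[OF M_left_module T(1) iota(1)])
    then have "restrict \<iota> T = (\<lambda>x\<in>T. \<zero>\<^bsub>H\<^esub>)" using T(2) by (simp add: lambek_torsion_def)
    then have "\<iota> x = \<zero>\<^bsub>H\<^esub>" using x by (metis restrict_apply')
    then show "x \<in> {\<zero>\<^bsub>M\<^esub>}"
      using x stableD(1)[OF T(1)] iota_eq[of x "\<zero>\<^bsub>A\<^esub>"] by auto
  qed
  then have "torsion_submodule R M H M \<subseteq> {\<zero>\<^bsub>M\<^esub>}"
    unfolding torsion_submodule_def by (intro submodule_span_minimal M.zero_submodule) blast
  moreover have "\<zero>\<^bsub>M\<^esub> \<in> torsion_submodule R M H M"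
    unfolding torsion_submodule_def submodule_span_def using submodule_zero by blast
  ultimately show ?thesis by blast
qed

lemma H_sigma_hull: "sigma_injective_hull R M M H \<iota>"
  unfolding sigma_injective_hull_def
proof (intro conjI allI impI)
  show "in_sigma R M H"
    by (rule generated_by_in_sigma[OF M_left_module hull_generated_by[OF M_left_module hull]])
qed (use hull_injective_sigma[OF M_left_module hull] iota iota_essential in simp_all)

text \<open>Composed with the projection, a homomorphism from the cokernel to the hull becomes an
  endomorphism of the hull that vanishes on \<open>A\<close>; by rigidity it is zero.\<close>
lemma cokernel_torsion:
  "torsion_submodule R M H (quotient_lmodule H (\<iota> ` carrier A)) = carrier (quotient_lmodule H (\<iota> ` carrier A))"
proof -
  let ?I = "\<iota> ` carrier A"
  let ?Q = "quotient_lmodule H ?I"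
  have I: "submodule ?I R H" by (rule essentialD(1)[OF iota_essential])
  note Q = quotient_left_module[OF H.left_module_axioms I]
  let ?p = "\<lambda>x\<in>carrier H. ?I +>\<^bsub>H\<^esub> x"
  interpret Q: left_module R ?Q by (rule Q(1))
  have sig: "in_sigma R M ?Q"
    by (rule generated_by_in_sigma[OF M_left_module
          quotient_generated_by[OF M_left_module hull_generated_by[OF M_left_module hull] I]])
  have only: "f = (\<lambda>x\<in>carrier ?Q. \<zero>\<^bsub>H\<^esub>)" if f: "f \<in> lhom R ?Q H" for f
  proof (rule lhom_eqI[OF f])
    show "(\<lambda>x\<in>carrier ?Q. \<zero>\<^bsub>H\<^esub>) \<in> lhom R ?Q H" by (rule restrict_lhom[OF Q(1)]) auto
    fix X assume X: "X \<in> carrier ?Q"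
    then obtain x where x: "x \<in> carrier H" "X = ?I +>\<^bsub>H\<^esub> x" by (auto simp: Q(3))
    note fp = lhom_compose[OF H.left_module_axioms Q(2) f]
    have "compose (carrier H) f ?p x = \<zero>\<^bsub>H\<^esub>"
    proof (rule endo_zero[OF fp _ x(1)])
      fix a assume a: "a \<in> carrier A"
      have "\<zero>\<^bsub>?Q\<^esub> = ?I" by (simp add: quotient_lmodule_def with_smult_def FactRing_def)
      moreover have "?I +>\<^bsub>H\<^esub> \<iota> a = ?I"
        using I a by (intro H.a_coset_join2) (auto simp: submodule_def)
      ultimately have "?p (\<iota> a) = \<zero>\<^bsub>?Q\<^esub>" using a by simp
      then show "compose (carrier H) f ?p (\<iota> a) = \<zero>\<^bsub>H\<^esub>"
        using a lhom_zero[OF Q(1) H.left_module_axioms f] by (simp only: compose_eq iota_closed)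
    qed
    then show "f X = (\<lambda>x\<in>carrier ?Q. \<zero>\<^bsub>H\<^esub>) X"
      using X x(1) unfolding x(2) by (simp only: compose_eq restrict_apply' if_True simp_thms)
  qed
  have "(\<lambda>x\<in>carrier ?Q. \<zero>\<^bsub>H\<^esub>) \<in> lhom R ?Q H" by (rule restrict_lhom[OF Q(1)]) auto
  then have "lhom R ?Q H = {\<lambda>x\<in>carrier ?Q. \<zero>\<^bsub>H\<^esub>}"
    by (intro equalityI subsetI) (simp_all only: singleton_iff, erule only)
  then have "lambek_torsion R M H ?Q" unfolding lambek_torsion_def using sig by (rule conjI[rotated])
  moreover have "?Q\<lparr>carrier := carrier ?Q\<rparr> = ?Q" by simp
  ultimately have "carrier ?Q \<in> {T. submodule T R ?Q \<and> lambek_torsion R M H (?Q\<lparr>carrier := T\<rparr>)}"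
    using Q.carrier_submodule by (simp only: mem_Collect_eq simp_thms)
  then have "carrier ?Q \<subseteq> torsion_submodule R M H ?Q"
    unfolding torsion_submodule_def by (intro order_trans[OF Union_upper submodule_span_incl])
  moreover have "torsion_submodule R M H ?Q \<subseteq> carrier ?Q"
    unfolding torsion_submodule_def
    by (intro submodule_span_minimal Q.carrier_submodule Union_least) (elim CollectE conjE, erule submodule_subset)
  ultimately show ?thesis by (rule equalityI[rotated])
qed

lemma H_quotient_module: "is_quotient_module R M H M H \<iota> (carrier H)"
proof -
  have "in_sigma R M M" by (rule generated_by_in_sigma[OF M_left_module generated_by_self[OF M_left_module]])
  moreover have "carrier (quotient_lmodule H (\<iota> ` carrier A)) = (\<lambda>x. \<iota> ` carrier A +>\<^bsub>H\<^esub> x) ` carrier H"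
    by (rule quotient_left_module(3)[OF H.left_module_axioms essentialD(1)[OF iota_essential]])
  ultimately show ?thesis
    unfolding is_quotient_module_def
    using A_torsion_free H_sigma_hull H.carrier_submodule cokernel_torsion by auto
qed

subsection \<open>Invariants as a direct limit\<close>

abbreviation "PE \<equiv> partial_endos R M"
abbreviation "LR \<equiv> limit_rel R M"

lemma partial_endosD:
  assumes "(I, f) \<in> PE"
  shows "essential R M I" "f \<in> lhom R (M\<lparr>carrier := I\<rparr>) M" "I \<subseteq> carrier A"
    "x \<in> I \<Longrightarrow> f x \<in> carrier A"
proof -
  show *: "essential R M I" "f \<in> lhom R (M\<lparr>carrier := I\<rparr>) M" using assms by (auto simp: partial_endos_def)
  show "I \<subseteq> carrier A" by (rule stableD(1)[OF essentialD(1)[OF *(1)]])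
  show "x \<in> I \<Longrightarrow> f x \<in> carrier A" using lhom_closed[OF *(2), of x] by simp
qed

lemma partial_endosI: "essential R M I \<Longrightarrow> f \<in> lhom R (M\<lparr>carrier := I\<rparr>) M \<Longrightarrow> (I, f) \<in> PE"
  by (simp add: partial_endos_def)

text \<open>The extension of a partial endomorphism to the hull; it exists by injectivity and is unique by
  rigidity.\<close>
definition hull_ext :: "'a set \<times> ('a \<Rightarrow> 'a) \<Rightarrow> 'e \<Rightarrow> 'e" where
  "hull_ext p = (THE g. g \<in> lhom R H H \<and> (\<forall>x\<in>fst p. g (\<iota> x) = \<iota> (snd p x)))"

lemma hull_ext_unique:
  assumes "(I, f) \<in> PE" "g \<in> lhom R H H" "\<And>x. x \<in> I \<Longrightarrow> g (\<iota> x) = \<iota> (f x)"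
  shows "hull_ext (I, f) = g"
  unfolding hull_ext_def fst_conv snd_conv
proof (rule the_equality)
  show "g \<in> lhom R H H \<and> (\<forall>x\<in>I. g (\<iota> x) = \<iota> (f x))" using assms(2,3) by blast
  show "g' = g" if "g' \<in> lhom R H H \<and> (\<forall>x\<in>I. g' (\<iota> x) = \<iota> (f x))" for g'
    using endo_eqI[OF _ assms(2) partial_endosD(1)[OF assms(1)], of g'] that assms(3) by simp
qed

lemma hull_ext:
  assumes "(I, f) \<in> PE"
  shows "hull_ext (I, f) \<in> lhom R H H" "x \<in> I \<Longrightarrow> hull_ext (I, f) (\<iota> x) = \<iota> (f x)"
proof -
  note p = partial_endosD[OF assms]
  have I: "left_module R (M\<lparr>carrier := I\<rparr>)" by (rule M.submodule_left_module[OF essentialD(1)[OF p(1)]])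
  have "compose I \<iota> f \<in> lhom R (M\<lparr>carrier := I\<rparr>) H"
    using lhom_compose[OF I p(2) iota(1)] by simp
  then obtain g where g: "g \<in> lhom R M H" "\<And>x. x \<in> I \<Longrightarrow> g x = compose I \<iota> f x"
    by (rule rel_injectiveE[OF hull_injective_generated[OF M_left_module hull generated_by_self[OF M_left_module]]
          essentialD(1)[OF p(1)]]) blast
  obtain h where h: "h \<in> lhom R H H" "\<And>a. a \<in> carrier A \<Longrightarrow> h (\<iota> a) = g a"
    by (rule endo_extension_unique[OF g(1)]) blast
  have hx: "h (\<iota> x) = \<iota> (f x)" if "x \<in> I" for x
    using h(2)[of x] g(2)[OF that] p(3) that by (auto simp: compose_def)
  then have "hull_ext (I, f) = h" by (rule hull_ext_unique[OF assms h(1)])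
  then show "hull_ext (I, f) \<in> lhom R H H" "x \<in> I \<Longrightarrow> hull_ext (I, f) (\<iota> x) = \<iota> (f x)"
    using h(1) hx by simp_all
qed

text \<open>The classes of the direct limit are the fibres of the extension map, so the operations of the
  limit can be computed on extensions.\<close>
lemma limit_rel_iff: "(p, q) \<in> LR \<longleftrightarrow> p \<in> PE \<and> q \<in> PE \<and> hull_ext p = hull_ext q"
proof -
  obtain I f J g where pq: "p = (I, f)" "q = (J, g)" by (cases p, cases q)
  have "hull_ext p = hull_ext q" if "p \<in> PE" "q \<in> PE" "essential R M K" "K \<subseteq> I \<inter> J" "\<forall>x\<in>K. f x = g x" for K
  proof (rule endo_eqI[OF _ _ that(3)])
    show "hull_ext p \<in> lhom R H H" "hull_ext q \<in> lhom R H H"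
      using hull_ext(1) that(1,2) unfolding pq by blast+
    fix x assume x: "x \<in> K"
    then have "hull_ext p (\<iota> x) = \<iota> (f x)" "hull_ext q (\<iota> x) = \<iota> (g x)"
      using hull_ext(2)[of I f x] hull_ext(2)[of J g x] that unfolding pq by blast+
    then show "hull_ext p (\<iota> x) = hull_ext q (\<iota> x)" using that(5) x by simp
  qed
  moreover have "\<forall>x\<in>I \<inter> J. f x = g x" if "p \<in> PE" "q \<in> PE" "hull_ext p = hull_ext q"
  proof
    fix x assume x: "x \<in> I \<inter> J"
    have "\<iota> (f x) = \<iota> (g x)"
      using hull_ext(2)[of I f x] hull_ext(2)[of J g x] that x unfolding pq by simp
    then show "f x = g x"
      using partial_endosD(4)[of I f x] partial_endosD(4)[of J g x] that x iota_eq unfolding pq by simp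
  qed
  moreover have "essential R M (I \<inter> J)" if "p \<in> PE" "q \<in> PE"
    using essential_Int[OF M_left_module] partial_endosD(1) that unfolding pq by blast
  ultimately show ?thesis
    unfolding limit_rel_def pq by blast
qed

definition endo_class :: "'e \<Rightarrow> ('a set \<times> ('a \<Rightarrow> 'a)) set" where
  "endo_class s = {p \<in> PE. hull_ext p = endo s}"

lemma limit_class: "p \<in> PE \<Longrightarrow> LR `` {p} = endo_class (hull_ext p u)"
proof -
  assume p: "p \<in> PE"
  have "endo (hull_ext p u) = hull_ext p"
    using hull_ext(1)[of "fst p" "snd p"] p by (intro endo_at_value) simp
  then show ?thesis using p by (auto simp: endo_class_def limit_rel_iff)
qed

text \<open>An endomorphism of the hull restricts to the essential ideal of the elements that it sends to
  \<open>A\<close>.\<close>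
lemma endo_class_nonempty:
  assumes "s \<in> Inv"
  shows "\<exists>p\<in>PE. hull_ext p = endo s"
proof -
  let ?f = "compose (carrier M) (endo s) \<iota>"
  note e = endo_at(1)[OF assms]
  have f: "?f \<in> lhom R M H" by (rule lhom_compose[OF M_left_module iota(1) e])
  define I where "I = {x \<in> carrier A. ?f x \<in> \<iota> ` carrier A}"
  have I: "essential R M I" unfolding I_def by (rule preimage_essential[OF f])
  note Is = essentialD(1)[OF I]
  have IM: "left_module R (M\<lparr>carrier := I\<rparr>)" by (rule M.submodule_left_module[OF Is])
  define g where "g = (\<lambda>x\<in>I. inv_into (carrier A) \<iota> (?f x))"
  have "g \<in> lhom R (M\<lparr>carrier := I\<rparr>) M"
    using lhom_factor[OF IM M_left_module iota(1) _ lhom_sub[OF M_left_module Is f]] iota(2)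
    by (simp add: g_def I_def cong: restrict_cong)
  then have "(I, g) \<in> PE" by (rule partial_endosI[OF I])
  moreover have "endo s (\<iota> x) = \<iota> (g x)" if "x \<in> I" for x
    using that by (auto simp: g_def I_def compose_def f_inv_into_f)
  ultimately show ?thesis using hull_ext_unique[OF _ e] by blast
qed

lemma partial_endo_sum:
  assumes p: "(I, f) \<in> PE" and q: "(J, g) \<in> PE"
  shows "(I \<inter> J, \<lambda>x\<in>I \<inter> J. f x \<oplus>\<^bsub>M\<^esub> g x) \<in> PE" (is ?t1)
    and "hull_ext (I \<inter> J, \<lambda>x\<in>I \<inter> J. f x \<oplus>\<^bsub>M\<^esub> g x) = hull_ext (I, f) \<oplus>\<^bsub>S\<^esub> hull_ext (J, g)" (is ?t2)
proof -
  note pD = partial_endosD[OF p] and qD = partial_endosD[OF q]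
  have IJ: "essential R M (I \<inter> J)" by (rule essential_Int[OF M_left_module pD(1) qD(1)])
  have LM: "left_module R (M\<lparr>carrier := I \<inter> J\<rparr>)" by (rule M.submodule_left_module[OF essentialD(1)[OF IJ]])
  have "restrict (\<lambda>x. f x \<oplus>\<^bsub>M\<^esub> g x) (carrier (M\<lparr>carrier := I \<inter> J\<rparr>)) \<in> lhom R (M\<lparr>carrier := I \<inter> J\<rparr>) M"
    by (rule restrict_lhom[OF LM])
      (use pD(4) qD(4) lhom_add[OF pD(2)] lhom_add[OF qD(2)] lhom_smult[OF pD(2)] lhom_smult[OF qD(2)]
        in \<open>simp_all add: A.a_ac B_add\<close>)
  then show 1: ?t1 by (intro partial_endosI IJ) simp
  show ?t2
    by (rule hull_ext_unique[OF 1 S_closed(2)[OF hull_ext(1)[OF p] hull_ext(1)[OF q]]])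
      (use pD(3,4) qD(4) hull_ext(2)[OF p] hull_ext(2)[OF q] in \<open>auto simp: iota_add subset_iff\<close>)
qed

text \<open>The preimage of \<open>J\<close> under \<open>f\<close> is essential in \<open>I\<close>, and \<open>I\<close> is essential in \<open>A\<close>.\<close>
lemma partial_endo_composite:
  assumes p: "(I, f) \<in> PE" and q: "(J, g) \<in> PE"
  defines "D \<equiv> {x \<in> I. f x \<in> J}"
  shows "(D, \<lambda>x\<in>D. g (f x)) \<in> PE" (is ?t1)
    and "hull_ext (D, \<lambda>x\<in>D. g (f x)) = hull_ext (I, f) \<otimes>\<^bsub>S\<^esub> hull_ext (J, g)" (is ?t2)
proof -
  note pD = partial_endosD[OF p] and qD = partial_endosD[OF q]
  have IM: "left_module R (M\<lparr>carrier := I\<rparr>)" by (rule M.submodule_left_module[OF essentialD(1)[OF pD(1)]])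
  have D: "essential R M D"
    unfolding D_def
    using essential_trans[OF M_left_module pD(1)] essential_vimage[OF IM M_left_module pD(2) qD(1)] by simp
  have DM: "left_module R (M\<lparr>carrier := D\<rparr>)" by (rule M.submodule_left_module[OF essentialD(1)[OF D]])
  have Ds: "x \<in> I" "f x \<in> J" if "x \<in> D" for x using that by (auto simp: D_def)
  have "restrict (\<lambda>x. g (f x)) (carrier (M\<lparr>carrier := D\<rparr>)) \<in> lhom R (M\<lparr>carrier := D\<rparr>) M"
    by (rule restrict_lhom[OF DM])
      (use Ds qD(4) lhom_add[OF pD(2)] lhom_add[OF qD(2)] lhom_smult[OF pD(2)] lhom_smult[OF qD(2)]
        in simp_all)
  then show 1: ?t1 by (intro partial_endosI D) simp
  show ?t2
    by (rule hull_ext_unique[OF 1 S_closed(1)[OF hull_ext(1)[OF p] hull_ext(1)[OF q]]])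
      (use Ds pD(3,4) hull_ext(2)[OF p] hull_ext(2)[OF q] in \<open>auto simp: subset_iff\<close>)
qed

abbreviation "DL \<equiv> partial_endo_limit R M"

lemma endo_class_mem: "p \<in> endo_class s \<longleftrightarrow> p \<in> PE \<and> hull_ext p = endo s"
  by (simp add: endo_class_def)

text \<open>All representatives give the same class, so the union in the definition is that class.\<close>
lemma DL_add:
  assumes s: "s \<in> Inv" and t: "t \<in> Inv"
  shows "endo_class s \<oplus>\<^bsub>DL\<^esub> endo_class t = endo_class (s \<oplus>\<^bsub>H\<^esub> t)"
proof -
  have *: "LR `` {(I \<inter> J, \<lambda>x\<in>I \<inter> J. f x \<oplus>\<^bsub>M\<^esub> g x)} = endo_class (s \<oplus>\<^bsub>H\<^esub> t)"
    if "(I, f) \<in> endo_class s" "(J, g) \<in> endo_class t" for I f J g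
  proof -
    have pq: "(I, f) \<in> PE" "(J, g) \<in> PE" "hull_ext (I, f) = endo s" "hull_ext (J, g) = endo t"
      using that by (simp_all add: endo_class_mem)
    show ?thesis
      unfolding limit_class[OF partial_endo_sum(1)[OF pq(1,2)]] partial_endo_sum(2)[OF pq(1,2)] pq(3,4)
      using endo_at(2) s t by simp
  qed
  obtain p q where "p \<in> endo_class s" "q \<in> endo_class t"
    using endo_class_nonempty s t unfolding endo_class_def by blast
  with * show ?thesis
    unfolding partial_endo_limit_def ring.simps by (cases p, cases q) fast
qed

lemma DL_mult:
  assumes s: "s \<in> Inv" and t: "t \<in> Inv"
  shows "endo_class s \<otimes>\<^bsub>DL\<^esub> endo_class t = endo_class (s \<otimes>\<^bsub>Chat\<^esub> t)"
proof -
  have *: "LR `` {({x \<in> I. f x \<in> J}, \<lambda>x\<in>{x \<in> I. f x \<in> J}. g (f x))} = endo_class (s \<otimes>\<^bsub>Chat\<^esub> t)"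
    if "(I, f) \<in> endo_class s" "(J, g) \<in> endo_class t" for I f J g
  proof -
    have pq: "(I, f) \<in> PE" "(J, g) \<in> PE" "hull_ext (I, f) = endo s" "hull_ext (J, g) = endo t"
      using that by (simp_all add: endo_class_mem)
    show ?thesis
      unfolding limit_class[OF partial_endo_composite(1)[OF pq(1,2)]] partial_endo_composite(2)[OF pq(1,2)] pq(3,4)
      by simp
  qed
  obtain p q where "p \<in> endo_class s" "q \<in> endo_class t"
    using endo_class_nonempty s t unfolding endo_class_def by blast
  with * show ?thesis
    unfolding partial_endo_limit_def monoid.simps by (cases p, cases q) fast
qed

lemma invariants_limit: "Chat \<simeq> DL"
proof -
  have "endo_class \<in> ring_iso Chat DL"
  proof (rule ring_iso_memI)
    fix s assume "s \<in> carrier Chat"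
    then have s: "s \<in> Inv" by simp
    obtain p where p: "p \<in> PE" "hull_ext p = endo s" using endo_class_nonempty[OF s] by blast
    then have "endo_class s = LR `` {p}" using limit_class[OF p(1)] endo_at(2)[OF s] by simp
    then show "endo_class s \<in> carrier DL"
      using p(1) by (simp add: partial_endo_limit_def quotientI)
  next
    fix s t assume "s \<in> carrier Chat" "t \<in> carrier Chat"
    then have st: "s \<in> Inv" "t \<in> Inv" by simp_all
    show "endo_class (s \<otimes>\<^bsub>Chat\<^esub> t) = endo_class s \<otimes>\<^bsub>DL\<^esub> endo_class t"
      "endo_class (s \<oplus>\<^bsub>Chat\<^esub> t) = endo_class s \<oplus>\<^bsub>DL\<^esub> endo_class t"
      using DL_mult[OF st] DL_add[OF st] by simp_all
  next
    have id: "(carrier M, \<lambda>x\<in>carrier M. x) \<in> PE"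
      using lhom_id[OF M_left_module]
      by (intro partial_endosI essential_carrier[OF M_left_module]) (simp add: operator_module_def with_smult_def)
    have "hull_ext (carrier M, \<lambda>x\<in>carrier M. x) = (\<lambda>x\<in>carrier H. x)"
      by (rule hull_ext_unique[OF id lhom_id[OF H.left_module_axioms]]) simp
    then show "endo_class \<one>\<^bsub>Chat\<^esub> = \<one>\<^bsub>DL\<^esub>"
      using limit_class[OF id] by (simp add: partial_endo_limit_def)
  next
    show "bij_betw endo_class (carrier Chat) (carrier DL)"
      unfolding bij_betw_def
    proof
      show "inj_on endo_class (carrier Chat)"
      proof (rule inj_onI)
        fix s t assume "s \<in> carrier Chat" "t \<in> carrier Chat" and eq: "endo_class s = endo_class t"
        then have st: "s \<in> Inv" "t \<in> Inv" by simp_all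
        obtain p where "p \<in> endo_class s" using endo_class_nonempty[OF st(1)] unfolding endo_class_def by blast
        moreover from this have "p \<in> endo_class t" by (simp only: eq)
        ultimately have "endo s = endo t" by (simp add: endo_class_mem)
        then have "endo s u = endo t u" by simp
        then show "s = t" using endo_at(2) st by simp
      qed
      show "endo_class ` carrier Chat = carrier DL"
      proof
        show "endo_class ` carrier Chat \<subseteq> carrier DL"
        proof (clarsimp)
          fix s assume s: "s \<in> Inv"
          obtain p where p: "p \<in> PE" "hull_ext p = endo s" using endo_class_nonempty[OF s] by blast
          then have "endo_class s = LR `` {p}" using limit_class[OF p(1)] endo_at(2)[OF s] by simp
          then show "endo_class s \<in> carrier DL"
            using p(1) by (simp add: partial_endo_limit_def quotientI)
        qed
        show "carrier DL \<subseteq> endo_class ` carrier Chat"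
        proof
          fix X assume "X \<in> carrier DL"
          then obtain p where p: "p \<in> PE" "X = LR `` {p}"
            by (auto simp: partial_endo_limit_def elim!: quotientE)
          have "hull_ext p u \<in> Inv"
            using hull_ext(1)[of "fst p" "snd p"] p(1) by (intro endo_value_invariant) simp
          then show "X \<in> endo_class ` carrier Chat" using limit_class[OF p(1)] p(2) by simp
        qed
      qed
    qed
  qed
  then show ?thesis by (auto simp: is_ring_iso_def)
qed

section \<open>Semiprimeness, self-injectivity and non-singularity\<close>

lemma trace_stable:
  assumes "submodule K R H"
  shows "submodule {a \<in> carrier A. \<iota> a \<in> K} R M"
  using lhom_vimage[OF M_left_module H.left_module_axioms iota(1) assms] by simp

text \<open>The essential submodule \<open>A\<close> detects nonzero submodules of the hull.\<close>
lemma trace_zero: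
  assumes K: "submodule K R H" and z: "{a \<in> carrier A. \<iota> a \<in> K} = {\<zero>\<^bsub>A\<^esub>}"
  shows "K = {\<zero>\<^bsub>H\<^esub>}"
proof (rule essentialD(2)[OF iota_essential K])
  show "\<iota> ` carrier A \<inter> K = {\<zero>\<^bsub>H\<^esub>}"
  proof (intro equalityI subsetI)
    fix y assume y: "y \<in> \<iota> ` carrier A \<inter> K"
    then obtain a where a: "a \<in> carrier A" "y = \<iota> a" "y \<in> K" by blast
    then have "a \<in> {a \<in> carrier A. \<iota> a \<in> K}" by simp
    then have "a = \<zero>\<^bsub>A\<^esub>" unfolding z by simp
    then show "y \<in> {\<zero>\<^bsub>H\<^esub>}" using a by simp
  next
    fix y assume "y \<in> {\<zero>\<^bsub>H\<^esub>}"
    then show "y \<in> \<iota> ` carrier A \<inter> K"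
      using submodule_zero[OF K] by (auto intro!: image_eqI[of _ _ "\<zero>\<^bsub>A\<^esub>"])
  qed
qed

lemma trace_product:
  assumes "\<forall>x\<in>K. \<forall>y\<in>L. x \<otimes>\<^bsub>HA\<^esub> y = \<zero>\<^bsub>H\<^esub>" "a \<in> carrier A" "b \<in> carrier A" "\<iota> a \<in> K" "\<iota> b \<in> L"
  shows "a \<otimes>\<^bsub>A\<^esub> b = \<zero>\<^bsub>A\<^esub>"
proof -
  have "\<iota> (a \<otimes>\<^bsub>A\<^esub> b) = \<iota> \<zero>\<^bsub>A\<^esub>"
    using ring_hom_mult[OF iota_hom assms(2,3)] assms by simp
  then show ?thesis using assms(2,3) iota_eq[of "a \<otimes>\<^bsub>A\<^esub> b" "\<zero>\<^bsub>A\<^esub>"] by simp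
qed

lemma hull_prod_zero_iff:
  assumes "submodule K R H" "submodule L R H"
  shows "K \<cdot>\<^bsub>HA\<^esub> L = {\<zero>\<^bsub>HA\<^esub>} \<longleftrightarrow> (\<forall>x\<in>K. \<forall>y\<in>L. x \<otimes>\<^bsub>HA\<^esub> y = \<zero>\<^bsub>H\<^esub>)"
  using ideal_prod_zero_iff[OF HA_ring, of K L] submodule_subset[OF assms(1)] submodule_zero[OF assms(1)]
    submodule_subset[OF assms(2)] submodule_zero[OF assms(2)] by simp

lemma prod_zero_iff:
  assumes "submodule K R M" "submodule L R M"
  shows "K \<cdot>\<^bsub>A\<^esub> L = {\<zero>\<^bsub>A\<^esub>} \<longleftrightarrow> (\<forall>x\<in>K. \<forall>y\<in>L. x \<otimes>\<^bsub>A\<^esub> y = \<zero>\<^bsub>A\<^esub>)"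
  by (rule ideal_prod_zero_iff[OF A.ring_axioms stableD(1)[OF assms(1)] stableD(1)[OF assms(2)]
        stableD(2)[OF assms(1)] stableD(2)[OF assms(2)]])

lemma hull_semiprime: "B_semiprime k HA Bhat"
  unfolding B_semiprime_def
proof (intro allI impI)
  fix K assume "stable_ideal k HA Bhat K" and KK: "K \<cdot>\<^bsub>HA\<^esub> K = {\<zero>\<^bsub>HA\<^esub>}"
  then have K: "submodule K R H" by (simp add: stable_hull_iff)
  have "\<forall>x\<in>K. \<forall>y\<in>K. x \<otimes>\<^bsub>HA\<^esub> y = \<zero>\<^bsub>H\<^esub>" using KK hull_prod_zero_iff[OF K K] by simp
  then have "{a \<in> carrier A. \<iota> a \<in> K} = {\<zero>\<^bsub>A\<^esub>}"
    using trace_product by (intro square_zero trace_stable[OF K]) blast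
  then show "K = {\<zero>\<^bsub>HA\<^esub>}" using trace_zero[OF K] by simp
qed

text \<open>An extension over \<open>B\<close> is automatically linear over the larger algebra, because it commutes
  with \<open>S\<close>.\<close>
lemma hull_self_injective_Bhat: "self_injective Rhat Mhat"
  unfolding rel_injective_def
proof (intro allI impI)
  fix N f assume N: "submodule N Rhat Mhat" and f: "f \<in> lhom Rhat (Mhat\<lparr>carrier := N\<rparr>) Mhat"
  have "submodule N R H" using N stable_hull_iff by (simp add: stable_ideal_def)
  then have NH: "N \<subseteq> carrier H" and Ns: "submodule N R H" using submodule_subset by auto
  have "f \<in> lhom R (H\<lparr>carrier := N\<rparr>) H"
  proof (rule lhomI)
    show "f x \<in> carrier H" if "x \<in> carrier (H\<lparr>carrier := N\<rparr>)" for x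
      using lhom_closed[OF f, of x] that by (simp add: Mhat_simps)
    show "f x = undefined" if "x \<notin> carrier (H\<lparr>carrier := N\<rparr>)" for x
      using lhom_undef[OF f, of x] that by simp
    show "f (x \<oplus>\<^bsub>H\<lparr>carrier := N\<rparr>\<^esub> y) = f x \<oplus>\<^bsub>H\<^esub> f y"
      if "x \<in> carrier (H\<lparr>carrier := N\<rparr>)" "y \<in> carrier (H\<lparr>carrier := N\<rparr>)" for x y
      using lhom_add[OF f, of x y] that by (simp add: Mhat_simps)
    show "f (b \<odot>\<^bsub>H\<lparr>carrier := N\<rparr>\<^esub> x) = b \<odot>\<^bsub>H\<^esub> f x"
      if "b \<in> carrier R" "x \<in> carrier (H\<lparr>carrier := N\<rparr>)" for b x
      using lhom_smult[OF f, of "opB b" x] lhom_closed[OF f, of x] that Bhat_opB[of b] NH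
      by (auto simp: Mhat_simps Rhat_simps subset_iff)
  qed
  then obtain g where g: "g \<in> lhom R H H" "\<And>x. x \<in> N \<Longrightarrow> g x = f x"
    by (rule rel_injectiveE[OF hull_self_injective[OF M_left_module hull] Ns]) blast
  have "\<forall>x\<in>carrier H. g (\<beta> x) = \<beta> (g x)" if "\<beta> \<in> Bhat" for \<beta>
    using that
  proof (induction rule: Bhat_induct)
    case (op b)
    then show ?case using lhom_smult[OF g(1), of b] lhom_closed[OF g(1)] by simp
  next
    case (endo f)
    then show ?case using endo_commute[OF g(1)] by blast
  next
    case (add \<beta> \<gamma>)
    then show ?case
      using lhom_closed[OF add(1)] lhom_closed[OF add(2)] lhom_closed[OF g(1)] lhom_add[OF g(1)] by simp
  next
    case (mult \<beta> \<gamma>)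
    then show ?case
      using lhom_closed[OF mult(2)] lhom_closed[OF g(1)] by simp
  next
    case (smult c \<beta>)
    then show ?case
      using lhom_closed[OF smult(2)] lhom_closed[OF g(1)] lhom_smult[OF g(1), of "scalar c"] scalar_B[OF smult(1)] by simp
  qed
  then have "g \<in> lhom Rhat Mhat Mhat"
    using lhom_closed[OF g(1)] lhom_undef[OF g(1)] lhom_add[OF g(1)]
    by (intro lhomI) (simp_all add: Mhat_simps Rhat_simps)
  then show "\<exists>g\<in>lhom Rhat Mhat Mhat. \<forall>x\<in>N. g x = f x" using g(2) by blast
qed

subsection \<open>Projections onto stable ideals\<close>

text \<open>For a stable ideal \<open>K\<close> the sum of \<open>K\<close> and its annihilator is essential, because a stable
  ideal that meets \<open>K\<close> trivially annihilates \<open>K\<close>. The projection onto \<open>K\<close> along the annihilator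
  therefore extends to the hull.\<close>
lemma projection:
  assumes K: "submodule K R M"
  obtains L e where "submodule L R M" "\<And>l k. l \<in> L \<Longrightarrow> k \<in> K \<Longrightarrow> l \<otimes>\<^bsub>A\<^esub> k = \<zero>\<^bsub>A\<^esub>"
    "\<And>X. submodule X R M \<Longrightarrow> X \<inter> K = {\<zero>\<^bsub>A\<^esub>} \<Longrightarrow> X \<subseteq> L"
    "essential R M {k \<oplus>\<^bsub>A\<^esub> l |k l. k \<in> K \<and> l \<in> L}"
    "e \<in> lhom R H H" "\<And>k. k \<in> K \<Longrightarrow> e (\<iota> k) = \<iota> k" "\<And>l. l \<in> L \<Longrightarrow> e (\<iota> l) = \<zero>\<^bsub>H\<^esub>"
proof -
  note KA = stableD(1)[OF K]
  define L where "L = {l \<in> carrier A. \<forall>b\<in>B. \<forall>k\<in>K. b l \<otimes>\<^bsub>A\<^esub> k = \<zero>\<^bsub>A\<^esub>}"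
  have KA': "k \<in> carrier A" if "k \<in> K" for k using KA that by auto
  have bz: "b \<zero>\<^bsub>A\<^esub> = \<zero>\<^bsub>A\<^esub>" if "b \<in> B" for b
    using lhom_zero[OF module_left_module[OF A.module_axioms] module_left_module[OF A.module_axioms] B_lhom[OF that]] .
  have L: "submodule L R M"
    unfolding M.submodule_iff
  proof (intro conjI ballI)
    fix b l assume b: "b \<in> carrier R" and l: "l \<in> L"
    have "b' (b l) \<otimes>\<^bsub>A\<^esub> k = \<zero>\<^bsub>A\<^esub>" if "b' \<in> B" "k \<in> K" for b' k
    proof -
      have "b' \<otimes>\<^bsub>R\<^esub> b \<in> B" using R.m_closed[of b' b] b that(1) by simp
      then have "(b' \<otimes>\<^bsub>R\<^esub> b) l \<otimes>\<^bsub>A\<^esub> k = \<zero>\<^bsub>A\<^esub>" using l that(2) unfolding L_def by blast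
      then show ?thesis using l by (simp add: compose_def L_def)
    qed
    then show "b \<odot>\<^bsub>M\<^esub> l \<in> L" using b l by (simp add: L_def)
  qed (auto simp: L_def B_add A.l_distr KA' bz)
  have LK: "l \<otimes>\<^bsub>A\<^esub> k = \<zero>\<^bsub>A\<^esub>" if "l \<in> L" "k \<in> K" for l k
  proof -
    have "\<one>\<^bsub>R\<^esub> \<in> B" using R.one_closed by simp
    then have "\<one>\<^bsub>R\<^esub> l \<otimes>\<^bsub>A\<^esub> k = \<zero>\<^bsub>A\<^esub>" using that unfolding L_def by blast
    then show ?thesis using that by (simp add: L_def)
  qed
  have LKi: "L \<inter> K = {\<zero>\<^bsub>A\<^esub>}" using annihilate_iff_disjoint[OF L K] LK by blast
  have max: "X \<subseteq> L" if X: "submodule X R M" "X \<inter> K = {\<zero>\<^bsub>A\<^esub>}" for X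
  proof
    fix x assume x: "x \<in> X"
    have "\<forall>x\<in>X. \<forall>k\<in>K. x \<otimes>\<^bsub>A\<^esub> k = \<zero>\<^bsub>A\<^esub>" using annihilate_iff_disjoint[OF X(1) K] X(2) by blast
    then show "x \<in> L" using x stableD(1,4)[OF X(1)] by (auto simp: L_def)
  qed
  define D where "D = {k \<oplus>\<^bsub>A\<^esub> l |k l. k \<in> K \<and> l \<in> L}"
  have LA': "l \<in> carrier A" if "l \<in> L" for l using that by (simp add: L_def)
  have KD: "K \<subseteq> D" and LD: "L \<subseteq> D"
    using stableD(2)[OF K] stableD(2)[OF L] KA' LA' A.r_zero A.l_zero unfolding D_def
    by (force, force)
  have sum_add: "k \<oplus>\<^bsub>A\<^esub> l \<oplus>\<^bsub>A\<^esub> (k' \<oplus>\<^bsub>A\<^esub> l') = (k \<oplus>\<^bsub>A\<^esub> k') \<oplus>\<^bsub>A\<^esub> (l \<oplus>\<^bsub>A\<^esub> l')"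
    if "k \<in> K" "l \<in> L" "k' \<in> K" "l' \<in> L" for k l k' l'
    using that KA' LA' by (simp add: A.a_ac)
  have D: "submodule D R M"
    unfolding M.submodule_iff
  proof (intro conjI ballI)
    show "D \<subseteq> carrier M" using KA' LA' by (auto simp: D_def)
    show "\<zero>\<^bsub>M\<^esub> \<in> D" using KD stableD(2)[OF K] by auto
  next
    fix x y assume "x \<in> D" "y \<in> D"
    then obtain k l k' l' where *: "k \<in> K" "l \<in> L" "k' \<in> K" "l' \<in> L" "x = k \<oplus>\<^bsub>A\<^esub> l" "y = k' \<oplus>\<^bsub>A\<^esub> l'"
      unfolding D_def by blast
    then have "x \<oplus>\<^bsub>M\<^esub> y = (k \<oplus>\<^bsub>A\<^esub> k') \<oplus>\<^bsub>A\<^esub> (l \<oplus>\<^bsub>A\<^esub> l')" using sum_add by simp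
    then show "x \<oplus>\<^bsub>M\<^esub> y \<in> D" using stableD(3)[OF K *(1,3)] stableD(3)[OF L *(2,4)] unfolding D_def by blast
  next
    fix b x assume b: "b \<in> carrier R" and "x \<in> D"
    then obtain k l where *: "k \<in> K" "l \<in> L" "x = k \<oplus>\<^bsub>A\<^esub> l" unfolding D_def by blast
    then have "b \<odot>\<^bsub>M\<^esub> x = b k \<oplus>\<^bsub>A\<^esub> b l" using b KA' LA' by (simp add: B_add)
    then show "b \<odot>\<^bsub>M\<^esub> x \<in> D" using stableD(4)[OF K _ *(1), of b] stableD(4)[OF L _ *(2), of b] b unfolding D_def by auto
  qed
  have Dess: "essential R M D"
    unfolding essential_def
  proof (intro conjI allI impI D)
    fix X assume X: "submodule X R M" "D \<inter> X = {\<zero>\<^bsub>M\<^esub>}"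
    have "X \<inter> K = {\<zero>\<^bsub>A\<^esub>}" using X KD stableD(2)[OF K] stableD(2)[OF X(1)] by auto
    then have "X \<subseteq> D" using max[OF X(1)] LD by blast
    then show "X = {\<zero>\<^bsub>M\<^esub>}" using X(2) by blast
  qed
  define q where "q = (\<lambda>x\<in>D. THE k. k \<in> K \<and> (\<exists>l\<in>L. x = k \<oplus>\<^bsub>A\<^esub> l))"
  have uniq: "k = k'" if "k \<in> K" "l \<in> L" "k' \<in> K" "l' \<in> L" "k \<oplus>\<^bsub>A\<^esub> l = k' \<oplus>\<^bsub>A\<^esub> l'" for k l k' l'
  proof -
    have c: "k \<in> carrier A" "l \<in> carrier A" "k' \<in> carrier A" "l' \<in> carrier A" using that KA' LA' by auto
    have "k \<ominus>\<^bsub>A\<^esub> k' = k \<oplus>\<^bsub>A\<^esub> l \<oplus>\<^bsub>A\<^esub> \<ominus>\<^bsub>A\<^esub> l \<oplus>\<^bsub>A\<^esub> \<ominus>\<^bsub>A\<^esub> k'"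
      using c by (simp add: a_minus_def A.a_assoc A.r_neg)
    also have "\<dots> = l' \<oplus>\<^bsub>A\<^esub> \<ominus>\<^bsub>A\<^esub> l"
    proof -
      have "k' \<oplus>\<^bsub>A\<^esub> l' \<oplus>\<^bsub>A\<^esub> \<ominus>\<^bsub>A\<^esub> l \<oplus>\<^bsub>A\<^esub> \<ominus>\<^bsub>A\<^esub> k' = l' \<oplus>\<^bsub>A\<^esub> \<ominus>\<^bsub>A\<^esub> l \<oplus>\<^bsub>A\<^esub> (k' \<oplus>\<^bsub>A\<^esub> \<ominus>\<^bsub>A\<^esub> k')"
        using c by (simp add: A.a_ac)
      then show ?thesis unfolding that(5) using c by (simp add: A.r_neg)
    qed
    finally have e: "k \<ominus>\<^bsub>A\<^esub> k' = l' \<oplus>\<^bsub>A\<^esub> \<ominus>\<^bsub>A\<^esub> l" .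
    have nK: "\<ominus>\<^bsub>A\<^esub> k' \<in> K" and nL: "\<ominus>\<^bsub>A\<^esub> l \<in> L"
      using submodule_neg[OF K that(3)] submodule_neg[OF L that(2)] c
        M.M.minus_equality[of "\<ominus>\<^bsub>A\<^esub> k'" k'] M.M.minus_equality[of "\<ominus>\<^bsub>A\<^esub> l" l] by (simp_all add: A.l_neg)
    have "k \<ominus>\<^bsub>A\<^esub> k' \<in> L \<inter> K"
      using stableD(3)[OF K that(1) nK] stableD(3)[OF L that(4) nL] e by (simp add: a_minus_def)
    then have "k \<ominus>\<^bsub>A\<^esub> k' = \<zero>\<^bsub>A\<^esub>" unfolding LKi by simp
    then show ?thesis using c by simp
  qed
  have q: "q (k \<oplus>\<^bsub>A\<^esub> l) = k" if "k \<in> K" "l \<in> L" for k l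
  proof -
    have "k \<oplus>\<^bsub>A\<^esub> l \<in> D" using that unfolding D_def by blast
    moreover have "(THE k'. k' \<in> K \<and> (\<exists>l'\<in>L. k \<oplus>\<^bsub>A\<^esub> l = k' \<oplus>\<^bsub>A\<^esub> l')) = k"
    proof (rule the_equality)
      show "k \<in> K \<and> (\<exists>l'\<in>L. k \<oplus>\<^bsub>A\<^esub> l = k \<oplus>\<^bsub>A\<^esub> l')" using that by blast
      show "k' = k" if "k' \<in> K \<and> (\<exists>l'\<in>L. k \<oplus>\<^bsub>A\<^esub> l = k' \<oplus>\<^bsub>A\<^esub> l')" for k'
        using that uniq[OF \<open>k \<in> K\<close> \<open>l \<in> L\<close>] by metis
    qed
    ultimately show ?thesis by (simp add: q_def)
  qed
  have DE: "\<exists>k l. k \<in> K \<and> l \<in> L \<and> x = k \<oplus>\<^bsub>A\<^esub> l" if "x \<in> D" for x using that unfolding D_def by blast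
  have "q \<in> lhom R (M\<lparr>carrier := D\<rparr>) M"
  proof (rule lhomI)
    fix x assume "x \<in> carrier (M\<lparr>carrier := D\<rparr>)"
    then show "q x \<in> carrier M" using DE[of x] q KA' by auto
  next
    fix x y assume "x \<in> carrier (M\<lparr>carrier := D\<rparr>)" "y \<in> carrier (M\<lparr>carrier := D\<rparr>)"
    then obtain k l k' l' where *: "k \<in> K" "l \<in> L" "k' \<in> K" "l' \<in> L" "x = k \<oplus>\<^bsub>A\<^esub> l" "y = k' \<oplus>\<^bsub>A\<^esub> l'"
      using DE[of x] DE[of y] by auto
    then show "q (x \<oplus>\<^bsub>M\<lparr>carrier := D\<rparr>\<^esub> y) = q x \<oplus>\<^bsub>M\<^esub> q y"
      using q[OF stableD(3)[OF K *(1,3)] stableD(3)[OF L *(2,4)]] by (simp add: sum_add q)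
  next
    fix b x assume b: "b \<in> carrier R" and "x \<in> carrier (M\<lparr>carrier := D\<rparr>)"
    then obtain k l where *: "k \<in> K" "l \<in> L" "x = k \<oplus>\<^bsub>A\<^esub> l" using DE[of x] by auto
    then show "q (b \<odot>\<^bsub>M\<lparr>carrier := D\<rparr>\<^esub> x) = b \<odot>\<^bsub>M\<^esub> q x"
      using b q[OF stableD(4)[OF K _ *(1), of b] stableD(4)[OF L _ *(2), of b]] KA' LA' by (simp add: B_add q)
  qed (simp add: q_def)
  then have qPE: "(D, q) \<in> PE" by (rule partial_endosI[OF Dess])
  note e = hull_ext[OF qPE]
  show ?thesis
  proof (rule that[OF L LK max Dess[unfolded D_def] e(1)])
    fix k assume k: "k \<in> K"
    then show "hull_ext (D, q) (\<iota> k) = \<iota> k"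
      using e(2)[of k] KD q[OF k stableD(2)[OF L]] KA' by auto
  next
    fix l assume l: "l \<in> L"
    then show "hull_ext (D, q) (\<iota> l) = \<zero>\<^bsub>H\<^esub>"
      using e(2)[of l] LD q[OF stableD(2)[OF K] l] LA' by auto
  qed
qed

subsection \<open>Non-singularity\<close>

abbreviation "CH \<equiv> with_smult H endo"

lemma CH_module: "module Chat CH"
proof (rule left_module_module[OF Chat_cring])
  have ag: "abelian_group CH"
    by (rule abelian_group_cong[OF H.M.abelian_group_axioms]) (simp_all add: with_smult_def)
  show "left_module Chat CH"
    unfolding left_module_def left_module_axioms_def
  proof (intro conjI allI impI Chat.ring_axioms ag)
    fix s x assume "s \<in> carrier Chat" "x \<in> carrier CH"
    then show "s \<odot>\<^bsub>CH\<^esub> x \<in> carrier CH"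
      using lhom_closed[OF endo_at(1), of s x] by (simp add: with_smult_simps)
  next
    fix s t x assume "s \<in> carrier Chat" "t \<in> carrier Chat" "x \<in> carrier CH"
    then have *: "s \<in> Inv" "t \<in> Inv" "x \<in> carrier H" by (simp_all add: with_smult_simps)
    show "(s \<oplus>\<^bsub>Chat\<^esub> t) \<odot>\<^bsub>CH\<^esub> x = s \<odot>\<^bsub>CH\<^esub> x \<oplus>\<^bsub>CH\<^esub> t \<odot>\<^bsub>CH\<^esub> x"
      using endo_at_apply(1)[OF *] by (simp add: with_smult_simps)
    show "(s \<otimes>\<^bsub>Chat\<^esub> t) \<odot>\<^bsub>CH\<^esub> x = s \<odot>\<^bsub>CH\<^esub> (t \<odot>\<^bsub>CH\<^esub> x)"
      using endo_at_apply(2)[OF *] endo_commute[OF endo_at(1)[OF *(1)] endo_at(1)[OF *(2)] *(3)]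
      by (simp only: with_smult_simps)
  next
    fix s x y assume "s \<in> carrier Chat" "x \<in> carrier CH" "y \<in> carrier CH"
    then show "s \<odot>\<^bsub>CH\<^esub> (x \<oplus>\<^bsub>CH\<^esub> y) = s \<odot>\<^bsub>CH\<^esub> x \<oplus>\<^bsub>CH\<^esub> s \<odot>\<^bsub>CH\<^esub> y"
      using lhom_add[OF endo_at(1), of s x y] by (simp add: with_smult_simps)
  next
    fix x assume "x \<in> carrier CH"
    then show "\<one>\<^bsub>Chat\<^esub> \<odot>\<^bsub>CH\<^esub> x = x" by (simp add: with_smult_simps endo_at_one)
  qed
qed

lemma endo_zero_on:
  assumes "s \<in> Inv" "essential R M D" "\<And>x. x \<in> D \<Longrightarrow> endo s (\<iota> x) = \<zero>\<^bsub>H\<^esub>"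
  shows "s = \<zero>\<^bsub>H\<^esub>"
proof -
  have z: "(\<lambda>x\<in>carrier H. \<zero>\<^bsub>H\<^esub>) \<in> lhom R H H"
    by (rule restrict_lhom[OF H.left_module_axioms]) simp_all
  have "endo s = (\<lambda>x\<in>carrier H. \<zero>\<^bsub>H\<^esub>)"
    using assms stableD(1)[OF essentialD(1)[OF assms(2)]]
    by (intro endo_eqI[OF endo_at(1)[OF assms(1)] z assms(2)]) auto
  then have "endo s u = \<zero>\<^bsub>H\<^esub>" by simp
  then show ?thesis using endo_at(2)[OF assms(1)] by simp
qed

text \<open>Let \<open>W\<close> be the submodule killed by the annihilator \<open>I\<close> of \<open>m\<close>, \<open>K\<close> its trace on \<open>A\<close>,
  and \<open>s\<close> the invariant of the projection onto \<open>K\<close>. A multiple of \<open>s\<close> in \<open>I\<close> kills \<open>K\<close>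
  because it lies in \<open>I\<close>, and the complement because it is a multiple of \<open>s\<close>. Hence the
  principal ideal \<open>J\<close> of \<open>s\<close> misses the essential ideal \<open>I\<close>, and \<open>s\<close>, \<open>K\<close>, \<open>W\<close> and \<open>m\<close>
  are zero.\<close>
lemma essential_annihilator_zero:
  assumes m: "m \<in> carrier H"
    and ess: "essential Chat (with_smult Chat (monoid.mult Chat)) {c \<in> carrier Chat. endo c m = \<zero>\<^bsub>H\<^esub>}"
      (is "essential _ ?C ?I")
  shows "m = \<zero>\<^bsub>H\<^esub>"
proof -
  define W where "W = {x \<in> carrier H. \<forall>c\<in>?I. endo c x = \<zero>\<^bsub>H\<^esub>}"
  have W: "submodule W R H"
    unfolding H.submodule_iff
    using lhom_zero[OF H.left_module_axioms H.left_module_axioms endo_at(1)]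
    by (auto simp: W_def lhom_add[OF endo_at(1)] lhom_smult[OF endo_at(1)])
  define K where "K = {a \<in> carrier A. \<iota> a \<in> W}"
  have K: "submodule K R M" unfolding K_def by (rule trace_stable[OF W])
  obtain L e where L: "submodule L R M" "essential R M {k \<oplus>\<^bsub>A\<^esub> l |k l. k \<in> K \<and> l \<in> L}"
    and e: "e \<in> lhom R H H" "\<And>k. k \<in> K \<Longrightarrow> e (\<iota> k) = \<iota> k" "\<And>l. l \<in> L \<Longrightarrow> e (\<iota> l) = \<zero>\<^bsub>H\<^esub>"
    by (rule projection[OF K]) blast
  define s where "s = e u"
  have s: "s \<in> Inv" "endo s = e" using endo_value_invariant[OF e(1)] endo_at_value[OF e(1)] by (simp_all add: s_def)
  define J where "J = {d \<otimes>\<^bsub>Chat\<^esub> s |d. d \<in> carrier Chat}"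
  have Cmod: "left_module Chat ?C" by (rule ring_left_module) (rule Chat.ring_axioms)
  have J: "submodule J Chat ?C"
    unfolding left_module.submodule_iff[OF Cmod]
  proof (intro conjI ballI)
    show "J \<subseteq> carrier ?C" using s(1) Chat.m_closed[of _ s] unfolding with_smult_simps J_def by auto
    have "\<zero>\<^bsub>Chat\<^esub> = \<zero>\<^bsub>Chat\<^esub> \<otimes>\<^bsub>Chat\<^esub> s" using s(1) Chat.l_null[of s] by simp
    then show "\<zero>\<^bsub>?C\<^esub> \<in> J" unfolding with_smult_simps J_def using Chat.zero_closed by blast
  next
    fix x y assume "x \<in> J" "y \<in> J"
    then obtain c d where cd: "c \<in> carrier Chat" "d \<in> carrier Chat" "x = c \<otimes>\<^bsub>Chat\<^esub> s" "y = d \<otimes>\<^bsub>Chat\<^esub> s"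
      unfolding J_def by blast
    have "x \<oplus>\<^bsub>?C\<^esub> y = (c \<oplus>\<^bsub>Chat\<^esub> d) \<otimes>\<^bsub>Chat\<^esub> s"
      unfolding with_smult_simps cd(3,4) using s(1) by (intro Chat.l_distr[symmetric] cd) simp
    then show "x \<oplus>\<^bsub>?C\<^esub> y \<in> J" unfolding J_def using Chat.a_closed[OF cd(1,2)] by blast
  next
    fix c x assume c: "c \<in> carrier Chat" and "x \<in> J"
    then obtain d where d: "d \<in> carrier Chat" "x = d \<otimes>\<^bsub>Chat\<^esub> s" unfolding J_def by blast
    have "c \<odot>\<^bsub>?C\<^esub> x = (c \<otimes>\<^bsub>Chat\<^esub> d) \<otimes>\<^bsub>Chat\<^esub> s"
      unfolding with_smult_simps d(2) using s(1) by (intro Chat.m_assoc[symmetric] c d) simp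
    then show "c \<odot>\<^bsub>?C\<^esub> x \<in> J" unfolding J_def using Chat.m_closed[OF c d(1)] by blast
  qed
  have "c = \<zero>\<^bsub>H\<^esub>" if c: "c \<in> ?I" "c \<in> J" for c
  proof -
    obtain d where d: "d \<in> Inv" "c = d \<otimes>\<^bsub>Chat\<^esub> s" using c(2) unfolding J_def by auto
    have cI: "c \<in> Inv" using c(1) by simp
    have ce: "endo c x = e (endo d x)" if "x \<in> carrier H" for x
      using endo_at_apply(2)[OF d(1) s(1) that] d(2) s(2) by simp
    show ?thesis
    proof (rule endo_zero_on[OF cI L(2)])
      fix x assume "x \<in> {k \<oplus>\<^bsub>A\<^esub> l |k l. k \<in> K \<and> l \<in> L}"
      then obtain k l where x: "k \<in> K" "l \<in> L" "x = k \<oplus>\<^bsub>A\<^esub> l" by blast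
      have kl: "k \<in> carrier A" "l \<in> carrier A" using stableD(1)[OF K] stableD(1)[OF L(1)] x by auto
      have "endo c (\<iota> k) = \<zero>\<^bsub>H\<^esub>" using x(1) c(1) by (auto simp: K_def W_def)
      moreover have "endo c (\<iota> l) = \<zero>\<^bsub>H\<^esub>"
        using ce[of "\<iota> l"] kl e(3)[OF x(2)] endo_commute[OF e(1) endo_at(1)[OF d(1)], of "\<iota> l"]
          lhom_zero[OF H.left_module_axioms H.left_module_axioms endo_at(1)[OF d(1)]] by simp
      ultimately show "endo c (\<iota> x) = \<zero>\<^bsub>H\<^esub>"
        using lhom_add[OF endo_at(1)[OF cI], of "\<iota> k" "\<iota> l"] kl x(3) by (simp add: iota_add)
    qed
  qed
  moreover have "\<zero>\<^bsub>H\<^esub> \<in> ?I" "\<zero>\<^bsub>H\<^esub> \<in> J"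
    using submodule_zero[OF essentialD(1)[OF ess]] submodule_zero[OF J] by (simp_all only: with_smult_simps Chat_simps)
  ultimately have "?I \<inter> J = {\<zero>\<^bsub>?C\<^esub>}" by (auto simp: with_smult_simps)
  then have "J = {\<zero>\<^bsub>?C\<^esub>}" by (rule essentialD(2)[OF ess J])
  moreover have "s = \<one>\<^bsub>Chat\<^esub> \<otimes>\<^bsub>Chat\<^esub> s" using s(1) Chat.l_one[of s] by simp
  then have "s \<in> J" unfolding J_def using Chat.one_closed by blast
  ultimately have "s = \<zero>\<^bsub>H\<^esub>" by (simp add: with_smult_simps)
  have "k = \<zero>\<^bsub>A\<^esub>" if "k \<in> K" for k
  proof -
    have k: "k \<in> carrier A" using stableD(1)[OF K] that by auto
    have "\<iota> k = e (\<iota> k)" using e(2)[OF that] by simp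
    also have "\<dots> = lmult A k \<odot>\<^bsub>H\<^esub> s" using endo_iota[OF e(1) k] by (simp add: s_def)
    also have "\<dots> = \<iota> \<zero>\<^bsub>A\<^esub>" using \<open>s = \<zero>\<^bsub>H\<^esub>\<close> mult_B(1)[OF k] by simp
    finally show ?thesis using k iota_eq[of k "\<zero>\<^bsub>A\<^esub>"] by simp
  qed
  then have "K = {\<zero>\<^bsub>A\<^esub>}" using stableD(2)[OF K] by blast
  then have "W = {\<zero>\<^bsub>H\<^esub>}" unfolding K_def by (rule trace_zero[OF W])
  moreover have "m \<in> W" using m by (simp add: W_def)
  ultimately show ?thesis by simp
qed

lemma hull_nonsingular: "nonsingular Chat CH"
proof -
  have Cmod: "left_module Chat (with_smult Chat (monoid.mult Chat))"
    by (rule ring_left_module) (rule Chat.ring_axioms)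
  have "{c \<in> carrier Chat. endo c \<zero>\<^bsub>H\<^esub> = \<zero>\<^bsub>H\<^esub>} = carrier (with_smult Chat (monoid.mult Chat))"
    using lhom_zero[OF H.left_module_axioms H.left_module_axioms endo_at(1)] by (auto simp: with_smult_simps)
  then have "essential Chat (with_smult Chat (monoid.mult Chat)) {c \<in> carrier Chat. endo c \<zero>\<^bsub>H\<^esub> = \<zero>\<^bsub>H\<^esub>}"
    using essential_carrier[OF Cmod] by simp
  then show ?thesis
    unfolding nonsingular_def using CH_module essential_annihilator_zero
    by (auto simp only: with_smult_simps H.M.zero_closed)
qed

subsection \<open>Primeness\<close>

text \<open>From \<open>A\<close> to the hull, traces are taken. In the other direction, \<open>KL = 0\<close> puts \<open>L\<close> into the
  annihilator of \<open>K\<close>. The fixed elements and the kernel of the projection onto \<open>K\<close> are stable,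
  because endomorphisms commute, and they contain \<open>K\<close> and \<open>L\<close>; as two-sided ideals with zero
  intersection they have product zero.\<close>
lemma hull_prime_iff: "B_prime k A B \<longleftrightarrow> B_prime k HA Bhat"
proof
  assume prime: "B_prime k A B"
  show "B_prime k HA Bhat"
    unfolding B_prime_def
  proof (intro allI impI)
    fix K L assume "stable_ideal k HA Bhat K" "stable_ideal k HA Bhat L" and KL: "K \<cdot>\<^bsub>HA\<^esub> L = {\<zero>\<^bsub>HA\<^esub>}"
    then have K: "submodule K R H" and L: "submodule L R H" by (simp_all add: stable_hull_iff)
    let ?K = "{a \<in> carrier A. \<iota> a \<in> K}" and ?L = "{a \<in> carrier A. \<iota> a \<in> L}"
    have "\<forall>x\<in>K. \<forall>y\<in>L. x \<otimes>\<^bsub>HA\<^esub> y = \<zero>\<^bsub>H\<^esub>" using KL hull_prod_zero_iff[OF K L] by simp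
    then have "?K \<cdot>\<^bsub>A\<^esub> ?L = {\<zero>\<^bsub>A\<^esub>}"
      using prod_zero_iff[OF trace_stable[OF K] trace_stable[OF L]] trace_product by blast
    then have "?K = {\<zero>\<^bsub>A\<^esub>} \<or> ?L = {\<zero>\<^bsub>A\<^esub>}"
      using prime trace_stable[OF K] trace_stable[OF L] unfolding B_prime_def stable_ideal_def by blast
    then show "K = {\<zero>\<^bsub>HA\<^esub>} \<or> L = {\<zero>\<^bsub>HA\<^esub>}"
      using trace_zero[OF K] trace_zero[OF L] by auto
  qed
next
  assume prime: "B_prime k HA Bhat"
  show "B_prime k A B"
    unfolding B_prime_def
  proof (intro allI impI)
    fix K L assume "stable_ideal k A B K" "stable_ideal k A B L" and KL: "K \<cdot>\<^bsub>A\<^esub> L = {\<zero>\<^bsub>A\<^esub>}"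
    then have K: "submodule K R M" and L: "submodule L R M" by (simp_all add: stable_ideal_def)
    have "K \<inter> L = {\<zero>\<^bsub>A\<^esub>}" using KL prod_zero_iff[OF K L] annihilate_iff_disjoint[OF K L] by blast
    then have LK: "L \<inter> K = {\<zero>\<^bsub>A\<^esub>}" by blast
    obtain P e where P: "\<And>X. submodule X R M \<Longrightarrow> X \<inter> K = {\<zero>\<^bsub>A\<^esub>} \<Longrightarrow> X \<subseteq> P"
      and e: "e \<in> lhom R H H" "\<And>k. k \<in> K \<Longrightarrow> e (\<iota> k) = \<iota> k" "\<And>l. l \<in> P \<Longrightarrow> e (\<iota> l) = \<zero>\<^bsub>H\<^esub>"
      by (rule projection[OF K]) blast
    define Kh where "Kh = {x \<in> carrier H. e x = x}"
    define Lh where "Lh = {x \<in> carrier H. e x = \<zero>\<^bsub>H\<^esub>}"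
    have KL_sub: "submodule Kh R H" "submodule Lh R H"
      using lhom_equalizer[OF H.left_module_axioms H.left_module_axioms e(1) lhom_id[OF H.left_module_axioms]]
        lhom_kernel[OF H.left_module_axioms H.left_module_axioms e(1)]
      by (simp_all add: Kh_def Lh_def cong: conj_cong)
    have stab: "stable_ideal k HA Bhat Kh" "stable_ideal k HA Bhat Lh"
      unfolding stable_hull_iff using KL_sub endo_commute[OF e(1)] lhom_closed[of _ R H H]
        lhom_zero[OF H.left_module_axioms H.left_module_axioms]
      by (auto simp: Kh_def Lh_def)
    have "x \<otimes>\<^bsub>HA\<^esub> y = \<zero>\<^bsub>H\<^esub>" if x: "x \<in> Kh" and y: "y \<in> Lh" for x y
    proof -
      have c: "x \<in> carrier H" "y \<in> carrier H" using x y by (auto simp: Kh_def Lh_def)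
      have "\<And>\<beta> z. \<beta> \<in> Bhat \<Longrightarrow> z \<in> Kh \<Longrightarrow> \<beta> z \<in> Kh" "\<And>\<beta> z. \<beta> \<in> Bhat \<Longrightarrow> z \<in> Lh \<Longrightarrow> \<beta> z \<in> Lh"
        using stab submodule_smult[of Kh Rhat Mhat] submodule_smult[of Lh Rhat Mhat]
        by (simp_all add: stable_ideal_def Mhat_simps Rhat_simps)
\<comment> \<open>the product lies in both ideals\<close>
      then have "rmult HA y x \<in> Kh" "lmult HA x y \<in> Lh" using HA_mult_Bhat c x y by auto
      then show ?thesis using c by (simp add: Kh_def Lh_def lmult_def rmult_def)
    qed
    then have "Kh \<cdot>\<^bsub>HA\<^esub> Lh = {\<zero>\<^bsub>HA\<^esub>}" using hull_prod_zero_iff[OF KL_sub] by blast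
    then have "Kh = {\<zero>\<^bsub>H\<^esub>} \<or> Lh = {\<zero>\<^bsub>H\<^esub>}"
      using prime stab unfolding B_prime_def by simp
    moreover have "\<iota> k \<in> Kh" if "k \<in> K" for k using e(2)[OF that] stableD(1)[OF K] that by (auto simp: Kh_def)
    moreover have "\<iota> l \<in> Lh" if "l \<in> L" for l
      using e(3)[of l] P[OF L LK] stableD(1)[OF L] that by (auto simp: Lh_def)
    moreover have "a = \<zero>\<^bsub>A\<^esub>" if "a \<in> carrier A" "\<iota> a = \<zero>\<^bsub>H\<^esub>" for a
      using iota_eq[of a "\<zero>\<^bsub>A\<^esub>"] that by simp
    ultimately have "K \<subseteq> {\<zero>\<^bsub>A\<^esub>} \<or> L \<subseteq> {\<zero>\<^bsub>A\<^esub>}"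
      using stableD(1)[OF K] stableD(1)[OF L] by blast
    then show "K = {\<zero>\<^bsub>A\<^esub>} \<or> L = {\<zero>\<^bsub>A\<^esub>}" using stableD(2)[OF K] stableD(2)[OF L] by blast
  qed
qed

end

theorem theorem3p2:
  fixes k :: "'k ring"
    and A :: "('k, 'a) module"
    and B :: "('a \<Rightarrow> 'a) set"
    and R :: "('k, 'a \<Rightarrow> 'a) module"
    and AB :: "('a \<Rightarrow> 'a, 'a) module"
    and E Ahat :: "('a \<Rightarrow> 'a, 'e) module"
    and \<iota> :: "'a \<Rightarrow> 'e"
    and S :: "('e \<Rightarrow> 'e) ring"
    and C :: "('k, 'a) module"
    and Chat :: "'e ring"
    and A\<^sub>C :: "('a, 'a) module"
    and S\<^sub>C :: "('a, 'e \<Rightarrow> 'e) module"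
    and T :: "('a \<Rightarrow> 'a, ('a \<times> ('e \<Rightarrow> 'e) \<Rightarrow>\<^sub>0 int) set) module"
    and \<phi> :: "('a \<times> ('e \<Rightarrow> 'e) \<Rightarrow>\<^sub>0 int) set \<Rightarrow> 'e"
    and HA :: "('k, 'e) module"
    and Bhat :: "('e \<Rightarrow> 'e) set"
  assumes "assoc_algebra k A"
    and "k_subalgebra k (endo_algebra k A) B"
    and "multiplication_algebra k A \<subseteq> B"
    and "B_semiprime k A B"
    \<comment> \<open>\<open>A\<close> as a left \<open>B\<close>-module, its injective hull \<open>E\<close> and its self-injective hull\<close>
    and R: "R = operator_algebra k A B"
    and AB: "AB = operator_module A"
    and "injective_hull R AB E \<iota>"
    and Ahat: "Ahat = self_injective_hull R AB E"
    \<comment> \<open>\<open>End\<^sub>B(Ahat)\<close>, \<open>A\<^sup>B\<close> and \<open>Ahat\<^sup>B\<close>\<close>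
    and S: "S = right_endo_ring R Ahat"
    and C: "C = A\<lparr>carrier := invariants A B AB\<rparr>"
    and Chat: "Chat = invariant_ring k A B Ahat (\<iota> \<one>\<^bsub>A\<^esub>)"
    \<comment> \<open>\<open>A\<close> and \<open>End\<^sub>B(Ahat)\<close> over \<open>A\<^sup>B\<close>, their tensor product as a ring and left \<open>B\<close>-module, and
      the map \<open>a \<otimes> f \<mapsto> (a) f\<close>\<close>
    and A\<^sub>C: "A\<^sub>C = with_smult A (monoid.mult A)"
    and S\<^sub>C: "S\<^sub>C = with_smult S (\<lambda>c f. endo_at R Ahat (\<iota> \<one>\<^bsub>A\<^esub>) (\<iota> c) \<otimes>\<^bsub>S\<^esub> f)"
    and T: "T = with_smult (tensor_algebra C A\<^sub>C S\<^sub>C) (tensor_left_action C A\<^sub>C S\<^sub>C (\<lambda>b x. b x))"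
    and \<phi>: "\<phi> = tensor_lift C A\<^sub>C S\<^sub>C Ahat (\<lambda>a f. f (\<iota> a))"
    \<comment> \<open>the algebra structure on \<open>Ahat\<close>, and the algebra generated by \<open>B\<close> and \<open>Ahat\<^sup>B\<close>\<close>
    and HA: "HA = transported_algebra R T \<phi> Ahat (\<iota> \<one>\<^bsub>A\<^esub>)"
    and Bhat: "Bhat = generated_subalgebra k (endo_algebra k HA)
          ((\<lambda>b. \<lambda>x\<in>carrier Ahat. b \<odot>\<^bsub>Ahat\<^esub> x) ` B \<union>
           endo_at R Ahat (\<iota> \<one>\<^bsub>A\<^esub>) ` carrier Chat)"
  shows
    \<comment> \<open>(1)\<close>
    "is_quotient_module R AB Ahat AB Ahat \<iota> (carrier Ahat) \<and>
     Chat \<simeq> partial_endo_limit R AB \<and>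
    \<comment> \<open>(2)\<close>
     left_module R T \<and> \<phi> \<in> lhom R T Ahat \<and>
     (\<forall>a\<in>carrier A. \<forall>f\<in>carrier S. \<phi> (pure_tensor C A\<^sub>C S\<^sub>C a f) = f (\<iota> a)) \<and>
     ideal (a_kernel T Ahat \<phi>) T \<and>
     ring HA \<and>
     (\<forall>a\<in>carrier A. \<forall>b\<in>carrier A. \<forall>s\<in>carrier Chat. \<forall>t\<in>carrier Chat.
        endo_at R Ahat (\<iota> \<one>\<^bsub>A\<^esub>) s (\<iota> a) \<otimes>\<^bsub>HA\<^esub> endo_at R Ahat (\<iota> \<one>\<^bsub>A\<^esub>) t (\<iota> b) =
        endo_at R Ahat (\<iota> \<one>\<^bsub>A\<^esub>) (s \<otimes>\<^bsub>Chat\<^esub> t) (\<iota> (a \<otimes>\<^bsub>A\<^esub> b))) \<and>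
     \<iota> \<in> ring_hom A HA \<and> inj_on \<iota> (carrier A) \<and>
    \<comment> \<open>the extension of \<open>HA\<close> by \<open>Bhat\<close>\<close>
     lmult HA ` carrier HA \<subseteq> multiplication_algebra k HA \<and>
     multiplication_algebra k HA \<subseteq> Bhat \<and>
     module_structure_extension k HA (operator_algebra k HA Bhat) (lmult HA) (\<lambda>b. b) \<and>
    \<comment> \<open>(3)\<close>
     B_semiprime k HA Bhat \<and>
     self_injective (operator_algebra k HA Bhat) (operator_module HA) \<and>
    \<comment> \<open>(4)\<close>
     nonsingular Chat (with_smult Ahat (endo_at R Ahat (\<iota> \<one>\<^bsub>A\<^esub>))) \<and>
    \<comment> \<open>(5)\<close>
     (B_prime k A B \<longleftrightarrow> B_prime k HA Bhat)"
proof -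
  note setting = R AB Ahat S C Chat A\<^sub>C S\<^sub>C T \<phi> HA
  interpret X: semiprime_extension k A B E \<iota>
    using assms(1-4,7) unfolding R AB by (rule semiprime_extension.intro)
  have Bhat: "Bhat = X.Bhat"
    unfolding X.Bhat_def Bhat setting ..
  show ?thesis
    unfolding Bhat setting
    by (intro conjI ballI X.H_quotient_module X.invariants_limit X.T_left_module X.\<phi>_lhom
        X.kernel_ideal X.HA_ring X.iota_hom X.iota X.lmult_in_multiplication_algebra
        X.multiplication_algebra_in_Bhat X.Bhat_extension X.hull_semiprime X.hull_self_injective_Bhat
        X.hull_nonsingular X.hull_prime_iff)
      (simp_all only: X.\<phi>_pure X.HA_mult_invariants X.S_simps X.Chat_simps)
qed

end
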